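(* Let $n\ge1$, $R>0$, let $\rho_l,\rho_r\ge0$ and let $u_l,u_r$ be arbitrary real numbers. Then the pseudo-Riemann problem $$\partial_t\rho+\partial_r(\rho u)+\tfrac{n-1}{r}\rho u=0,\qquad \partial_t(\rho u)+\partial_r(\rho u^2)+\tfrac{n-1}{r}\rho u^2=0\qquad(r>0,\ t>0),$$ $$(\rho,u)|_{t=0}=\begin{cases}(\rho_l r^{1-n},u_l), & r<R,\\ (\rho_r r^{1-n},u_r), & r>R,\end{cases}$$ has a radially symmetric shadow wave solution that is global (exists for all $t\ge0$), physical and dissipative. At each point of time, the solution consists of at most one shadow wave, one contact discontinuity, three shocks bounding vacuum states, and a delta function at the origin.
   Context: The system is the radial form of the pressureless Euler system in $\mathbb R^n$, with $\rho=\rho(|\vec x|,t)$ and velocity $u(|\vec x|,t)\,\vec x/|\vec x|$. $|\mathbb S^{n-1}|$ denotes the surface area of the unit sphere. Radially symmetric shadow wave solution (global). It is a triple $(\rho^\varepsilon_{sw},u^\varepsilon_{sw},m_0)$ built from: a regular part $(\rho,u)$ on $\{r>0,t>0\}$, piecewise $C^1$ with jumps across finitely many curves; possibly a shadow wave front $r=R+c(t)>0$, $0\le t<T^*$ ($T^*\in(0,\infty]$, $c(0)=0$, $c$ of class $C^1$ and piecewise $C^2$), carrying a continuous, piecewise $C^1$ mass $\sigma(t)$; and a function $m_0(t)$, the mass accumulated at the origin. The pair $(\rho^\varepsilon_{sw},u^\varepsilon_{sw})$ equals $(\sigma(t)/\varepsilon,\dot c(t))$ for $|r-R-c(t)|<\varepsilon/2$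 and $(\rho,u)$ elsewhere. It is required that: (i) the system holds in the weak limit: for all $\phi\in C_c^\infty(\,]0,\infty[\times]0,\infty[\,)$ and $k=0,1$, $$\lim_{\varepsilon\to0}\iint\Big[-\rho^\varepsilon_{sw}(u^\varepsilon_{sw})^k\partial_t\phi-\rho^\varepsilon_{sw}(u^\varepsilon_{sw})^{k+1}\partial_r\phi+\tfrac{n-1}{r}\rho^\varepsilon_{sw}(u^\varepsilon_{sw})^{k+1}\phi\Big]dr\,dt=0.$$ (Where the outer states are $C^1$ at the front this means $\partial_t\sigma+\tfrac{n-1}{R+c}\dot c\,\sigma=\dot c[\rho]-[\rho u]$ and $\partial_t(\sigma\dot c)+\tfrac{n-1}{R+c}\dot c^2\sigma=\dot c[\rho u]-[\rho u^2]$, where $[\cdot]$ is the right-minus-left jump at the front; across jump curves without mass it means the Rankine–Hugoniot conditions.) (ii) the limits $u(0+,t)=\lim_{r\searrow0}u(r,t)$ and $\lim_{r\searrow0}\rho(r,t)r^{n-1}$ exist except possibly at a discrete set of times; (iii) boundary conditions at the origin: if $u(0+,t)>0$, then $\dot m_0(t)=0$ and $\rho(0+,t)=0$ (with $u(0+,t)$ arbitrary); if $u(0+,t)<0$, then $\dot m_0(t)=-\lim_{r\searrow0}r^{n-1}|\mathbb S^{n-1}|\rho(r,t)u(r,t)$; if $u(0+,t)=0$, then $\dot m_0(t)=0$; (iv) if the front reaches the origin at $t_0=T^*<\infty$, i.e. $\lim_{t\nearrow t_0}(R+c(t))=0$, then $m_0(t_0+)=m_0(t_0-)+\lim_{t\nearrow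 t_0}\sigma(t)(R+c(t))^{n-1}|\mathbb S^{n-1}|$; (v) initial data: the weak limit as $\varepsilon\to0$ of $(\rho^\varepsilon_{sw},u^\varepsilon_{sw})(\cdot,t)$ converges to the given data in the sense of distributions on $\{r>0\}$ as $t\searrow0$, and $m_0(0+)=0$. In vacuum regions ($\rho=0$) the velocity may be prescribed arbitrarily. Physical: densities are nonnegative, in particular $\sigma(t)\ge0$. Dissipative: $$\lim_{\varepsilon\to0}\Big(\partial_t\big(\tfrac12\rho^\varepsilon_{sw}(u^\varepsilon_{sw})^2\big)+\partial_r\big(\tfrac12\rho^\varepsilon_{sw}(u^\varepsilon_{sw})^3\big)+\tfrac{n-1}{2r}\rho^\varepsilon_{sw}(u^\varepsilon_{sw})^3\Big)\le0$$ when applied to nonnegative $\phi\in C_c^\infty(\,]0,\infty[\times]0,\infty[\,)$. Terminology for jump curves with $\sigma=0$: a contact discontinuity is a jump curve with equal velocities on both sides, moving with that velocity; a shock bounding a vacuum state is a jump curve with $\rho=0$ on one side, moving with the velocity of the state on the other side. The delta function at the origin is $m_0(t)\delta_{\vec x=0}$. *)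

theory Defs
  imports "HOL-Analysis.Analysis"
begin

text \<open>
  Space-time points are pairs (r, t): radius first, time second.
\<close>

definition quadrant :: "(real \<times> real) set" where
  "quadrant = {0<..} \<times> {0<..}"

text \<open>
  Functions of class C^k on an open set: all directional derivatives up to order k exist in the
  Frechet sense and are continuous.
\<close>

primrec Ck_on :: "nat \<Rightarrow> ('a::euclidean_space \<Rightarrow> real) \<Rightarrow> 'a set \<Rightarrow> bool" where
  "Ck_on 0 f U \<longleftrightarrow> continuous_on U f"
| "Ck_on (Suc k) f U \<longleftrightarrow>
     f differentiable_on U \<and> (\<forall>v. Ck_on k (\<lambda>x. frechet_derivative f (at x) v) U)"

definition test_function :: "'a::euclidean_space set \<Rightarrow> ('a \<Rightarrow> real) \<Rightarrow> bool" where
  "test_function \<Omega> \<phi> \<longleftrightarrow> (\<forall>k. Ck_on k \<phi> UNIV) \<and>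
     (\<exists>K. compact K \<and> K \<subseteq> \<Omega> \<and> (\<forall>x. x \<notin> K \<longrightarrow> \<phi> x = 0))"

text \<open>Surface area of the unit sphere in n-dimensional Euclidean space; it is 2 for n = 1.\<close>

definition sphere_area :: "nat \<Rightarrow> real" where
  "sphere_area n = 2 * pi powr (real n / 2) / Gamma (real n / 2)"

text \<open>
  An arc (a, b, g) stands for the curve r = g(t), a < t < b, where b may be infinite.
\<close>

type_synonym arc = "real \<times> ereal \<times> (real \<Rightarrow> real)"

definition arc_times :: "real \<Rightarrow> ereal \<Rightarrow> real set" where
  "arc_times a b = {t. a < t \<and> ereal t < b}"

definition C1_arc :: "arc \<Rightarrow> bool" where
  "C1_arc A = (case A of (a, b, \<gamma>) \<Rightarrow>
     0 \<le> a \<and> ereal a < b \<and> \<gamma> C1_differentiable_on arc_times a b \<and>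
     (\<forall>t\<in>arc_times a b. 0 < \<gamma> t))"

text \<open>
  Piecewise C^1 on the quadrant: near every point, up to finitely many exceptional points (where
  arcs meet or end), the function is either C^1 or is split by one of the arcs into two parts that
  are C^1 up to the arc. Local boundedness controls the exceptional points.
\<close>

definition piecewise_C1_off :: "arc set \<Rightarrow> (real \<times> real \<Rightarrow> real) \<Rightarrow> bool" where
  "piecewise_C1_off J f \<longleftrightarrow>
     (\<forall>K. compact K \<and> K \<subseteq> quadrant \<longrightarrow> bounded (f ` K)) \<and>
     (\<exists>P. finite P \<and> (\<forall>x\<in>quadrant - P.
        (\<exists>U. open U \<and> x \<in> U \<and> Ck_on 1 f U) \<or>
        (\<exists>(a, b, \<gamma>)\<in>J. snd x \<in> arc_times a b \<and> fst x = \<gamma> (snd x) \<and>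
           (\<exists>U g h. open U \<and> x \<in> U \<and> Ck_on 1 g U \<and> Ck_on 1 h U \<and>
              (\<forall>(r, t)\<in>U. (r < \<gamma> t \<longrightarrow> f (r, t) = g (r, t)) \<and>
                          (\<gamma> t < r \<longrightarrow> f (r, t) = h (r, t)))))))"

text \<open>
  The front is r = R + shift(t), 0 \<le> t < lifetime, with R the position of the initial jump.
\<close>

record sdw_front =
  shift :: "real \<Rightarrow> real"
  lifetime :: ereal
  front_mass :: "real \<Rightarrow> real"

definition front_times :: "sdw_front \<Rightarrow> real set" where
  "front_times F = {t. 0 \<le> t \<and> ereal t < lifetime F}"

definition front_regular :: "real \<Rightarrow> sdw_front \<Rightarrow> bool" where
  "front_regular R F \<longleftrightarrow>
     0 < lifetime F \<and> shift F 0 = 0 \<and> (\<forall>t\<in>front_times F. 0 < R + shift F t) \<and>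
     (\<exists>s. (\<forall>t\<in>front_times F.
             (shift F has_real_derivative s t) (at t within front_times F)) \<and>
          s piecewise_C1_differentiable_on front_times F) \<and>
     front_mass F piecewise_C1_differentiable_on front_times F"

text \<open>
  The fields dens and vel are the regular part of the solution, jump_arcs are its jump curves
  other than the shadow wave front. There is at most one front.
\<close>

record sdw =
  dens :: "real \<times> real \<Rightarrow> real"
  vel :: "real \<times> real \<Rightarrow> real"
  jump_arcs :: "arc set"
  front :: "sdw_front option"
  origin_mass :: "real \<Rightarrow> real"

definition in_layer :: "real \<Rightarrow> real \<Rightarrow> sdw_front \<Rightarrow> real \<times> real \<Rightarrow> bool" where
  "in_layer R \<epsilon> F = (\<lambda>(r, t). t \<in> front_times F \<and> \<bar>r - R - shift F t\<bar> < \<epsilon> / 2)"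

definition sw_dens :: "real \<Rightarrow> sdw \<Rightarrow> real \<Rightarrow> real \<times> real \<Rightarrow> real" where
  "sw_dens R S \<epsilon> x = (case front S of None \<Rightarrow> dens S x
     | Some F \<Rightarrow> if in_layer R \<epsilon> F x then front_mass F (snd x) / \<epsilon> else dens S x)"

definition sw_vel :: "real \<Rightarrow> sdw \<Rightarrow> real \<Rightarrow> real \<times> real \<Rightarrow> real" where
  "sw_vel R S \<epsilon> x = (case front S of None \<Rightarrow> vel S x
     | Some F \<Rightarrow> if in_layer R \<epsilon> F x then deriv (shift F) (snd x) else vel S x)"

definition regular_part :: "real \<Rightarrow> sdw \<Rightarrow> bool" where
  "regular_part R S \<longleftrightarrow>
     finite (jump_arcs S) \<and> (\<forall>A\<in>jump_arcs S. C1_arc A) \<and>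
     (let J = jump_arcs S \<union> {(0, lifetime F, \<lambda>t. R + shift F t) | F. front S = Some F}
      in piecewise_C1_off J (dens S) \<and> piecewise_C1_off J (vel S))"

text \<open>
  The expression d/dt f + d/dr g + (n-1)/r g, tested with \<phi>. Here f and g are families indexed by
  \<epsilon>; integrability is required explicitly because the integral of a non-integrable function is 0
  by convention.
\<close>

definition weak_integrand ::
  "nat \<Rightarrow> (real \<times> real \<Rightarrow> real) \<Rightarrow> (real \<times> real \<Rightarrow> real) \<Rightarrow> (real \<times> real \<Rightarrow> real) \<Rightarrow> real \<times> real \<Rightarrow> real"
where
  "weak_integrand n f g \<phi> = (\<lambda>(r, t).
     - f (r, t) * deriv (\<lambda>s. \<phi> (r, s)) t
     - g (r, t) * deriv (\<lambda>q. \<phi> (q, t)) r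
     + (real n - 1) / r * g (r, t) * \<phi> (r, t))"

definition weak_limit ::
  "nat \<Rightarrow> (real \<Rightarrow> real \<times> real \<Rightarrow> real) \<Rightarrow> (real \<Rightarrow> real \<times> real \<Rightarrow> real) \<Rightarrow>
   (real \<times> real \<Rightarrow> real) \<Rightarrow> real \<Rightarrow> bool"
where
  "weak_limit n f g \<phi> L \<longleftrightarrow>
     (\<forall>\<^sub>F \<epsilon> in at_right 0. set_integrable lborel quadrant (weak_integrand n (f \<epsilon>) (g \<epsilon>) \<phi>)) \<and>
     ((\<lambda>\<epsilon>. LINT x:quadrant|lborel. weak_integrand n (f \<epsilon>) (g \<epsilon>) \<phi> x) \<longlongrightarrow> L) (at_right 0)"

definition weak_solution :: "nat \<Rightarrow> real \<Rightarrow> sdw \<Rightarrow> bool" where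
  "weak_solution n R S \<longleftrightarrow>
     (\<forall>\<phi>. test_function quadrant \<phi> \<longrightarrow> (\<forall>k\<in>{0, 1::nat}.
        weak_limit n (\<lambda>\<epsilon> x. sw_dens R S \<epsilon> x * sw_vel R S \<epsilon> x ^ k)
                     (\<lambda>\<epsilon> x. sw_dens R S \<epsilon> x * sw_vel R S \<epsilon> x ^ (k + 1)) \<phi> 0))"

text \<open>
  Traces and boundary conditions at the origin. Both are imposed outside a locally finite set D of
  times. The value v is u(0+,t).
\<close>

definition origin_conditions :: "nat \<Rightarrow> sdw \<Rightarrow> bool" where
  "origin_conditions n S \<longleftrightarrow>
     (\<exists>D. (\<forall>T. finite (D \<inter> {0..T})) \<and> (\<forall>t>0. t \<notin> D \<longrightarrow>
        (\<exists>v w. ((\<lambda>r. vel S (r, t)) \<longlongrightarrow> v) (at_right 0) \<and>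
               ((\<lambda>r. dens S (r, t) * r ^ (n - 1)) \<longlongrightarrow> w) (at_right 0) \<and>
               (v > 0 \<longrightarrow> (origin_mass S has_real_derivative 0) (at t) \<and>
                          ((\<lambda>r. dens S (r, t)) \<longlongrightarrow> 0) (at_right 0)) \<and>
               (v < 0 \<longrightarrow> (\<exists>q. ((\<lambda>r. r ^ (n - 1) * sphere_area n * dens S (r, t) * vel S (r, t))
                                   \<longlongrightarrow> q) (at_right 0) \<and>
                               (origin_mass S has_real_derivative - q) (at t))) \<and>
               (v = 0 \<longrightarrow> (origin_mass S has_real_derivative 0) (at t)))))"

definition hits_origin :: "real \<Rightarrow> sdw_front \<Rightarrow> real \<Rightarrow> bool" where
  "hits_origin R F t\<^sub>0 \<longleftrightarrow>
     lifetime F = ereal t\<^sub>0 \<and> ((\<lambda>t. R + shift F t) \<longlongrightarrow> 0) (at_left t\<^sub>0)"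

text \<open>
  The mass at the origin jumps by the mass of the front when the latter arrives, and is continuous
  at all other times. (Without continuity, the mass could jump at the exceptional times above.)
\<close>

definition origin_absorption :: "nat \<Rightarrow> real \<Rightarrow> sdw \<Rightarrow> bool" where
  "origin_absorption n R S \<longleftrightarrow>
     (\<forall>t>0. (\<nexists>F. front S = Some F \<and> hits_origin R F t) \<longrightarrow> isCont (origin_mass S) t) \<and>
     (\<forall>F t\<^sub>0. front S = Some F \<and> hits_origin R F t\<^sub>0 \<longrightarrow>
        (\<exists>m M. (origin_mass S \<longlongrightarrow> m) (at_left t\<^sub>0) \<and>
               ((\<lambda>t. front_mass F t * (R + shift F t) ^ (n - 1) * sphere_area n) \<longlongrightarrow> M) (at_left t\<^sub>0) \<and>
               (origin_mass S \<longlongrightarrow> m + M) (at_right t\<^sub>0)))"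

text \<open>
  For a test function \<psi>, L t is the value at \<psi> of the weak limit of f \<epsilon> (., t) as \<epsilon> tends to 0.
\<close>

definition initial_limit :: "(real \<Rightarrow> real \<times> real \<Rightarrow> real) \<Rightarrow> (real \<Rightarrow> real) \<Rightarrow> bool" where
  "initial_limit f f\<^sub>0 \<longleftrightarrow>
     (\<forall>\<psi>. test_function {0<..} \<psi> \<longrightarrow>
        (\<exists>L. (\<forall>\<^sub>F t in at_right 0.
                (\<forall>\<^sub>F \<epsilon> in at_right 0. set_integrable lborel {0<..} (\<lambda>r. f \<epsilon> (r, t) * \<psi> r)) \<and>
                ((\<lambda>\<epsilon>. LINT r:{0<..}|lborel. f \<epsilon> (r, t) * \<psi> r) \<longlongrightarrow> L t) (at_right 0)) \<and>
             (L \<longlongrightarrow> (LINT r:{0<..}|lborel. f\<^sub>0 r * \<psi> r)) (at_right 0)))"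

definition sdw_solution ::
  "nat \<Rightarrow> real \<Rightarrow> (real \<Rightarrow> real) \<Rightarrow> (real \<Rightarrow> real) \<Rightarrow> sdw \<Rightarrow> bool"
where
  "sdw_solution n R \<rho>\<^sub>0 u\<^sub>0 S \<longleftrightarrow>
     regular_part R S \<and> (\<forall>F. front S = Some F \<longrightarrow> front_regular R F) \<and>
     weak_solution n R S \<and> origin_conditions n S \<and> origin_absorption n R S \<and>
     initial_limit (sw_dens R S) \<rho>\<^sub>0 \<and> initial_limit (sw_vel R S) u\<^sub>0 \<and>
     (origin_mass S \<longlongrightarrow> 0) (at_right 0)"

definition physical :: "sdw \<Rightarrow> bool" where
  "physical S \<longleftrightarrow>
     (\<forall>x\<in>quadrant. 0 \<le> dens S x) \<and>
     (\<forall>F. front S = Some F \<longrightarrow> (\<forall>t\<in>front_times F. 0 \<le> front_mass F t)) \<and>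
     (\<forall>t>0. 0 \<le> origin_mass S t)"

definition dissipative :: "nat \<Rightarrow> real \<Rightarrow> sdw \<Rightarrow> bool" where
  "dissipative n R S \<longleftrightarrow>
     (\<forall>\<phi>. test_function quadrant \<phi> \<and> (\<forall>x. 0 \<le> \<phi> x) \<longrightarrow>
        (\<exists>L\<le>0. weak_limit n (\<lambda>\<epsilon> x. 1 / 2 * sw_dens R S \<epsilon> x * sw_vel R S \<epsilon> x ^ 2)
                             (\<lambda>\<epsilon> x. 1 / 2 * sw_dens R S \<epsilon> x * sw_vel R S \<epsilon> x ^ 3) \<phi> L))"

definition contact_discontinuity :: "sdw \<Rightarrow> (real \<Rightarrow> real) \<Rightarrow> real \<Rightarrow> bool" where
  "contact_discontinuity S \<gamma> t \<longleftrightarrow>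
     (\<exists>v. ((\<lambda>r. vel S (r, t)) \<longlongrightarrow> v) (at_left (\<gamma> t)) \<and>
          ((\<lambda>r. vel S (r, t)) \<longlongrightarrow> v) (at_right (\<gamma> t)) \<and>
          (\<gamma> has_real_derivative v) (at t))"

definition vacuum_shock :: "sdw \<Rightarrow> (real \<Rightarrow> real) \<Rightarrow> real \<Rightarrow> bool" where
  "vacuum_shock S \<gamma> t \<longleftrightarrow>
     (\<exists>v. (\<gamma> has_real_derivative v) (at t) \<and>
        ((\<forall>\<^sub>F r in at_left (\<gamma> t). dens S (r, t) = 0) \<and>
           ((\<lambda>r. vel S (r, t)) \<longlongrightarrow> v) (at_right (\<gamma> t)) \<or>
         (\<forall>\<^sub>F r in at_right (\<gamma> t). dens S (r, t) = 0) \<and>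
           ((\<lambda>r. vel S (r, t)) \<longlongrightarrow> v) (at_left (\<gamma> t))))"

text \<open>
  The jump curves without mass that are present at time t. A front counts as a shadow wave only
  while its mass is nonzero; otherwise it is treated like the other jump curves.
\<close>

definition massless_curves :: "real \<Rightarrow> sdw \<Rightarrow> real \<Rightarrow> (real \<Rightarrow> real) set" where
  "massless_curves R S t =
     {\<gamma>. \<exists>a b. (a, b, \<gamma>) \<in> jump_arcs S \<and> t \<in> arc_times a b} \<union>
     {(\<lambda>s. R + shift F s) | F. front S = Some F \<and> t \<in> front_times F \<and> front_mass F t = 0}"

text \<open>
  A jump curve can be a contact discontinuity and bound a vacuum state at the same time, so the
  curves are distributed among the two kinds. Besides these curves the solution has by
  construction only the (at most one) shadow wave and the delta function at the origin.
\<close>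

definition wave_structure :: "real \<Rightarrow> sdw \<Rightarrow> bool" where
  "wave_structure R S \<longleftrightarrow>
     (\<forall>t>0. \<exists>C V. massless_curves R S t = C \<union> V \<and>
        finite C \<and> card C \<le> 1 \<and> (\<forall>\<gamma>\<in>C. contact_discontinuity S \<gamma> t) \<and>
        finite V \<and> card V \<le> 3 \<and> (\<forall>\<gamma>\<in>V. vacuum_shock S \<gamma> t))"

end

theory Submission
  imports Defs
begin

text \<open>
  For densities of the form \<open>p / r ^ (n - 1)\<close> the geometric source terms disappear after replacing a test
  function \<open>\<phi>\<close> by \<open>\<psi> = \<phi> / r ^ (n - 1)\<close>, so everything reduces to the one-dimensional pressureless
  system with piecewise constant states. If \<open>u\<^sub>r < u\<^sub>l\<close> and both densities are positive, a front carrying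
  mass forms; it moves with constant speed until the vacuum expanding from the origin with speed \<open>u\<^sub>l\<close> has
  swallowed the whole left state, and from then on its excess momentum relative to \<open>u\<^sub>r\<close> is conserved, which
  determines it explicitly. In all other cases the states are transported freely. The origin collects
  whatever mass arrives there.
\<close>

section \<open>Integration along moving curves\<close>

text \<open>With \<open>N = n - 1\<close>, the radial derivative of
  \<open>\<phi> = r ^ N * \<psi>\<close> contains \<open>N / r * \<phi>\<close>, which cancels the
  source term; the factor \<open>r ^ N\<close> left over cancels the weight of the density. While
  both states feed the front at constant speed \<open>w\<close>, the balances of mass and momentum
  give \<open>rl * (ul - w)^2 = rr * (w - ur)^2\<close>, so \<open>w\<close> is the mean of
  \<open>ul\<close> and \<open>ur\<close> with weights \<open>sqrt rl\<close> and
  \<open>sqrt rr\<close>. Once the left state is used up, \<open>m * (s - ur) = K\<close> and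
  \<open>m' = rr * (s - ur)\<close>, hence \<open>(m^2)' = 2 * rr * K\<close>: the mass is a square
  root of a linear function, and the position follows by integration. Tested with the
  \<open>k\<close>-th power of the velocity, the weak form always tends to an integral along the
  front of the defect in the balance of \<open>m * s ^ k\<close>. It is computed once for all
  \<open>k\<close>: \<open>k = 0, 1\<close> give the two equations, \<open>k = 2\<close> the energy
  loss. The obstacle is the origin, where \<open>1 / r ^ N\<close> blows up and \<open>X\<close> may
  become nonpositive. Test functions vanish for \<open>r < d\<close>, so the profiles can be
  continued past the arrival time and cut off at \<open>d / 2\<close>.\<close>

lemma borel_measurable_fst_snd [measurable]:
  "(fst :: real \<times> real \<Rightarrow> real) \<in> borel_measurable borel"
  "(snd :: real \<times> real \<Rightarrow> real) \<in> borel_measurable borel"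
  by (intro borel_measurable_continuous_onI continuous_intros)+

lemma borel_measurable_shear:
  fixes X :: "real \<Rightarrow> real"
  assumes [measurable]: "X \<in> borel_measurable borel"
  shows "(\<lambda>x. (X (snd x) + c * fst x, snd x)) \<in> borel_measurable borel"
  by (intro borel_measurable_Pair) measurable

text \<open>For each fixed time the map is affine in the radius with slope \<open>c\<close>, so
  Tonelli reduces the claim to a one-dimensional affine substitution.\<close>

lemma distr_shear:
  fixes X :: "real \<Rightarrow> real"
  assumes [measurable]: "X \<in> borel_measurable borel" and c: "0 < c"
  shows "distr (lborel :: (real \<times> real) measure) borel (\<lambda>x. (X (snd x) + c * fst x, snd x))
       = density lborel (\<lambda>_. ennreal (1 / c))"
proof (rule measure_eqI)
  fix A :: "(real \<times> real) set"
  assume "A \<in> sets (distr lborel borel (\<lambda>x. (X (snd x) + c * fst x, snd x)))"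
  then have A[measurable]: "A \<in> sets borel" by simp
  have "emeasure (distr lborel borel (\<lambda>x. (X (snd x) + c * fst x, snd x))) A
      = (\<integral>\<^sup>+x. indicator A (X (snd x) + c * fst x, snd x) \<partial>lborel)"
  proof -
    have "emeasure (distr lborel borel (\<lambda>x. (X (snd x) + c * fst x, snd x))) A
        = (\<integral>\<^sup>+x. indicator A x \<partial>distr lborel borel (\<lambda>x. (X (snd x) + c * fst x, snd x)))"
      by (subst nn_integral_indicator) simp_all
    also have "\<dots> = (\<integral>\<^sup>+x. indicator A (X (snd x) + c * fst x, snd x) \<partial>lborel)"
      using borel_measurable_shear[OF assms(1), of c] by (intro nn_integral_distr) auto
    finally show ?thesis .
  qed
  also have "\<dots> = (\<integral>\<^sup>+t. \<integral>\<^sup>+q. indicator A (X t + c * q, t) \<partial>lborel \<partial>lborel)"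
    unfolding lborel_prod[symmetric] by (subst lborel_pair.nn_integral_snd[symmetric]) (auto simp: borel_prod)
  also have "\<dots> = (\<integral>\<^sup>+t. ennreal (1/c) * \<integral>\<^sup>+r. indicator A (r, t) \<partial>lborel \<partial>lborel)"
  proof (intro nn_integral_cong)
    fix t :: real
    have "ennreal (1/c) * (\<integral>\<^sup>+r. indicator A (r, t) \<partial>lborel)
       = ennreal (1/c) * (ennreal c * (\<integral>\<^sup>+q. indicator A (X t + c * q, t) \<partial>lborel))"
      using c by (subst nn_integral_real_affine[where c = c and t = "X t"]) auto
    then show "(\<integral>\<^sup>+q. indicator A (X t + c * q, t) \<partial>lborel)
       = ennreal (1/c) * (\<integral>\<^sup>+r. indicator A (r, t) \<partial>lborel)"
      using c by (simp add: mult.assoc[symmetric] ennreal_mult[symmetric])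
  qed
  also have "\<dots> = ennreal (1/c) * (\<integral>\<^sup>+t. \<integral>\<^sup>+r. indicator A (r, t) \<partial>lborel \<partial>lborel)"
    by (subst nn_integral_cmult) (auto simp: borel_prod)
  also have "\<dots> = ennreal (1/c) * emeasure lborel A"
  proof -
    have "(\<integral>\<^sup>+t. \<integral>\<^sup>+r. indicator A (r, t) \<partial>lborel \<partial>lborel) = (\<integral>\<^sup>+x. indicator A x \<partial>(lborel \<Otimes>\<^sub>M lborel))"
      by (subst lborel_pair.nn_integral_snd[symmetric]) (auto simp: borel_prod lborel_prod)
    then show ?thesis by (simp add: lborel_prod)
  qed
  also have "\<dots> = emeasure (density lborel (\<lambda>_. ennreal (1 / c))) A"
    by (simp add: emeasure_density_const)
  finally show "emeasure (distr lborel borel (\<lambda>x. (X (snd x) + c * fst x, snd x))) A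
      = emeasure (density lborel (\<lambda>_. ennreal (1 / c))) A" .
qed simp

text \<open>Two values of \<open>c\<close> matter later: \<open>c = e\<close> stretches a layer of
  width \<open>e\<close> around the curve to unit width, and \<open>c = 1\<close> straightens the
  curve to a line of constant radius.\<close>

lemma
  fixes X :: "real \<Rightarrow> real" and f :: "real \<times> real \<Rightarrow> real"
  assumes X[measurable]: "X \<in> borel_measurable borel" and f[measurable]: "f \<in> borel_measurable borel" and c: "0 < c"
  shows integrable_shear: "integrable lborel f \<longleftrightarrow> integrable lborel (\<lambda>x. f (X (snd x) + c * fst x, snd x))"
    and integral_shear: "(LINT x|lborel. f x) = c * (LINT x|lborel. f (X (snd x) + c * fst x, snd x))"
proof -
  have m: "(\<lambda>x. (X (snd x) + c * fst x, snd x)) \<in> borel_measurable (lborel :: (real \<times> real) measure)"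
    using borel_measurable_shear[OF X, of c] by simp
  have "integrable lborel (\<lambda>x. f (X (snd x) + c * fst x, snd x)) \<longleftrightarrow>
     integrable (density lborel (\<lambda>_. ennreal (1 / c))) f"
    unfolding distr_shear[OF X c, symmetric] by (subst integrable_distr_eq[OF m f]) simp
  also have "\<dots> \<longleftrightarrow> integrable lborel f"
  proof -
    have "integrable lborel (\<lambda>x. f x / c) \<longleftrightarrow> integrable lborel f"
      using integrable_mult_right[of c lborel "\<lambda>x. f x / c"] c by (intro iffI) simp_all
    then show ?thesis
      using c by (subst integrable_density) simp_all
  qed
  finally show "integrable lborel f \<longleftrightarrow> integrable lborel (\<lambda>x. f (X (snd x) + c * fst x, snd x))" by simp
  have "(LINT x|lborel. f (X (snd x) + c * fst x, snd x)) =
     (LINT x|density lborel (\<lambda>_. ennreal (1 / c)). f x)"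
    unfolding distr_shear[OF X c, symmetric] by (subst integral_distr[OF m f]) simp
  also have "\<dots> = (1/c) * (LINT x|lborel. f x)"
    using c by (subst integral_density) auto
  finally show "(LINT x|lborel. f x) = c * (LINT x|lborel. f (X (snd x) + c * fst x, snd x))"
    using c by simp
qed

lemma integrable_bounded_support:
  fixes f :: "'a::euclidean_space \<Rightarrow> real"
  assumes "f \<in> borel_measurable borel" and "bounded K"
    and "\<And>x. x \<notin> K \<Longrightarrow> f x = 0" and "\<And>x. x \<in> K \<Longrightarrow> \<bar>f x\<bar> \<le> C"
  shows "integrable lborel f"
proof -
  obtain a b where K: "K \<subseteq> cbox a b" using bounded_subset_cbox_symmetric[OF assms(2)] by blast
  have "integrable lborel (\<lambda>x. \<bar>C\<bar> * indicator (cbox a b) x :: real)"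
    by (intro integrable_mult_right integrable_real_indicator) (auto simp: emeasure_lborel_cbox_eq)
  then show ?thesis
  proof (rule Bochner_Integration.integrable_bound)
    show "AE x in lborel. norm (f x) \<le> norm (\<bar>C\<bar> * indicator (cbox a b) x :: real)"
    proof (intro AE_I2)
      fix x show "norm (f x) \<le> norm (\<bar>C\<bar> * indicator (cbox a b) x :: real)"
        using assms(3,4)[of x] K by (cases "x \<in> K") (auto simp: indicator_def)
    qed
  qed (use assms(1) in simp)
qed

text \<open>Dominated convergence along a real parameter: the limit is tested on sequences
  approaching \<open>a\<close> from the right. The bound holds only for parameters below
  \<open>b\<close>, so the first \<open>N\<close> terms of a sequence are dropped.\<close>

lemma tendsto_integral_at_right:
  fixes f :: "real \<Rightarrow> 'a \<Rightarrow> real"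
  assumes m: "\<And>e. f e \<in> borel_measurable M" "g \<in> borel_measurable M" and w: "integrable M w"
    and lim: "AE x in M. ((\<lambda>e. f e x) \<longlongrightarrow> g x) (at_right a)"
    and bd: "a < b" "\<And>e x. a < e \<Longrightarrow> e < b \<Longrightarrow> \<bar>f e x\<bar> \<le> w x"
  shows "((\<lambda>e. LINT x|M. f e x) \<longlongrightarrow> (LINT x|M. g x)) (at_right a)"
  unfolding tendsto_at_iff_sequentially
proof (intro allI impI)
  fix Y :: "nat \<Rightarrow> real"
  assume Y: "\<forall>i. Y i \<in> {a<..} - {a}" "Y \<longlonglongrightarrow> a"
  then have "\<forall>\<^sub>F i in sequentially. Y i < b"
    using bd(1) by (intro order_tendstoD)
  then obtain N where N: "\<And>i. i \<ge> N \<Longrightarrow> Y i < b" by (auto simp: eventually_sequentially)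
  have Y': "filterlim (\<lambda>i. Y (i + N)) (at_right a) sequentially"
    using Y LIMSEQ_ignore_initial_segment[OF Y(2), of N] by (auto simp: filterlim_at intro!: always_eventually)
  have "(\<lambda>i. LINT x|M. f (Y (i + N)) x) \<longlonglongrightarrow> (LINT x|M. g x)"
  proof (rule integral_dominated_convergence[where w = w])
    show "AE x in M. (\<lambda>i. f (Y (i + N)) x) \<longlonglongrightarrow> g x"
      using lim by eventually_elim (rule filterlim_compose[OF _ Y'])
    show "AE x in M. norm (f (Y (i + N)) x) \<le> w x" for i
      using bd(2)[of "Y (i + N)"] N[of "i + N"] Y(1) by (intro AE_I2) auto
  qed (use m w in auto)
  then show "((\<lambda>e. LINT x|M. f e x) \<circ> Y) \<longlonglongrightarrow> (LINT x|M. g x)"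
    by (auto simp: o_def intro: LIMSEQ_offset)
qed

text \<open>At each fixed time the graph is a single point, hence null; Fubini does the
  rest.\<close>

lemma AE_off_graph:
  fixes X :: "real \<Rightarrow> real"
  assumes [measurable]: "X \<in> borel_measurable borel"
  shows "AE x in (lborel :: (real \<times> real) measure). fst x \<noteq> X (snd x)"
proof -
  have *: "{x \<in> space (lborel \<Otimes>\<^sub>M lborel). fst x \<noteq> X (snd x)} \<in> sets (lborel \<Otimes>\<^sub>M lborel)"
    unfolding lborel_prod by measurable
  have "AE t in lborel. AE r in lborel. r \<noteq> X t"
    by (intro AE_I2 AE_lborel_singleton)
  then have "AE r in lborel. AE t in lborel. r \<noteq> X t"
    by (subst lborel_pair.AE_commute[where P = "\<lambda>r t. r \<noteq> X t", OF *])
  then show ?thesis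
    unfolding lborel_prod[symmetric] by (subst lborel_pair.AE_pair_iff[where P = "\<lambda>r t. r \<noteq> X t", OF *, symmetric])
qed

text \<open>Every integration by parts below rests on this form of the fundamental theorem. The
  finite set \<open>E\<close> admits the kink of the profiles at the time when the left state runs
  out.\<close>

lemma lborel_integral_derivative_eq_0:
  fixes F f :: "real \<Rightarrow> real"
  assumes F: "continuous_on UNIV F" and E: "finite E"
    and D: "\<And>t. t \<notin> E \<Longrightarrow> (F has_real_derivative f t) (at t)"
    and supp: "\<And>t. t \<notin> {a..b} \<Longrightarrow> F t = 0" "\<And>t. t \<notin> {a..b} \<Longrightarrow> f t = 0"
    and f: "integrable lborel f"
  shows "(LINT t|lborel. f t) = 0"
proof -
  \<comment> \<open>Both endpoints lie outside \<open>{a..b}\<close>, also when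
    \<open>a > b\<close>, so the boundary terms vanish.\<close>
  define A B where "A = min a b - 1" and "B = max a b + 1"
  have AB: "A \<le> B" "A \<notin> {a..b}" "B \<notin> {a..b}" "{a..b} \<subseteq> {A..B}"
    by (auto simp: A_def B_def)
  have "(f has_integral F B - F A) {A..B}"
  proof (rule fundamental_theorem_of_calculus_interior_strong[OF E AB(1)])
    show "(F has_vector_derivative f t) (at t)" if "t \<in> {A<..<B} - E" for t
      using D[of t] that by (simp add: has_real_derivative_iff_has_vector_derivative)
  qed (rule continuous_on_subset[OF F subset_UNIV])
  then have "(f has_integral 0) {A..B}" using supp(1)[OF AB(2)] supp(1)[OF AB(3)] by simp
  then have "(f has_integral 0) UNIV"
    by (rule has_integral_on_superset) (use AB(4) in \<open>auto intro: supp(2)\<close>)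
  moreover have "(f has_integral (LINT t|lborel. f t)) UNIV"
    by (rule has_integral_integral_lborel[OF f])
  ultimately show ?thesis by (rule has_integral_unique[symmetric])
qed

text \<open>
  Rescaling the layer to unit width turns the limit into a dominated convergence.
\<close>

lemma
  fixes X :: "real \<Rightarrow> real" and h :: "real \<times> real \<Rightarrow> real"
  assumes X[measurable]: "X \<in> borel_measurable borel" and h[measurable]: "h \<in> borel_measurable borel"
    and bd: "\<And>x. \<bar>h x\<bar> \<le> C" and K: "bounded K" "\<And>x. x \<notin> K \<Longrightarrow> h x = 0"
  shows integrable_layer: "0 < e \<Longrightarrow>
      integrable lborel (\<lambda>x. indicator {-(e/2)<..<e/2} (fst x - X (snd x)) * h x / e)"
    and tendsto_layer: "(\<And>t. isCont (\<lambda>r. h (r, t)) (X t)) \<Longrightarrow>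
      ((\<lambda>e. LINT x|lborel. indicator {-(e/2)<..<e/2} (fst x - X (snd x)) * h x / e)
        \<longlongrightarrow> (LINT t|lborel. h (X t, t))) (at_right 0)"
proof -
  define g where "g e x = indicator {-(e/2)<..<e/2} (fst x - X (snd x)) * h x / e" for e x
  have g_meas[measurable]: "g e \<in> borel_measurable borel" for e
    unfolding g_def by measurable
  have "0 \<le> C" using bd[of undefined] by linarith
  show int: "integrable lborel (\<lambda>x. indicator {-(e/2)<..<e/2} (fst x - X (snd x)) * h x / e)" if "0 < e" for e
  proof (rule integrable_bounded_support[OF _ K(1), of _ "C / e"])
    show "\<bar>indicator {-(e/2)<..<e/2} (fst x - X (snd x)) * h x / e\<bar> \<le> C / e" for x
      using bd[of x] that \<open>0 \<le> C\<close> by (auto simp: indicator_def divide_right_mono)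
  qed (use K in auto)
  assume cont: "\<And>t. isCont (\<lambda>r. h (r, t)) (X t)"
  \<comment> \<open>This is \<open>g e\<close> after the substitution
    \<open>r = X t + e * q\<close>: the Jacobian \<open>e\<close> has absorbed the factor
    \<open>1 / e\<close>. Unlike \<open>g\<close>, it makes sense at \<open>e = 0\<close>, and that
    value is the limit integrand.\<close>
  define g' where "g' e x = indicator {-(1/2)<..<1/2::real} (fst x) * h (X (snd x) + e * fst x, snd x)" for e x
  have sh: "(\<lambda>x. (X (snd x) + e * fst x, snd x)) \<in> borel_measurable borel" for e
    by (rule borel_measurable_shear[OF X])
  have [measurable]: "(\<lambda>x. h (X (snd x) + e * fst x, snd x)) \<in> borel_measurable borel" for e
    by (rule measurable_compose[OF sh h])
  have g'_meas[measurable]: "g' e \<in> borel_measurable borel" for e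
    unfolding g'_def by measurable
  have eq: "(LINT x|lborel. g e x) = (LINT x|lborel. g' e x)" if "0 < e" for e
  proof -
    have "-(e/2) < e * q \<longleftrightarrow> -(1/2) < q" "e * q < e / 2 \<longleftrightarrow> q < 1/2" for q
      using mult_less_cancel_left_pos[OF that, of "-(1/2)" q] mult_less_cancel_left_pos[OF that, of q "1/2"] by simp_all
    then have *: "e * g e (X (snd x) + e * fst x, snd x) = g' e x" for x
      using that by (auto simp: g_def g'_def indicator_def)
    have "(LINT x|lborel. g e x) = e * (LINT x|lborel. g e (X (snd x) + e * fst x, snd x))"
      by (rule integral_shear[OF X g_meas that])
    also have "\<dots> = (LINT x|lborel. e * g e (X (snd x) + e * fst x, snd x))"
      by (rule integral_mult_right_zero[symmetric])
    finally show ?thesis by (simp only: *)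
  qed
  obtain L where L: "snd ` K \<subseteq> cbox (-L) L"
    using bounded_subset_cbox_symmetric[OF bounded_snd[OF K(1)]] by blast
  \<comment> \<open>A fixed box containing the supports of all \<open>g' e\<close>: the layer has
    unit width in \<open>q\<close>, and the times come from the support of \<open>h\<close>. This
    makes the dominating function independent of \<open>e\<close>.\<close>
  define J where "J = cbox (-(1/2), -L) (1/2::real, L)"
  have lim: "((\<lambda>e. LINT x|lborel. g' e x) \<longlongrightarrow> (LINT x|lborel. g' 0 x)) (at_right 0)"
  proof (rule tendsto_integral_at_right[where b = 1 and w = "\<lambda>x. C * indicator J x"])
    show "integrable lborel (\<lambda>x. C * indicator J x)"
      unfolding J_def by (intro integrable_mult_right integrable_real_indicator) (auto simp: emeasure_lborel_cbox_eq)
    show "AE x in lborel. ((\<lambda>e. g' e x) \<longlongrightarrow> g' 0 x) (at_right 0)"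
    proof (intro AE_I2)
      fix x :: "real \<times> real"
      have "((\<lambda>e. X (snd x) + e * fst x) \<longlongrightarrow> X (snd x) + 0 * fst x) (at_right 0)"
        by (intro tendsto_intros)
      then have "((\<lambda>e. h (X (snd x) + e * fst x, snd x)) \<longlongrightarrow> h (X (snd x), snd x)) (at_right 0)"
        using isCont_tendsto_compose[OF cont] by simp
      then show "((\<lambda>e. g' e x) \<longlongrightarrow> g' 0 x) (at_right 0)"
        unfolding g'_def by (auto intro!: tendsto_intros)
    qed
    show "\<bar>g' e x\<bar> \<le> C * indicator J x" for e x
    proof (cases "h (X (snd x) + e * fst x, snd x) = 0")
      case False
      then have "(X (snd x) + e * fst x, snd x) \<in> K" using K(2) by blast
      then have "snd x \<in> cbox (-L) L" using L by force
      then show ?thesis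
        using bd[of "(X (snd x) + e * fst x, snd x)"] \<open>0 \<le> C\<close>
        by (auto simp: g'_def J_def indicator_def cbox_Pair_eq mem_Times_iff)
    qed (use \<open>0 \<le> C\<close> in \<open>auto simp: g'_def\<close>)
  qed auto
  have int0: "integrable lborel (g' 0)"
  proof (rule integrable_bounded_support[of _ J C])
    show "bounded J" by (simp add: J_def)
    show "\<bar>g' 0 x\<bar> \<le> C" for x using bd[of "(X (snd x), snd x)"] \<open>0 \<le> C\<close> by (auto simp: g'_def indicator_def)
    show "g' 0 x = 0" if "x \<notin> J" for x
    proof (rule ccontr)
      assume "g' 0 x \<noteq> 0"
      then have "-(1/2) < fst x" "fst x < 1/2" "h (X (snd x), snd x) \<noteq> 0"
        by (auto simp: g'_def indicator_def split: if_splits)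
      moreover from this have "snd x \<in> cbox (-L) L" using L K(2)[of "(X (snd x), snd x)"] by force
      ultimately show False using that by (cases x) (auto simp: J_def cbox_Pair_eq)
    qed
  qed auto
  have "(LINT x|lborel. g' 0 x) = (LINT t|lborel. LINT q|lborel. g' 0 (q, t))"
    using int0 unfolding lborel_prod[symmetric]
    by (subst lborel_pair.integral_snd) auto
  also have "\<dots> = (LINT t|lborel. h (X t, t))"
    by (simp add: g'_def)
  finally have g'0: "(LINT x|lborel. g' 0 x) = (LINT t|lborel. h (X t, t))" .
  have "((\<lambda>e. LINT x|lborel. g e x) \<longlongrightarrow> (LINT t|lborel. h (X t, t))) (at_right 0)"
    using lim unfolding g'0
    by (rule Lim_transform_eventually)
      (use eq in \<open>auto simp: eventually_at_right_field intro!: exI[of _ 1]\<close>)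
  then show "((\<lambda>e. LINT x|lborel. indicator {-(e/2)<..<e/2} (fst x - X (snd x)) * h x / e)
        \<longlongrightarrow> (LINT t|lborel. h (X t, t))) (at_right 0)"
    by (simp add: g_def)
qed

section \<open>Integration by parts against compactly supported functions\<close>

lemma continuous_zero_off_compact_bounded:
  fixes f :: "'a::metric_space \<Rightarrow> real"
  assumes f: "continuous_on UNIV f" and K: "compact K" "\<And>x. x \<notin> K \<Longrightarrow> f x = 0"
  shows "\<exists>C\<ge>0. \<forall>x. \<bar>f x\<bar> \<le> C"
proof -
  have "bounded (f ` K)"
    by (intro compact_imp_bounded compact_continuous_image continuous_on_subset[OF f] K(1)) auto
  then obtain C where C: "\<And>x. x \<in> K \<Longrightarrow> \<bar>f x\<bar> \<le> C" by (auto simp: bounded_iff)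
  have "\<bar>f x\<bar> \<le> max C 0" for x using C[of x] K(2)[of x] by (cases "x \<in> K") auto
  then show ?thesis by (intro exI[of _ "max C 0"]) simp
qed

text \<open>
  The derivatives are given as functions because \<open>\<psi>\<close> will be a test function divided by a power of the
  radius, extended by zero.
\<close>

locale test_pair =
  fixes \<psi> \<psi>r \<psi>t :: "real \<times> real \<Rightarrow> real" and d M :: real
  assumes deriv: "\<And>x. (\<psi> has_derivative (\<lambda>h. fst h * \<psi>r x + snd h * \<psi>t x)) (at x)"
    and cont_r: "continuous_on UNIV \<psi>r" and cont_t: "continuous_on UNIV \<psi>t"
    and supp: "\<And>x. x \<notin> {d..M} \<times> {d..M} \<Longrightarrow> \<psi> x = 0 \<and> \<psi>r x = 0 \<and> \<psi>t x = 0"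
    and d_pos: "0 < d"
begin

lemma outside:
  assumes "r \<notin> {d..M} \<or> t \<notin> {d..M}"
  shows "\<psi> (r, t) = 0" "\<psi>r (r, t) = 0" "\<psi>t (r, t) = 0"
  using assms supp[of "(r, t)"] by auto

lemma cont_psi: "continuous_on UNIV \<psi>"
  using deriv by (meson continuous_at_imp_continuous_on has_derivative_continuous)

lemma psi_measurable [measurable]:
  "\<psi> \<in> borel_measurable borel" "\<psi>r \<in> borel_measurable borel" "\<psi>t \<in> borel_measurable borel"
  using cont_psi cont_r cont_t by (auto intro: borel_measurable_continuous_onI)

lemma bounded_box: "bounded ({d..M} \<times> {d..M})"
  by (intro bounded_Times) auto

lemma bounds: obtains C where "0 \<le> C" "\<And>x. \<bar>\<psi> x\<bar> \<le> C" "\<And>x. \<bar>\<psi>r x\<bar> \<le> C" "\<And>x. \<bar>\<psi>t x\<bar> \<le> C"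
proof -
  have K: "compact ({d..M} \<times> {d..M})" by (intro compact_Times) auto
  have 0: "\<psi> x = 0" "\<psi>r x = 0" "\<psi>t x = 0" if "x \<notin> {d..M} \<times> {d..M}" for x
    using supp[OF that] by simp_all
  obtain C1 where C1: "0 \<le> C1" "\<And>x. \<bar>\<psi> x\<bar> \<le> C1"
    using continuous_zero_off_compact_bounded[OF cont_psi K 0(1)] by blast
  obtain C2 where C2: "0 \<le> C2" "\<And>x. \<bar>\<psi>r x\<bar> \<le> C2"
    using continuous_zero_off_compact_bounded[OF cont_r K 0(2)] by blast
  obtain C3 where C3: "0 \<le> C3" "\<And>x. \<bar>\<psi>t x\<bar> \<le> C3"
    using continuous_zero_off_compact_bounded[OF cont_t K 0(3)] by blast
  show ?thesis
  proof (rule that[of "C1 + C2 + C3"])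
    fix x
    show "\<bar>\<psi> x\<bar> \<le> C1 + C2 + C3" using C1(2)[of x] C2(1) C3(1) by linarith
    show "\<bar>\<psi>r x\<bar> \<le> C1 + C2 + C3" using C2(2)[of x] C1(1) C3(1) by linarith
    show "\<bar>\<psi>t x\<bar> \<le> C1 + C2 + C3" using C3(2)[of x] C1(1) C2(1) by linarith
  qed (use C1 C2 C3 in linarith)
qed

lemma deriv_along:
  assumes "(\<gamma> has_real_derivative v) (at t)"
  shows "((\<lambda>t. \<psi> (\<gamma> t, t)) has_real_derivative \<psi>t (\<gamma> t, t) + v * \<psi>r (\<gamma> t, t)) (at t)"
proof -
  have "((\<lambda>t. (\<gamma> t, t)) has_derivative (\<lambda>h. (h * v, h))) (at t)"
    using assms by (intro has_derivative_Pair has_derivative_ident) (simp add: has_field_derivative_def mult.commute[of _ v])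
  from has_derivative_compose[OF this deriv]
  show ?thesis
    unfolding has_field_derivative_def by (rule has_derivative_eq_rhs) (simp add: fun_eq_iff algebra_simps)
qed

lemma deriv_r: "((\<lambda>r. \<psi> (r, t)) has_real_derivative \<psi>r (r, t)) (at r)"
proof -
  have "((\<lambda>r. (r, t)) has_derivative (\<lambda>h. (h, 0))) (at r)"
    by (intro has_derivative_Pair has_derivative_ident has_derivative_const)
  from has_derivative_compose[OF this deriv]
  show ?thesis by (simp add: has_field_derivative_def mult.commute[of _ "\<psi>r (r, t)"])
qed

lemma half_line_integrable:
  assumes [measurable]: "A \<in> sets borel"
  shows "integrable lborel (\<lambda>r. indicator A (r - c) * \<psi>r (r, t))"
proof -
  obtain C where C: "\<And>x. \<bar>\<psi>r x\<bar> \<le> C" using bounds by metis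
  show ?thesis
    by (rule integrable_bounded_support[of _ "{d..M}" C])
      (use C order_trans[OF abs_ge_zero C] in \<open>auto simp: indicator_def outside\<close>)
qed

text \<open>The complementary half-line is integrated from a point below the support up to
  \<open>c\<close>, which gives \<open>\<psi> (c, t)\<close>; the integral over the whole line is
  zero.\<close>

lemma half_line_gt: "(LINT r|lborel. indicator {0<..} (r - c) * \<psi>r (r, t)) = - \<psi> (c, t)"
proof -
  define a where "a = min c d - 1"
  have "((\<lambda>r. \<psi>r (r, t)) has_integral \<psi> (c, t) - \<psi> (a, t)) {a..c}"
    using deriv_r by (intro fundamental_theorem_of_calculus)
     (auto simp: a_def has_real_derivative_iff_has_vector_derivative[symmetric] intro: has_field_derivative_at_within)
  moreover have "\<psi> (a, t) = 0" by (rule outside) (auto simp: a_def)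
  ultimately have "((\<lambda>r. \<psi>r (r, t)) has_integral \<psi> (c, t)) {a..c}" by simp
  then have "((\<lambda>r. indicator {..0} (r - c) * \<psi>r (r, t)) has_integral \<psi> (c, t)) {a..c}"
    by (rule has_integral_eq[rotated]) (auto simp: indicator_def)
  then have "((\<lambda>r. indicator {..0} (r - c) * \<psi>r (r, t)) has_integral \<psi> (c, t)) UNIV"
    by (rule has_integral_on_superset) (auto simp: indicator_def a_def intro!: outside)
  then have le: "(LINT r|lborel. indicator {..0} (r - c) * \<psi>r (r, t)) = \<psi> (c, t)"
    using half_line_integrable[of "{..0}" c t]
    by (intro has_integral_unique[OF has_integral_integral_lborel]) simp_all
  have "(LINT r|lborel. \<psi>r (r, t)) = 0"
    by (rule lborel_integral_derivative_eq_0[where E = "{}" and F = "\<lambda>r. \<psi> (r, t)" and a = d and b = M])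
      (use deriv_r half_line_integrable[of UNIV] in \<open>simp_all add: outside continuous_on_compose2[OF cont_psi] continuous_on_Pair\<close>)
  moreover have "(LINT r|lborel. \<psi>r (r, t)) = (LINT r|lborel. indicator {..0} (r - c) * \<psi>r (r, t) + indicator {0<..} (r - c) * \<psi>r (r, t))"
    by (intro Bochner_Integration.integral_cong) (auto simp: indicator_def)
  ultimately show ?thesis
    using half_line_integrable[of "{..0}" c t] half_line_integrable[of "{0<..}" c t] le by (simp add: Bochner_Integration.integral_add)
qed

text \<open>Green's formula for the region to the right of the curve. The field is split as
  \<open>u = \<gamma>' + (u - \<gamma>')\<close>: the part tangential to the curve integrates to
  zero in time along every translate of the curve, and the rest is a pure radial derivative that
  leaves a boundary value on the curve.\<close>

lemma transport_integral:
  fixes \<gamma> \<gamma>' :: "real \<Rightarrow> real"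
  assumes \<gamma>: "continuous_on UNIV \<gamma>" and E: "finite E"
    and D: "\<And>t. t \<notin> E \<Longrightarrow> (\<gamma> has_real_derivative \<gamma>' t) (at t)"
    and \<gamma>'[measurable]: "\<gamma>' \<in> borel_measurable borel" and B: "\<And>t. t \<in> {d..M} \<Longrightarrow> \<bar>\<gamma>' t\<bar> \<le> B"
  shows "(LINT x|lborel. indicator {0<..} (fst x - \<gamma> (snd x)) * (\<psi>t x + u * \<psi>r x))
      = (LINT t|lborel. (\<gamma>' t - u) * \<psi> (\<gamma> t, t))"
proof -
  obtain C where C: "0 \<le> C" "\<And>x. \<bar>\<psi> x\<bar> \<le> C" "\<And>x. \<bar>\<psi>r x\<bar> \<le> C" "\<And>x. \<bar>\<psi>t x\<bar> \<le> C"
    using bounds by metis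
  have \<gamma>_meas[measurable]: "\<gamma> \<in> borel_measurable borel" by (rule borel_measurable_continuous_onI[OF \<gamma>])
  have int: "integrable lborel (\<lambda>x. indicator {0<..} (fst x - \<gamma> (snd x)) * (a * \<psi>t x + g (snd x) * \<psi>r x))"
    if g[measurable]: "g \<in> borel_measurable borel" and b: "\<And>t. t \<in> {d..M} \<Longrightarrow> \<bar>g t\<bar> \<le> b" for g :: "real \<Rightarrow> real" and a b
  proof (rule integrable_bounded_support[OF _ bounded_box, of _ "\<bar>a\<bar> * C + b * C"])
    fix x assume "x \<in> {d..M} \<times> {d..M}"
    then have "\<bar>g (snd x)\<bar> \<le> b" by (auto intro: b)
    then have "\<bar>a\<bar> * \<bar>\<psi>t x\<bar> + \<bar>g (snd x)\<bar> * \<bar>\<psi>r x\<bar> \<le> \<bar>a\<bar> * C + b * C"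
      using C by (intro add_mono mult_mono) auto
    then show "\<bar>indicator {0<..} (fst x - \<gamma> (snd x)) * (a * \<psi>t x + g (snd x) * \<psi>r x)\<bar> \<le> \<bar>a\<bar> * C + b * C"
      by (auto simp: indicator_def abs_mult[symmetric] intro: order_trans[OF abs_triangle_ineq] order_trans[OF abs_ge_zero])
  qed (use supp in auto)
  have int1: "integrable lborel (\<lambda>x. indicator {0<..} (fst x - \<gamma> (snd x)) * (\<psi>t x + \<gamma>' (snd x) * \<psi>r x))"
    using int[OF \<gamma>' B, of 1] by simp
  have int2: "integrable lborel (\<lambda>x. indicator {0<..} (fst x - \<gamma> (snd x)) * ((u - \<gamma>' (snd x)) * \<psi>r x))"
    using int[of "\<lambda>t. u - \<gamma>' t" "\<bar>u\<bar> + B" 0] B by (force intro: order_trans[OF abs_triangle_ineq4])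
  have mv[measurable]: "(\<lambda>x. indicator {0<..} (fst x - \<gamma> (snd x)) * (\<psi>t x + \<gamma>' (snd x) * \<psi>r x)) \<in> borel_measurable borel"
    by measurable
  \<comment> \<open>On the translate by \<open>q\<close> the integrand is the total time derivative
    of a function of compact support.\<close>
  have z: "(LINT t|lborel. \<psi>t (\<gamma> t + q, t) + \<gamma>' t * \<psi>r (\<gamma> t + q, t)) = 0" for q
  proof (rule lborel_integral_derivative_eq_0[where F = "\<lambda>t. \<psi> (\<gamma> t + q, t)" and a = d and b = M and E = E])
    show "continuous_on UNIV (\<lambda>t. \<psi> (\<gamma> t + q, t))"
      by (intro continuous_on_compose2[OF cont_psi] continuous_intros \<gamma>) auto
    show "((\<lambda>t. \<psi> (\<gamma> t + q, t)) has_real_derivative \<psi>t (\<gamma> t + q, t) + \<gamma>' t * \<psi>r (\<gamma> t + q, t)) (at t)"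
      if "t \<notin> E" for t
      using D[OF that] by (intro deriv_along) (auto intro!: derivative_eq_intros)
    show "integrable lborel (\<lambda>t. \<psi>t (\<gamma> t + q, t) + \<gamma>' t * \<psi>r (\<gamma> t + q, t))"
    proof (rule integrable_bounded_support[of _ "{d..M}" "C + B * C"])
      fix t assume "t \<in> {d..M}"
      then have "\<bar>\<psi>t (\<gamma> t + q, t)\<bar> + \<bar>\<gamma>' t\<bar> * \<bar>\<psi>r (\<gamma> t + q, t)\<bar> \<le> C + B * C"
        using C B[of t] by (intro add_mono mult_mono) auto
      then show "\<bar>\<psi>t (\<gamma> t + q, t) + \<gamma>' t * \<psi>r (\<gamma> t + q, t)\<bar> \<le> C + B * C"
        unfolding abs_mult[symmetric] by (rule order_trans[OF abs_triangle_ineq])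
    qed (auto simp: outside)
  qed (use E in \<open>auto simp: outside\<close>)
  \<comment> \<open>The shear turns the region into \<open>q > 0\<close>, so the time integral can
    be taken first, for fixed \<open>q\<close>.\<close>
  have "(LINT x|lborel. indicator {0<..} (fst x - \<gamma> (snd x)) * (\<psi>t x + \<gamma>' (snd x) * \<psi>r x))
    = (LINT x|lborel. indicator {0<..} (fst x) * (\<psi>t (\<gamma> (snd x) + fst x, snd x) + \<gamma>' (snd x) * \<psi>r (\<gamma> (snd x) + fst x, snd x)))"
    by (subst integral_shear[OF \<gamma>_meas mv, of 1]) simp_all
  also have "\<dots> = (LINT q|lborel. LINT t|lborel. indicator {0<..} q * (\<psi>t (\<gamma> t + q, t) + \<gamma>' t * \<psi>r (\<gamma> t + q, t)))"
  proof -
    have "integrable lborel (\<lambda>x. indicator {0<..} (fst x) * (\<psi>t (\<gamma> (snd x) + fst x, snd x) + \<gamma>' (snd x) * \<psi>r (\<gamma> (snd x) + fst x, snd x)))"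
      using int1 by (subst (asm) integrable_shear[OF \<gamma>_meas mv zero_less_one]) simp
    then show ?thesis
      unfolding lborel_prod[symmetric] by (subst lborel_pair.integral_fst'[symmetric]) auto
  qed
  also have "\<dots> = 0" by (simp add: z)
  finally have 1: "(LINT x|lborel. indicator {0<..} (fst x - \<gamma> (snd x)) * (\<psi>t x + \<gamma>' (snd x) * \<psi>r x)) = 0" .
  have "(LINT x|lborel. indicator {0<..} (fst x - \<gamma> (snd x)) * ((u - \<gamma>' (snd x)) * \<psi>r x))
     = (LINT t|lborel. LINT r|lborel. indicator {0<..} (r - \<gamma> t) * ((u - \<gamma>' t) * \<psi>r (r, t)))"
    using int2 unfolding lborel_prod[symmetric]
    by (subst lborel_pair.integral_snd) (auto simp: split_def)
  also have "\<dots> = (LINT t|lborel. (\<gamma>' t - u) * \<psi> (\<gamma> t, t))"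
  proof (intro Bochner_Integration.integral_cong refl)
    fix t
    have "(LINT r|lborel. indicator {0<..} (r - \<gamma> t) * ((u - \<gamma>' t) * \<psi>r (r, t)))
      = (LINT r|lborel. (u - \<gamma>' t) * (indicator {0<..} (r - \<gamma> t) * \<psi>r (r, t)))"
      by (simp add: mult_ac)
    also have "\<dots> = (u - \<gamma>' t) * - \<psi> (\<gamma> t, t)"
      by (simp add: half_line_gt)
    finally show "(LINT r|lborel. indicator {0<..} (r - \<gamma> t) * ((u - \<gamma>' t) * \<psi>r (r, t))) = (\<gamma>' t - u) * \<psi> (\<gamma> t, t)"
      by (simp add: algebra_simps)
  qed
  finally have 2: "(LINT x|lborel. indicator {0<..} (fst x - \<gamma> (snd x)) * ((u - \<gamma>' (snd x)) * \<psi>r x))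
     = (LINT t|lborel. (\<gamma>' t - u) * \<psi> (\<gamma> t, t))" by simp
  have "(LINT x|lborel. indicator {0<..} (fst x - \<gamma> (snd x)) * (\<psi>t x + u * \<psi>r x))
    = (LINT x|lborel. indicator {0<..} (fst x - \<gamma> (snd x)) * (\<psi>t x + \<gamma>' (snd x) * \<psi>r x)
       + indicator {0<..} (fst x - \<gamma> (snd x)) * ((u - \<gamma>' (snd x)) * \<psi>r x))"
    by (intro Bochner_Integration.integral_cong) (auto simp: algebra_simps)
  also have "\<dots> = (LINT t|lborel. (\<gamma>' t - u) * \<psi> (\<gamma> t, t))"
    using 1 2 by (simp add: Bochner_Integration.integral_add[OF int1 int2])
  finally show "(LINT x|lborel. indicator {0<..} (fst x - \<gamma> (snd x)) * (\<psi>t x + u * \<psi>r x))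
      = (LINT t|lborel. (\<gamma>' t - u) * \<psi> (\<gamma> t, t))" .
qed

lemma integrable_on_curve:
  fixes X g :: "real \<Rightarrow> real"
  assumes [measurable]: "g \<in> borel_measurable borel" "X \<in> borel_measurable borel" "f \<in> borel_measurable borel"
    and "\<And>t. t \<in> {d..M} \<Longrightarrow> \<bar>g t\<bar> \<le> B" and C: "\<And>x. \<bar>f x\<bar> \<le> C"
    and "\<And>r t. t \<notin> {d..M} \<Longrightarrow> f (r, t) = 0"
  shows "integrable lborel (\<lambda>t. g t * f (X t, t))"
proof (rule integrable_bounded_support[of _ "{d..M}" "B * C"])
  fix t assume "t \<in> {d..M}"
  then show "\<bar>g t * f (X t, t)\<bar> \<le> B * C"
    unfolding abs_mult using assms(4)[of t] C by (intro mult_mono) auto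
qed (use assms(6) in auto)

text \<open>Integration by parts along the front: the derivative of
  \<open>g t * \<psi> (X t, t)\<close> integrates to zero. Here \<open>g\<close> will be a moment
  \<open>m * s ^ k\<close>, which may have a kink, whereas \<open>X\<close> is differentiable
  everywhere.\<close>

lemma front_integral:
  fixes X s g g' :: "real \<Rightarrow> real"
  assumes X: "\<And>t. (X has_real_derivative s t) (at t)"
    and s: "continuous_on UNIV s" and g: "continuous_on UNIV g" and E: "finite E"
    and D: "\<And>t. t \<notin> E \<Longrightarrow> (g has_real_derivative g' t) (at t)"
    and g': "g' \<in> borel_measurable borel" "\<And>t. t \<in> {d..M} \<Longrightarrow> \<bar>g' t\<bar> \<le> B"
  shows "(LINT t|lborel. g t * (\<psi>t (X t, t) + s t * \<psi>r (X t, t))) = - (LINT t|lborel. g' t * \<psi> (X t, t))"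
proof -
  obtain C where C: "0 \<le> C" "\<And>x. \<bar>\<psi> x\<bar> \<le> C" "\<And>x. \<bar>\<psi>r x\<bar> \<le> C" "\<And>x. \<bar>\<psi>t x\<bar> \<le> C"
    using bounds by metis
  have Xc: "continuous_on UNIV X" 
    by (rule DERIV_continuous_on[OF has_field_derivative_at_within[OF X]])
  have [measurable]: "X \<in> borel_measurable borel" "s \<in> borel_measurable borel" "g \<in> borel_measurable borel"
    using Xc s g by (auto intro: borel_measurable_continuous_onI)
  have ex: "\<exists>b. \<forall>t\<in>{d..M}. \<bar>h t\<bar> \<le> b" if "continuous_on UNIV h" for h :: "real \<Rightarrow> real"
  proof -
    have "bounded (h ` {d..M})"
      by (intro compact_imp_bounded compact_continuous_image continuous_on_subset[OF that]) auto
    then show ?thesis by (auto simp: bounded_iff)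
  qed
  obtain b1 where b1: "\<And>t. t \<in> {d..M} \<Longrightarrow> \<bar>g t\<bar> \<le> b1" using ex[OF g] by blast
  obtain b2 where b2: "\<And>t. t \<in> {d..M} \<Longrightarrow> \<bar>g t * s t\<bar> \<le> b2"
    using ex[OF continuous_on_mult[OF g s]] by blast
  have i1: "integrable lborel (\<lambda>t. g' t * \<psi> (X t, t))"
    by (rule integrable_on_curve[where f = \<psi> and g = g' and X = X and B = B and C = C])
      (simp_all add: g' C outside)
  have i2: "integrable lborel (\<lambda>t. g t * \<psi>t (X t, t))" "integrable lborel (\<lambda>t. (g t * s t) * \<psi>r (X t, t))"
    subgoal
      by (rule integrable_on_curve[where f = \<psi>t and g = g and X = X and B = b1 and C = C])
        (simp_all add: b1 C outside)
    subgoal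
      by (rule integrable_on_curve[where f = \<psi>r and g = "\<lambda>t. g t * s t" and X = X and B = b2 and C = C])
        (simp_all add: b2 C outside)
    done
  have i3: "integrable lborel (\<lambda>t. g t * (\<psi>t (X t, t) + s t * \<psi>r (X t, t)))"
    using Bochner_Integration.integrable_add[OF i2] by (simp add: algebra_simps)
  have "(LINT t|lborel. g' t * \<psi> (X t, t) + g t * (\<psi>t (X t, t) + s t * \<psi>r (X t, t))) = 0"
  proof (rule lborel_integral_derivative_eq_0[where F = "\<lambda>t. g t * \<psi> (X t, t)" and a = d and b = M and E = E])
    show "continuous_on UNIV (\<lambda>t. g t * \<psi> (X t, t))"
      by (intro continuous_on_mult g continuous_on_compose2[OF cont_psi] continuous_intros Xc) auto
    show "((\<lambda>t. g t * \<psi> (X t, t)) has_real_derivative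
        g' t * \<psi> (X t, t) + g t * (\<psi>t (X t, t) + s t * \<psi>r (X t, t))) (at t)" if "t \<notin> E" for t
      using DERIV_mult[OF D[OF that] deriv_along[OF X]] by (simp add: algebra_simps)
  qed (use E i1 i3 in \<open>auto simp: outside\<close>)
  then show ?thesis
    by (simp add: Bochner_Integration.integral_add[OF i1 i3])
qed

end

section \<open>Test functions and the weak form\<close>

lemma Ck_on_1_iff:
  "Ck_on 1 f U \<longleftrightarrow> f differentiable_on U \<and> (\<forall>v. continuous_on U (\<lambda>x. frechet_derivative f (at x) v))"
  by (simp add: One_nat_def)

lemma frechet_derivative_eq:
  "(f has_derivative f') (at x) \<Longrightarrow> frechet_derivative f (at x) = f'"
  using frechet_derivative_at by metis

lemma compact_pos_lower_bound:
  fixes K :: "real set"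
  assumes "compact K" "K \<subseteq> {0<..}"
  obtains d M where "0 < d" "K \<subseteq> {d..M}"
proof (cases "K = {}")
  case False
  obtain d M where "d \<in> K" "\<And>x. x \<in> K \<Longrightarrow> d \<le> x" "\<And>x. x \<in> K \<Longrightarrow> x \<le> M"
    using compact_attains_inf[OF assms(1) False] compact_attains_sup[OF assms(1) False] by metis
  then show ?thesis by (intro that[of d M]) (use assms(2) in auto)
qed (use that[of 1 1] in auto)

lemma test_function_line:
  assumes "test_function {0<..} (\<psi> :: real \<Rightarrow> real)"
  obtains d M C where "0 < d" "continuous_on UNIV \<psi>" "\<And>r. \<bar>\<psi> r\<bar> \<le> C" "\<And>r. r \<notin> {d..M} \<Longrightarrow> \<psi> r = 0"
proof -
  have "Ck_on 0 \<psi> UNIV" using assms unfolding test_function_def by blast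
  then have c: "continuous_on UNIV \<psi>" by simp
  obtain K where K: "compact K" "K \<subseteq> {0<..}" "\<And>x. x \<notin> K \<Longrightarrow> \<psi> x = 0"
    using assms unfolding test_function_def by blast
  obtain d M where dM: "0 < d" "K \<subseteq> {d..M}" using compact_pos_lower_bound[OF K(1,2)] by blast
  obtain C where C: "\<And>x. \<bar>\<psi> x\<bar> \<le> C"
    using continuous_zero_off_compact_bounded[OF c K(1,3)] by blast
  then show ?thesis using that[of d C M] dM c K(3) by blast
qed

text \<open>Division by \<open>r ^ (n - 1)\<close> removes the source term. The support of
  \<open>\<phi>\<close> is a compact subset of the open quadrant, hence at a positive distance from
  \<open>r = 0\<close>, so the quotient stays smooth enough when extended by zero.\<close>

lemma test_function_pair:
  assumes \<phi>: "test_function quadrant \<phi>" and n: "1 \<le> n"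
  obtains \<psi> \<psi>r \<psi>t d M where "test_pair \<psi> \<psi>r \<psi>t d M"
    "\<And>x. \<psi> x = \<phi> x / fst x ^ (n - 1)"
    "\<And>f g x. x \<in> quadrant \<Longrightarrow>
       weak_integrand n f g \<phi> x = fst x ^ (n - 1) * (- f x * \<psi>t x - g x * \<psi>r x)"
proof -
  define N where "N = n - 1"
  have N: "real n - 1 = real N" using n by (simp add: N_def)
  define \<phi>r where "\<phi>r x = frechet_derivative \<phi> (at x) (1, 0)" for x
  define \<phi>t where "\<phi>t x = frechet_derivative \<phi> (at x) (0, 1)" for x
  have C1: "Ck_on 1 \<phi> UNIV" using \<phi> unfolding test_function_def by (metis)
  have d: "\<phi> differentiable_on UNIV" using C1[unfolded Ck_on_1_iff] by (rule conjunct1)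
  have c': "continuous_on UNIV (\<lambda>x. frechet_derivative \<phi> (at x) v)" for v
    using conjunct2[OF C1[unfolded Ck_on_1_iff]] by (rule spec)
  have diff: "\<phi> differentiable (at x)" for x using d unfolding differentiable_on_def by blast
  have c: "continuous_on UNIV \<phi>r" "continuous_on UNIV \<phi>t"
    unfolding \<phi>r_def[abs_def] \<phi>t_def[abs_def] by (rule c')+
  have D: "(\<phi> has_derivative (\<lambda>h. fst h * \<phi>r x + snd h * \<phi>t x)) (at x)" for x
  proof -
    have D: "(\<phi> has_derivative frechet_derivative \<phi> (at x)) (at x)"
      using diff frechet_derivative_works by blast
    have "frechet_derivative \<phi> (at x) h = fst h * \<phi>r x + snd h * \<phi>t x" for h
    proof -
      have l: "linear (frechet_derivative \<phi> (at x))" using has_derivative_linear[OF D] .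
      have "frechet_derivative \<phi> (at x) (fst h *\<^sub>R (1, 0) + snd h *\<^sub>R (0, 1)) = fst h * \<phi>r x + snd h * \<phi>t x"
        unfolding linear_add[OF l] linear_scale[OF l] \<phi>r_def \<phi>t_def by simp
      moreover have "fst h *\<^sub>R (1, 0) + snd h *\<^sub>R (0, 1) = h" by (cases h) simp
      ultimately show ?thesis by (simp only:)
    qed
    then have "frechet_derivative \<phi> (at x) = (\<lambda>h. fst h * \<phi>r x + snd h * \<phi>t x)" by (rule ext)
    then show ?thesis using D by (simp only:)
  qed
  obtain K where K: "compact K" "K \<subseteq> quadrant" "\<And>x. x \<notin> K \<Longrightarrow> \<phi> x = 0"
    using \<phi> unfolding test_function_def by blast
  have op: "open (- K)" using K(1) compact_imp_closed by blast
  have off: "\<phi>r x = 0" "\<phi>t x = 0" if "x \<notin> K" for x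
  proof -
    have "(\<phi> has_derivative (\<lambda>h. 0)) (at x)"
      by (rule has_derivative_transform_within_open[OF has_derivative_const op]) (use that K(3) in auto)
    then show "\<phi>r x = 0" "\<phi>t x = 0"
      unfolding \<phi>r_def \<phi>t_def by (simp_all add: frechet_derivative_eq)
  qed
  define \<psi> where "\<psi> x = \<phi> x / fst x ^ N" for x
  define \<psi>r where "\<psi>r x = \<phi>r x / fst x ^ N - real N * \<phi> x / fst x ^ Suc N" for x
  define \<psi>t where "\<psi>t x = \<phi>t x / fst x ^ N" for x
  obtain d1 M1 where 1: "0 < d1" "fst ` K \<subseteq> {d1..M1}"
    by (rule compact_pos_lower_bound[of "fst ` K"])
      (use K in \<open>auto simp: quadrant_def intro!: compact_continuous_image continuous_intros\<close>)
  obtain d2 M2 where 2: "0 < d2" "snd ` K \<subseteq> {d2..M2}"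
    by (rule compact_pos_lower_bound[of "snd ` K"])
      (use K in \<open>auto simp: quadrant_def intro!: compact_continuous_image continuous_intros\<close>)
  have box: "K \<subseteq> {min d1 d2..max M1 M2} \<times> {min d1 d2..max M1 M2}"
    using 1(2) 2(2) by (force simp: mem_Times_iff)
  \<comment> \<open>The half-plane \<open>r > 0\<close> and the complement of \<open>K\<close> are
    open and cover the plane, so continuity on each of them suffices. This handles the poles at
    \<open>r = 0\<close>.\<close>
  have cont: "continuous_on UNIV f"
    if f: "continuous_on {x :: real \<times> real. 0 < fst x} f" "\<And>x. x \<notin> K \<Longrightarrow> f x = 0" for f :: "real \<times> real \<Rightarrow> real"
  proof -
    have o: "open {x :: real \<times> real. 0 < fst x}" by (intro open_Collect_less continuous_intros)
    have "continuous_on (- K) f"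
      by (rule continuous_on_eq[where f = "\<lambda>_. 0"]) (use f(2) in auto)
    then have "continuous_on ({x. 0 < fst x} \<union> - K) f"
      using continuous_on_open_Un[OF o op f(1)] by blast
    moreover have "{x. 0 < fst x} \<union> - K = UNIV" using K(2) by (force simp: quadrant_def)
    ultimately show ?thesis by simp
  qed
  have c\<phi>: "continuous_on UNIV \<phi>" by (rule has_derivative_continuous_on[OF has_derivative_at_withinI[OF D]])
  have "test_pair \<psi> \<psi>r \<psi>t (min d1 d2) (max M1 M2)"
  proof
    fix x
    show "(\<psi> has_derivative (\<lambda>h. fst h * \<psi>r x + snd h * \<psi>t x)) (at x)"
    proof (cases "x \<in> K")
      case True
      then have r: "0 < fst x" using K(2) by (auto simp: quadrant_def)
      have p: "((\<lambda>x :: real \<times> real. fst x ^ N) has_derivative (\<lambda>h. real N * fst h * fst x ^ (N - 1))) (at x)"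
        by (intro has_derivative_power has_derivative_fst has_derivative_ident)
      have "(\<psi> has_derivative (\<lambda>h. ((fst h * \<phi>r x + snd h * \<phi>t x) * fst x ^ N
          - \<phi> x * (real N * fst h * fst x ^ (N - 1))) / (fst x ^ N * fst x ^ N))) (at x)"
        unfolding \<psi>_def[abs_def] by (rule has_derivative_divide'[OF D p]) (use r in simp)
      moreover have "((fst h * \<phi>r x + snd h * \<phi>t x) * fst x ^ N
          - \<phi> x * (real N * fst h * fst x ^ (N - 1))) / (fst x ^ N * fst x ^ N) = fst h * \<psi>r x + snd h * \<psi>t x" for h
        using r unfolding \<psi>r_def \<psi>t_def by (cases N) (simp_all add: field_simps)
      ultimately show ?thesis by simp
    next
      case False
      have "(\<psi> has_derivative (\<lambda>h. 0)) (at x)"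
        by (rule has_derivative_transform_within_open[OF has_derivative_const op])
          (use False K(3) in \<open>auto simp: \<psi>_def\<close>)
      then show ?thesis using off[OF False] K(3)[OF False] by (simp add: \<psi>r_def \<psi>t_def)
    qed
    show "\<psi> x = 0 \<and> \<psi>r x = 0 \<and> \<psi>t x = 0" if "x \<notin> {min d1 d2..max M1 M2} \<times> {min d1 d2..max M1 M2}"
      
    proof -
      have "x \<notin> K" using that box by blast
      then show ?thesis using K(3) off by (simp add: \<psi>_def \<psi>r_def \<psi>t_def)
    qed
  next
    show "continuous_on UNIV \<psi>r"
      unfolding \<psi>r_def[abs_def]
      by (intro cont continuous_intros continuous_on_subset[OF c(1)] continuous_on_subset[OF c\<phi>]) (use K off in auto)
    show "continuous_on UNIV \<psi>t"
      unfolding \<psi>t_def[abs_def]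
      by (intro cont continuous_intros continuous_on_subset[OF c(2)]) (use K off in auto)
  qed (use 1 2 in auto)
  moreover have "weak_integrand n f g \<phi> x = fst x ^ N * (- f x * \<psi>t x - g x * \<psi>r x)"
    if "x \<in> quadrant" for f g x
  proof -
    obtain r t where x: "x = (r, t)" by (cases x)
    have r: "0 < r" using that x by (simp add: quadrant_def)
    have "((\<lambda>s. (r, s)) has_derivative (\<lambda>h. (0, h))) (at t)"
      by (intro has_derivative_Pair has_derivative_ident has_derivative_const)
    from has_derivative_compose[OF this D]
    have "((\<lambda>s. \<phi> (r, s)) has_real_derivative \<phi>t (r, t)) (at t)"
      unfolding has_field_derivative_def by (rule has_derivative_eq_rhs) (simp add: fun_eq_iff)
    then have dt: "deriv (\<lambda>s. \<phi> (r, s)) t = \<phi>t (r, t)" by (rule DERIV_imp_deriv)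
    have "((\<lambda>q. (q, t)) has_derivative (\<lambda>h. (h, 0))) (at r)"
      by (intro has_derivative_Pair has_derivative_ident has_derivative_const)
    from has_derivative_compose[OF this D]
    have "((\<lambda>q. \<phi> (q, t)) has_real_derivative \<phi>r (r, t)) (at r)"
      unfolding has_field_derivative_def by (rule has_derivative_eq_rhs) (simp add: fun_eq_iff)
    then have dr: "deriv (\<lambda>q. \<phi> (q, t)) r = \<phi>r (r, t)" by (rule DERIV_imp_deriv)
    show ?thesis
      using r by (simp add: x weak_integrand_def dt dr N \<psi>r_def \<psi>t_def field_simps)
  qed
  ultimately show ?thesis
    using that \<psi>_def unfolding N_def by blast
qed

context test_pair
begin

lemma block_integrable:
  assumes [measurable]: "a \<in> borel_measurable borel" "b \<in> borel_measurable borel"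
  shows "integrable lborel (\<lambda>x. indicator {0<..} (fst x - a (snd x)) * indicator {..0} (fst x - b (snd x)) * (\<psi>t x + u * \<psi>r x))"
    "integrable lborel (\<lambda>x. indicator {0<..} (fst x - a (snd x)) * (\<psi>t x + u * \<psi>r x))"
proof -
  obtain C where C: "0 \<le> C" "\<And>x. \<bar>\<psi>r x\<bar> \<le> C" "\<And>x. \<bar>\<psi>t x\<bar> \<le> C"
    using bounds by metis
  have bd: "\<bar>\<psi>t x + u * \<psi>r x\<bar> \<le> C + \<bar>u\<bar> * C" for x
  proof -
    have "\<bar>\<psi>t x\<bar> + \<bar>u\<bar> * \<bar>\<psi>r x\<bar> \<le> C + \<bar>u\<bar> * C"
      using C by (intro add_mono mult_mono) auto
    then show ?thesis unfolding abs_mult[symmetric] by (rule order_trans[OF abs_triangle_ineq])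
  qed
  have 0: "0 \<le> C + \<bar>u\<bar> * C" using C(1) by simp
  show "integrable lborel (\<lambda>x. indicator {0<..} (fst x - a (snd x)) * indicator {..0} (fst x - b (snd x)) * (\<psi>t x + u * \<psi>r x))"
    by (rule integrable_bounded_support[OF _ bounded_box, of _ "C + \<bar>u\<bar> * C"])
      (use bd supp 0 in \<open>auto simp: indicator_def\<close>)
  show "integrable lborel (\<lambda>x. indicator {0<..} (fst x - a (snd x)) * (\<psi>t x + u * \<psi>r x))"
    by (rule integrable_bounded_support[OF _ bounded_box, of _ "C + \<bar>u\<bar> * C"])
      (use bd supp 0 in \<open>auto simp: indicator_def\<close>)
qed

text \<open>The block is the difference of the regions to the right of its two edges. The left edge
  moves with the velocity \<open>u\<close> of the state, so no mass crosses it and only the flux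
  through the edge \<open>b\<close> survives.\<close>

lemma block_integral:
  assumes b: "continuous_on UNIV b" and E: "finite E" and ab: "\<And>t. u * t \<le> b t"
    and D: "\<And>t. t \<notin> E \<Longrightarrow> (b has_real_derivative b' t) (at t)"
    and b': "b' \<in> borel_measurable borel" and B: "\<And>t. t \<in> {d..M} \<Longrightarrow> \<bar>b' t\<bar> \<le> B"
  shows "(LINT x|lborel. indicator {0<..} (fst x - u * snd x) * indicator {..0} (fst x - b (snd x)) * (\<psi>t x + u * \<psi>r x))
    = (LINT t|lborel. (u - b' t) * \<psi> (b t, t))"
proof -
  have [measurable]: "b \<in> borel_measurable borel" by (rule borel_measurable_continuous_onI[OF b])
  have i1: "(LINT x|lborel. indicator {0<..} (fst x - u * snd x) * (\<psi>t x + u * \<psi>r x)) = 0"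
    by (subst transport_integral[where \<gamma> = "\<lambda>t. u * t" and \<gamma>' = "\<lambda>_. u" and E = "{}" and B = "\<bar>u\<bar>"])
      (auto intro!: continuous_intros derivative_eq_intros)
  have i2: "(LINT x|lborel. indicator {0<..} (fst x - b (snd x)) * (\<psi>t x + u * \<psi>r x))
      = (LINT t|lborel. (b' t - u) * \<psi> (b t, t))"
    by (rule transport_integral[OF b E D b' B])
  have "indicator {0<..} (fst x - u * snd x) * indicator {..0} (fst x - b (snd x)) * (\<psi>t x + u * \<psi>r x)
    = indicator {0<..} (fst x - u * snd x) * (\<psi>t x + u * \<psi>r x) - indicator {0<..} (fst x - b (snd x)) * (\<psi>t x + u * \<psi>r x)" for x
    using ab[of "snd x"] by (auto simp: indicator_def)
  then have "(LINT x|lborel. indicator {0<..} (fst x - u * snd x) * indicator {..0} (fst x - b (snd x)) * (\<psi>t x + u * \<psi>r x))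
    = 0 - (LINT t|lborel. (b' t - u) * \<psi> (b t, t))"
    using block_integrable(2)[of "\<lambda>t. u * t" b u] block_integrable(2)[of b b u]
    by (simp add: Bochner_Integration.integral_diff i1 i2)
  also have "\<dots> = (LINT t|lborel. - ((b' t - u) * \<psi> (b t, t)))" by simp
  also have "\<dots> = (LINT t|lborel. (u - b' t) * \<psi> (b t, t))"
    by (intro Bochner_Integration.integral_cong) (auto simp: algebra_simps)
  finally show ?thesis .
qed

lemma box_quadrant: "x \<in> {d..M} \<times> {d..M} \<Longrightarrow> x \<in> quadrant"
  using d_pos by (auto simp: quadrant_def)

end

lemma weak_limit_scale:
  assumes "weak_limit n f g \<phi> L"
  shows "weak_limit n (\<lambda>e x. c * f e x) (\<lambda>e x. c * g e x) \<phi> (c * L)"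
proof -
  have "weak_integrand n (\<lambda>x. c * f e x) (\<lambda>x. c * g e x) \<phi> = (\<lambda>x. c * weak_integrand n (f e) (g e) \<phi> x)" for e
    by (auto simp: weak_integrand_def fun_eq_iff algebra_simps)
  then show ?thesis
    using assms unfolding weak_limit_def
    by (auto simp: elim!: eventually_mono intro!: tendsto_intros)
qed

lemma weak_limit_const:
  assumes "set_integrable lborel quadrant (weak_integrand n f g \<phi>)"
    and "(LINT x:quadrant|lborel. weak_integrand n f g \<phi> x) = L"
  shows "weak_limit n (\<lambda>_. f) (\<lambda>_. g) \<phi> L"
  using assms unfolding weak_limit_def by simp

text \<open>Every edge of either state moves with the velocity of that state, so all boundary fluxes
  vanish. The coefficients \<open>a\<close> and \<open>b\<close> are left free in order to cover all
  velocity moments at once.\<close>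

lemma weak_limit_free_transport:
  assumes \<phi>: "test_function quadrant \<phi>" and n: "1 \<le> n" and R: "0 < R"
    and f: "\<And>x. x \<in> quadrant \<Longrightarrow> f x = (a * indicator {0<..} (fst x - ul * snd x) * indicator {..0} (fst x - (R + ul * snd x))
        + b * indicator {0<..} (fst x - (R + ur * snd x))) / fst x ^ (n - 1)"
    and g: "\<And>x. x \<in> quadrant \<Longrightarrow> g x = (a * ul * indicator {0<..} (fst x - ul * snd x) * indicator {..0} (fst x - (R + ul * snd x))
        + b * ur * indicator {0<..} (fst x - (R + ur * snd x))) / fst x ^ (n - 1)"
  shows "weak_limit n (\<lambda>_. f) (\<lambda>_. g) \<phi> 0"
proof -
  obtain \<psi> \<psi>r \<psi>t d M where "test_pair \<psi> \<psi>r \<psi>t d M"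
    and W: "\<And>f g x. x \<in> quadrant \<Longrightarrow>
       weak_integrand n f g \<phi> x = fst x ^ (n - 1) * (- f x * \<psi>t x - g x * \<psi>r x)"
    using test_function_pair[OF \<phi> n] by metis
  then interpret test_pair \<psi> \<psi>r \<psi>t d M by simp
  define P where "P x = indicator {0<..} (fst x - ul * snd x) * indicator {..0} (fst x - (R + ul * snd x)) * (\<psi>t x + ul * \<psi>r x)" for x
  define Q where "Q x = indicator {0<..} (fst x - (R + ur * snd x)) * (\<psi>t x + ur * \<psi>r x)" for x
  have eq: "indicator quadrant x *\<^sub>R weak_integrand n f g \<phi> x = - a * P x - b * Q x" for x
  proof (cases "x \<in> quadrant")
    case True
    then have "fst x \<noteq> 0" by (auto simp: quadrant_def)
    then have *: "fst x ^ (n - 1) * (- (A / fst x ^ (n - 1)) * y - B / fst x ^ (n - 1) * z) = - A * y - B * z" for A B y z :: real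
      by (simp add: right_diff_distrib)
    show ?thesis
      using True unfolding W[OF True] f[OF True] g[OF True] * P_def Q_def by (simp add: algebra_simps)
  next
    case False
    then have "x \<notin> {d..M} \<times> {d..M}" using box_quadrant by blast
    then show ?thesis using False supp by (simp add: P_def Q_def)
  qed
  have int: "integrable lborel P" "integrable lborel Q"
    unfolding P_def Q_def by (intro block_integrable; measurable)+
  have "(LINT x|lborel. P x) = 0"
    unfolding P_def
    by (subst block_integral[where b' = "\<lambda>_. ul" and E = "{}" and B = "\<bar>ul\<bar>"])
      (use R in \<open>auto intro!: continuous_intros derivative_eq_intros\<close>)
  moreover have "(LINT x|lborel. Q x) = 0"
    unfolding Q_def
    by (subst transport_integral[where \<gamma> = "\<lambda>t. R + ur * t" and \<gamma>' = "\<lambda>_. ur" and E = "{}" and B = "\<bar>ur\<bar>"])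
      (auto intro!: continuous_intros derivative_eq_intros)
  ultimately show ?thesis
    using int by (intro weak_limit_const) (simp_all add: set_integrable_def set_lebesgue_integral_def eq del: real_scaleR_def)
qed

section \<open>The front with mass\<close>

text \<open>
  \<open>X\<close>, \<open>s\<close> and \<open>m\<close> are position, speed and one-dimensional mass of the front, that is \<open>m = \<sigma> X ^ (n - 1)\<close>. All
  are defined for all times: once \<open>X\<close> is nonpositive it stays so, and there the test functions vanish.
  At time \<open>t1\<close> the front meets the left edge \<open>r = ul * t\<close> of the left state; for \<open>ul \<le> 0\<close> this does not happen
  before the front reaches the origin.
\<close>

locale delta_front =
  fixes n :: nat and R rl rr ul ur t1 B :: real and X s s' m :: "real \<Rightarrow> real"
  assumes n: "1 \<le> n" and R: "0 < R" and rl: "0 < rl" and rr: "0 < rr"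
    and X_0: "X 0 = R" and X_deriv: "\<And>t. (X has_real_derivative s t) (at t)"
    and s_cont: "continuous_on UNIV s" and s_gt: "\<And>t. ur < s t" and s_lt: "\<And>t. s t < ul"
    and s_antimono: "\<And>t t'. t \<le> t' \<Longrightarrow> s t' \<le> s t"
    and t1: "0 < t1" and before: "\<And>t. t < t1 \<Longrightarrow> ul * t < X t" and after: "\<And>t. t1 \<le> t \<Longrightarrow> X t \<le> ul * t"
    and m_cont: "continuous_on UNIV m" and m_0: "m 0 = 0" and m_pos: "\<And>t. 0 < t \<Longrightarrow> 0 < m t"
    and m_deriv: "\<And>t. t \<noteq> t1 \<Longrightarrow> (m has_real_derivative
          (if t < t1 then rl * (ul - s t) else 0) + rr * (s t - ur)) (at t)"
    and s_deriv: "\<And>t. t \<noteq> t1 \<Longrightarrow> (s has_real_derivative s' t) (at t)"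
    and momentum: "\<And>t. ((if t < t1 then rl * (ul - s t) else 0) + rr * (s t - ur)) * s t + m t * s' t
          = (if t < t1 then rl * ul * (ul - s t) else 0) + rr * ur * (s t - ur)"
    and s'_cont: "continuous_on (- {t1}) s'" and s'_bound: "\<And>t. \<bar>s' t\<bar> \<le> B"
begin

definition m' :: "real \<Rightarrow> real" where
  "m' t = (if t < t1 then rl * (ul - s t) else 0) + rr * (s t - ur)"

definition life :: ereal where
  "life = (if \<exists>t\<ge>0. X t \<le> 0 then ereal (Inf {t. 0 \<le> t \<and> X t \<le> 0}) else \<infinity>)"

definition front0 :: sdw_front where
  "front0 = \<lparr>shift = (\<lambda>t. X t - R), lifetime = life, front_mass = (\<lambda>t. m t / X t ^ (n - 1))\<rparr>"

text \<open>Until the arrival of the front the left state falls in if \<open>ul < 0\<close>; at the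
  arrival the mass of the front is added; afterwards the right state falls in, with
  \<open>ur < 0\<close>. Since \<open>m\<close> and the densities are weighted by
  \<open>r ^ (n - 1)\<close>, they count mass per unit of solid angle, which explains the factor
  \<open>sphere_area n\<close>.\<close>

definition core_mass :: "real \<Rightarrow> real" where
  "core_mass t = sphere_area n * (if ereal t < life then rl * max 0 (- ul) * t
     else rl * max 0 (- ul) * real_of_ereal life + m (real_of_ereal life) - rr * ur * (t - real_of_ereal life))"

text \<open>The vacuum behind the left state is given the velocity \<open>ul\<close>, so the
  velocity jumps only at the front. For \<open>ul \<le> 0\<close> the left edge never enters the
  quadrant and is not listed as an arc; from \<open>t1\<close> on the two indicators of the left
  state exclude each other, and its density vanishes without a case distinction.\<close>

definition sol :: sdw where
  "sol = \<lparr>dens = (\<lambda>x. (rl * indicator {0<..} (fst x - ul * snd x) * indicator {..0} (fst x - X (snd x))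
           + rr * indicator {0<..} (fst x - X (snd x))) / fst x ^ (n - 1)),
        vel = (\<lambda>x. if fst x \<le> X (snd x) then ul else ur),
        jump_arcs = (if 0 < ul then {(0, ereal t1, \<lambda>t. ul * t)} else {}),
        front = Some front0, origin_mass = core_mass\<rparr>"

section \<open>The path of the front and its arrival at the origin\<close>

lemma X_cont: "continuous_on UNIV X"
  by (rule DERIV_continuous_on[OF has_field_derivative_at_within[OF X_deriv]])

lemma profile_measurable [measurable]:
  "X \<in> borel_measurable borel" "s \<in> borel_measurable borel" "m \<in> borel_measurable borel" "s' \<in> borel_measurable borel"
proof -
  show "s' \<in> borel_measurable borel"
    by (rule borel_measurable_continuous_countable_exceptions[of "{t1}"]) (use s'_cont in auto)
qed (intro borel_measurable_continuous_onI X_cont s_cont m_cont)+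

lemma m'_measurable [measurable]: "m' \<in> borel_measurable borel"
  unfolding m'_def[abs_def] by measurable

text \<open>To get from \<open>R > 0\<close> to a nonpositive position the front must have had
  negative speed at some earlier time, and the speed never increases. The bound
  \<open>s t0 < 0\<close> also forces \<open>ur < 0\<close>, which gives the direction of the flow
  after the arrival.\<close>

lemma X_stays_nonpos:
  assumes "0 \<le> t0" "X t0 \<le> 0" "t0 \<le> t"
  shows "s t0 < 0" "X t \<le> 0"
proof -
  have "0 < t0" using assms R X_0 by (cases "t0 = 0") auto
  then obtain z where z: "0 < z" "z < t0" "X t0 - X 0 = (t0 - 0) * s z"
    using MVT2[of 0 t0 X s] X_deriv by blast
  then have "t0 * s z < 0" using assms(2) R X_0 by simp
  then have "s z < 0" using \<open>0 < t0\<close> by (simp add: mult_less_0_iff)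
  then show s0: "s t0 < 0" using s_antimono[of z t0] z by simp
  have "X t \<le> X t0"
  proof (rule DERIV_nonpos_imp_nonincreasing[OF assms(3)])
    fix y assume "t0 \<le> y" "y \<le> t"
    then show "\<exists>y'. (X has_real_derivative y') (at y) \<and> y' \<le> 0"
      using X_deriv s_antimono[of t0 y] s0 by (intro exI[of _ "s y"]) auto
  qed
  then show "X t \<le> 0" using assms(2) by simp
qed

text \<open>The set of times with \<open>X t \<le> 0\<close> is closed and, once entered, never
  left; so being alive is a pointwise condition on \<open>X\<close>. At the arrival time itself the
  intermediate value theorem gives \<open>X t0 = 0\<close>.\<close>

lemma less_life_iff: "0 \<le> t \<Longrightarrow> ereal t < life \<longleftrightarrow> 0 < X t"
  and life_eq: "life = ereal t0 \<Longrightarrow> 0 < t0 \<and> X t0 = 0"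
proof -
  let ?Z = "{t. 0 \<le> t \<and> X t \<le> 0}"
  have Z: "closed ?Z"
    by (intro closed_Collect_conj closed_Collect_le continuous_intros X_cont)
  have bdd: "bdd_below ?Z" by (rule bdd_belowI[of _ 0]) auto
  have Inf_in: "Inf ?Z \<in> ?Z" if "?Z \<noteq> {}"
    using closed_contains_Inf[OF that bdd Z] .
  show "ereal t < life \<longleftrightarrow> 0 < X t" if t: "0 \<le> t"
  proof (cases "?Z = {}")
    case True
    then show ?thesis using t unfolding life_def by force
  next
    case False
    then have *: "life = ereal (Inf ?Z)" by (auto simp: life_def)
    have "t < Inf ?Z \<longleftrightarrow> 0 < X t"
    proof
      show "0 < X t" if "t < Inf ?Z"
      proof (rule ccontr)
        assume "\<not> 0 < X t"
        then have "t \<in> ?Z" using t by auto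
        then show False using cInf_lower[OF _ bdd] that by force
      qed
      show "t < Inf ?Z" if "0 < X t"
        using X_stays_nonpos(2)[of "Inf ?Z" t] Inf_in[OF False] that by force
    qed
    then show ?thesis by (simp add: *)
  qed
  show "0 < t0 \<and> X t0 = 0" if "life = ereal t0"
  proof -
    have ne: "?Z \<noteq> {}" using that by (auto simp: life_def split: if_splits)
    then have t0: "t0 = Inf ?Z" using that by (auto simp: life_def split: if_splits)
    have le: "0 \<le> t0" "X t0 \<le> 0" using Inf_in[OF ne] t0 by auto
    then have pos: "0 < t0" using R X_0 by (cases "t0 = 0") auto
    have "\<exists>z\<ge>0. z \<le> t0 \<and> X z = 0"
      using IVT2'[of X t0 0 0] le R X_0 continuous_on_subset[OF X_cont] by auto
    then obtain z where z: "0 \<le> z" "z \<le> t0" "X z = 0" by blast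
    then have "t0 \<le> z" using cInf_lower[OF _ bdd, of z] t0 by auto
    then show ?thesis using z pos by simp
  qed
qed

lemma front_times_iff: "t \<in> front_times front0 \<longleftrightarrow> 0 \<le> t \<and> 0 < X t"
  using less_life_iff by (auto simp: front_times_def front0_def)

lemma deriv_shift: "deriv (shift front0) t = s t"
  by (rule DERIV_imp_deriv) (auto simp: front0_def intro!: derivative_eq_intros X_deriv)

lemma in_layer_iff: "in_layer R e front0 x \<longleftrightarrow> 0 \<le> snd x \<and> 0 < X (snd x) \<and> \<bar>fst x - X (snd x)\<bar> < e / 2"
  by (cases x) (auto simp: in_layer_def front_times_iff, auto simp: front0_def)

text \<open>Outside the layer, each state is supported where the velocity is its own, so a power of
  the velocity merely multiplies the coefficients. For \<open>k = 0\<close> this is the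
  density.\<close>

lemma sw_product:
  assumes "x \<in> quadrant"
  shows "sw_dens R sol e x * sw_vel R sol e x ^ k = (if in_layer R e front0 x
      then m (snd x) / X (snd x) ^ (n - 1) * s (snd x) ^ k / e
      else (rl * ul ^ k * indicator {0<..} (fst x - ul * snd x) * indicator {..0} (fst x - X (snd x))
           + rr * ur ^ k * indicator {0<..} (fst x - X (snd x))) / fst x ^ (n - 1))"
proof (cases "in_layer R e front0 x")
  case True
  then show ?thesis
    by (simp add: sw_dens_def sw_vel_def sol_def deriv_shift) (simp add: front0_def)
next
  case False
  then show ?thesis
    by (auto simp: sw_dens_def sw_vel_def sol_def indicator_def)
qed


section \<open>Weak limits of the velocity moments\<close>

lemma ur_less_ul: "ur < ul"
  using s_gt[of 0] s_lt[of 0] by linarith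

lemma velocity_bounds: "\<bar>s t\<bar> \<le> \<bar>ul\<bar> + \<bar>ur\<bar>" "\<bar>m' t\<bar> \<le> (rl + rr) * (ul - ur)"
proof -
  show "\<bar>s t\<bar> \<le> \<bar>ul\<bar> + \<bar>ur\<bar>" using s_gt[of t] s_lt[of t] by linarith
  have "rl * (ul - s t) \<le> rl * (ul - ur)" "0 \<le> rl * (ul - s t)" "rr * (s t - ur) \<le> rr * (ul - ur)" "0 \<le> rr * (s t - ur)"
    using s_gt[of t] s_lt[of t] rl rr by simp_all
  moreover have "0 \<le> rl * (ul - ur)" using calculation by linarith
  ultimately show "\<bar>m' t\<bar> \<le> (rl + rr) * (ul - ur)"
    unfolding m'_def by (simp add: distrib_right)
qed

text \<open>The time derivative of \<open>m * s ^ k\<close> away from \<open>t1\<close>. For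
  \<open>k = 0\<close> the truncated exponent \<open>k - 1\<close> is harmless because of the factor
  \<open>real k\<close>.\<close>

definition moment_rate :: "nat \<Rightarrow> real \<Rightarrow> real" where
  "moment_rate k t = m' t * s t ^ k + m t * (real k * s t ^ (k - 1) * s' t)"

lemma moment_deriv: "t \<noteq> t1 \<Longrightarrow> ((\<lambda>t. m t * s t ^ k) has_real_derivative moment_rate k t) (at t)"
  unfolding moment_rate_def m'_def
  by (rule derivative_eq_intros m_deriv s_deriv refl | assumption)+ (simp add: algebra_simps)

lemma moment_rate_measurable [measurable]: "moment_rate k \<in> borel_measurable borel"
  unfolding moment_rate_def[abs_def] by measurable

lemma moment_rate_bounded: "\<exists>C. \<forall>t\<in>{a..b}. \<bar>moment_rate k t\<bar> \<le> C"
proof -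
  let ?V = "\<bar>ul\<bar> + \<bar>ur\<bar>"
  have "compact (m ` {a..b})"
    by (intro compact_continuous_image continuous_on_subset[OF m_cont]) auto
  then obtain C where C: "\<And>t. t \<in> {a..b} \<Longrightarrow> \<bar>m t\<bar> \<le> C"
    using compact_imp_bounded by (fastforce simp: bounded_iff)
  have "\<bar>moment_rate k t\<bar> \<le> (rl + rr) * (ul - ur) * ?V ^ k + C * (real k * ?V ^ (k - 1) * B)" if "t \<in> {a..b}" for t
  proof -
    have B0: "0 \<le> B" using s'_bound[of 0] by linarith
    have C0: "0 \<le> C" using C[OF that] by linarith
    have M0: "0 \<le> (rl + rr) * (ul - ur)" using velocity_bounds(2)[of 0] by linarith
    have p: "\<bar>s t\<bar> ^ j \<le> ?V ^ j" for j by (intro power_mono velocity_bounds) simp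
    have "\<bar>moment_rate k t\<bar> \<le> \<bar>m' t\<bar> * \<bar>s t\<bar> ^ k + \<bar>m t\<bar> * (real k * \<bar>s t\<bar> ^ (k - 1) * \<bar>s' t\<bar>)"
      unfolding moment_rate_def by (rule order_trans[OF abs_triangle_ineq]) (simp add: abs_mult power_abs)
    also have "\<dots> \<le> (rl + rr) * (ul - ur) * ?V ^ k + C * (real k * ?V ^ (k - 1) * B)"
      using B0 C0 rl rr s_gt[of t] s_lt[of t]
      by (intro add_mono mult_mono velocity_bounds p s'_bound C[OF that] order_refl mult_nonneg_nonneg zero_le_power) auto
    finally show ?thesis .
  qed
  then show ?thesis by blast
qed

text \<open>The layer contributes the growth of the moment carried by the front, the regular part
  the moment fluxes from both sides. All are integrals along the front against the same function
  \<open>\<psi>\<close>, so the limit is the defect of the balance of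
  \<open>m * s ^ k\<close>.\<close>

lemma weak_limit_moment:
  assumes \<phi>: "test_function quadrant \<phi>"
  shows "weak_limit n (\<lambda>e x. sw_dens R sol e x * sw_vel R sol e x ^ k) (\<lambda>e x. sw_dens R sol e x * sw_vel R sol e x ^ (k + 1)) \<phi>
    (LINT t|lborel. (moment_rate k t - (if t < t1 then rl * ul ^ k * (ul - s t) else 0) - rr * ur ^ k * (s t - ur))
       * (\<phi> (X t, t) / X t ^ (n - 1)))"
proof -
  obtain \<psi> \<psi>r \<psi>t d M where "test_pair \<psi> \<psi>r \<psi>t d M" and \<psi>: "\<And>x. \<psi> x = \<phi> x / fst x ^ (n - 1)"
    and W: "\<And>f g x. x \<in> quadrant \<Longrightarrow>
       weak_integrand n f g \<phi> x = fst x ^ (n - 1) * (- f x * \<psi>t x - g x * \<psi>r x)"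
    using test_function_pair[OF \<phi> n] by metis
  then interpret test_pair \<psi> \<psi>r \<psi>t d M by simp
  obtain C where C: "0 \<le> C" "\<And>x. \<bar>\<psi> x\<bar> \<le> C" using bounds by metis
  define P where "P x = indicator {0<..} (fst x - ul * snd x) * indicator {..0} (fst x - X (snd x)) * (\<psi>t x + ul * \<psi>r x)" for x
  define Q where "Q x = indicator {0<..} (fst x - X (snd x)) * (\<psi>t x + ur * \<psi>r x)" for x
  define Reg where "Reg x = - (rl * ul ^ k) * P x - rr * ur ^ k * Q x" for x
  \<comment> \<open>The cutoff at \<open>d / 2\<close> keeps the coefficient continuous when
    \<open>X\<close> reaches zero. For \<open>e < d\<close>, a point of the layer in the support has
    \<open>r \<ge> d\<close> and hence \<open>X t > d / 2\<close>, so there the cutoff changes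
    nothing.\<close>
  define \<sigma> where "\<sigma> t = m t / max (d / 2) (X t) ^ (n - 1) * s t ^ k" for t
  \<comment> \<open>The weak integrand inside the layer multiplied by \<open>e\<close>, in a form
    that is continuous on the whole plane.\<close>
  define h where "h x = \<sigma> (snd x) * fst x ^ (n - 1) * (- \<psi>t x - s (snd x) * \<psi>r x)" for x
  define I where "I e x = (indicator {-(e/2)<..<e/2} (fst x - X (snd x)) :: real)" for e and x :: "real \<times> real"
  have I_eq: "I e x = (if \<bar>fst x - X (snd x)\<bar> < e / 2 then 1 else 0)" for e x
  proof -
    have "(- (e / 2) < y \<and> y < e / 2) \<longleftrightarrow> \<bar>y\<bar> < e / 2" for y by linarith
    then show ?thesis by (simp only: I_def indicator_def greaterThanLessThan_iff of_bool_def)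
  qed
  let ?W = "\<lambda>e x. indicator quadrant x *\<^sub>R weak_integrand n (\<lambda>x. sw_dens R sol e x * sw_vel R sol e x ^ k)
      (\<lambda>x. sw_dens R sol e x * sw_vel R sol e x ^ (k + 1)) \<phi> x"
  have eq: "?W e x = (1 - I e x) * Reg x + I e x * h x / e" if e: "0 < e" "e < d" for e x
  proof (cases "x \<in> {d..M} \<times> {d..M}")
    case False
    then have 0: "\<psi> x = 0" "\<psi>r x = 0" "\<psi>t x = 0" using supp by auto
    then show ?thesis
      using W[of x] by (cases "x \<in> quadrant") (simp_all add: P_def Q_def Reg_def h_def)
  next
    case True
    then have xq: "x \<in> quadrant" and r: "d \<le> fst x" "0 \<le> snd x" using box_quadrant d_pos by auto
    have nz: "fst x \<noteq> 0" using r d_pos by simp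
    show ?thesis
    proof (cases "\<bar>fst x - X (snd x)\<bar> < e / 2")
      case True
      then have X: "d / 2 < X (snd x)" using r e by linarith
      then have l: "in_layer R e front0 x" using True r d_pos by (simp add: in_layer_iff)
      have Ie: "I e x = 1" using True by (simp only: I_eq if_True)
      have mx: "max (d / 2) (X (snd x)) = X (snd x)" using X by simp
      show ?thesis
        using xq unfolding W[OF xq] sw_product[OF xq] Ie h_def \<sigma>_def mx by (simp add: l algebra_simps diff_divide_distrib)
    next
      case False
      then have l: "\<not> in_layer R e front0 x" by (simp add: in_layer_iff)
      have Ie: "I e x = 0" using False by (simp only: I_eq if_False)
      have *: "fst x ^ (n - 1) * (- (A / fst x ^ (n - 1)) * y - A' / fst x ^ (n - 1) * z) = - A * y - A' * z" for A A' y z :: real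
        using nz by (simp add: right_diff_distrib)
      show ?thesis
        using xq unfolding W[OF xq] sw_product[OF xq] Ie if_not_P[OF l] * Reg_def P_def Q_def by (simp add: algebra_simps)
    qed
  qed
  have int: "integrable lborel P" "integrable lborel Q"
    unfolding P_def Q_def by (intro block_integrable; measurable)+
  then have Reg_int: "integrable lborel Reg" unfolding Reg_def by simp
  have P_int: "(LINT x|lborel. P x) = (LINT t|lborel. (if t < t1 then ul - s t else 0) * \<psi> (X t, t))"
  proof -
    \<comment> \<open>After \<open>t1\<close> the left block is empty although \<open>X\<close> lies
      below the ray \<open>ul * t\<close>. Replacing \<open>X\<close> by the maximum keeps the block
      unchanged and its edges ordered; the new edge then moves with speed \<open>ul\<close>, so its
      flux is zero after \<open>t1\<close>.\<close>
    define N where "N t = max (X t) (ul * t)" for t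
    define N' where "N' t = (if t < t1 then s t else ul)" for t
    have N: "N t = (if t < t1 then X t else ul * t)" for t
      using before[of t] after[of t] by (auto simp: N_def)
    have "P x = indicator {0<..} (fst x - ul * snd x) * indicator {..0} (fst x - N (snd x)) * (\<psi>t x + ul * \<psi>r x)" for x
      using after[of "snd x"] by (auto simp: P_def N indicator_def)
    then have "(LINT x|lborel. P x) = (LINT t|lborel. (ul - N' t) * \<psi> (N t, t))"
    proof (simp only:, intro block_integral[where E = "{t1}" and B = "\<bar>ul\<bar> + \<bar>ur\<bar>"])
      show "continuous_on UNIV N" unfolding N_def[abs_def] by (intro continuous_intros X_cont)
      show "ul * t \<le> N t" for t by (simp add: N_def)
      show "(N has_real_derivative N' t) (at t)" if "t \<notin> {t1}" for t
      proof (cases "t < t1")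
        case True
        show ?thesis
          unfolding N'_def if_P[OF True]
          by (rule has_field_derivative_transform_within_open[OF X_deriv open_lessThan[of t1]]) (use True N in auto)
      next
        case False
        have "((\<lambda>t. ul * t) has_real_derivative ul) (at t)" by (auto intro!: derivative_eq_intros)
        then show ?thesis
          unfolding N'_def if_not_P[OF False]
          by (rule has_field_derivative_transform_within_open[OF _ open_greaterThan[of t1]]) (use False that N in auto)
      qed
      show "N' \<in> borel_measurable borel" unfolding N'_def[abs_def] by measurable
      show "\<bar>N' t\<bar> \<le> \<bar>ul\<bar> + \<bar>ur\<bar>" for t using velocity_bounds(1)[of t] by (auto simp: N'_def)
    qed auto
    also have "\<dots> = (LINT t|lborel. (if t < t1 then ul - s t else 0) * \<psi> (X t, t))"
      by (intro Bochner_Integration.integral_cong) (auto simp: N N'_def)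
    finally show ?thesis .
  qed
  have Q_int: "(LINT x|lborel. Q x) = (LINT t|lborel. (s t - ur) * \<psi> (X t, t))"
    unfolding Q_def
    by (rule transport_integral[where E = "{}" and B = "\<bar>ul\<bar> + \<bar>ur\<bar>"])
      (use X_cont X_deriv velocity_bounds in auto)
  obtain G where G: "\<And>t. t \<in> {d..M} \<Longrightarrow> \<bar>moment_rate k t\<bar> \<le> G" using moment_rate_bounded by meson
  have h_front: "h (X t, t) = - (m t * s t ^ k * (\<psi>t (X t, t) + s t * \<psi>r (X t, t)))" for t
  \<comment> \<open>For \<open>X t < d\<close> both sides vanish by the support of
    \<open>\<psi>\<close>; otherwise the cutoff in \<open>\<sigma>\<close> is inactive and the
    powers of \<open>X t\<close> cancel.\<close>
  proof (cases "d \<le> X t")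
    case True
    then show ?thesis using d_pos by (simp add: h_def \<sigma>_def algebra_simps)
  next
    case False
    then show ?thesis by (simp add: h_def outside)
  qed
  have H_int: "(LINT t|lborel. h (X t, t)) = (LINT t|lborel. moment_rate k t * \<psi> (X t, t))"
    unfolding h_front
    using front_integral[where g = "\<lambda>t. m t * s t ^ k" and g' = "moment_rate k" and E = "{t1}" and B = G, OF X_deriv s_cont] G moment_deriv
    by (simp add: continuous_intros m_cont s_cont)
  have h_cont: "continuous_on UNIV h"
    unfolding h_def[abs_def] \<sigma>_def
    by (intro continuous_intros cont_r cont_t continuous_on_compose2[OF m_cont] continuous_on_compose2[OF s_cont]
        continuous_on_compose2[OF X_cont]) (use d_pos in \<open>auto simp: max_def\<close>)
  have h_supp: "h x = 0" if "x \<notin> {d..M} \<times> {d..M}" for x using supp[OF that] by (simp add: h_def)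
  obtain Ch where Ch: "\<And>x. \<bar>h x\<bar> \<le> Ch"
    using continuous_zero_off_compact_bounded[OF h_cont compact_Times[OF compact_Icc compact_Icc] h_supp] by blast
  have h_meas: "h \<in> borel_measurable borel" by (rule borel_measurable_continuous_onI[OF h_cont])
  have I_meas [measurable]: "I e \<in> borel_measurable borel" for e unfolding I_def by measurable
  have l1: "((\<lambda>e. LINT x|lborel. I e x * h x / e) \<longlongrightarrow> (LINT t|lborel. moment_rate k t * \<psi> (X t, t))) (at_right 0)"
    unfolding I_def H_int[symmetric]
  proof (rule tendsto_layer[OF profile_measurable(1) h_meas Ch bounded_box h_supp])
    have "continuous_on UNIV (\<lambda>r. h (r, t))" for t
      by (rule continuous_on_compose2[OF h_cont]) (auto intro: continuous_intros)
    then show "isCont (\<lambda>r. h (r, t)) (X t)" for t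
      by (simp add: continuous_on_eq_continuous_at)
  qed
  have i1: "integrable lborel (\<lambda>x. I e x * h x / e)" if "0 < e" for e
    unfolding I_def by (rule integrable_layer[OF profile_measurable(1) h_meas Ch bounded_box h_supp that])
  have RM[measurable]: "Reg \<in> borel_measurable borel" using borel_measurable_integrable[OF Reg_int] by simp
  have i2: "integrable lborel (\<lambda>x. (1 - I e x) * Reg x)" for e
    by (rule Bochner_Integration.integrable_bound[OF Reg_int]) (auto simp: I_def indicator_def)
  \<comment> \<open>Almost every point is off the graph of \<open>X\<close> and therefore leaves the
    layer once \<open>e\<close> is small.\<close>
  have l2: "((\<lambda>e. LINT x|lborel. (1 - I e x) * Reg x) \<longlongrightarrow> (LINT x|lborel. Reg x)) (at_right 0)"
  proof (rule tendsto_integral_at_right[where b = 1 and w = "\<lambda>x. \<bar>Reg x\<bar>"])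
    show "AE x in lborel. ((\<lambda>e. (1 - I e x) * Reg x) \<longlongrightarrow> Reg x) (at_right 0)"
      using AE_off_graph[OF profile_measurable(1)]
    proof eventually_elim
      case (elim x)
      then have "0 < 2 * \<bar>fst x - X (snd x)\<bar>" by simp
      then have "\<forall>\<^sub>F e in at_right 0. e < 2 * \<bar>fst x - X (snd x)\<bar>" by (rule eventually_at_right_real[THEN eventually_mono]) auto
      then have "\<forall>\<^sub>F e in at_right 0. Reg x = (1 - I e x) * Reg x"
        by eventually_elim (auto simp: I_eq)
      then show ?case by (rule Lim_transform_eventually[OF tendsto_const])
    qed
  qed (use Reg_int in \<open>auto simp: I_def indicator_def\<close>)
  have ev: "\<forall>\<^sub>F e in at_right (0 :: real). 0 < e \<and> e < d"
    using eventually_at_right_real[OF d_pos] by eventually_elim auto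
  have "((\<lambda>e. LINT x|lborel. ?W e x) \<longlongrightarrow> (LINT x|lborel. Reg x) + (LINT t|lborel. moment_rate k t * \<psi> (X t, t))) (at_right 0)"
    by (rule Lim_transform_eventually[OF tendsto_add[OF l2 l1]])
      (use ev in \<open>eventually_elim, simp only: eq, simp add: Bochner_Integration.integral_add i1 i2\<close>)
  moreover have "(LINT x|lborel. Reg x) + (LINT t|lborel. moment_rate k t * \<psi> (X t, t)) =
    (LINT t|lborel. (moment_rate k t - (if t < t1 then rl * ul ^ k * (ul - s t) else 0) - rr * ur ^ k * (s t - ur))
       * (\<phi> (X t, t) / X t ^ (n - 1)))"
  proof -
    have j1: "integrable lborel (\<lambda>t. moment_rate k t * \<psi> (X t, t))"
      by (rule integrable_on_curve[where f = \<psi> and g = "moment_rate k" and X = X and B = G and C = C])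
        (simp_all add: G C outside)
    have j2: "integrable lborel (\<lambda>t. (if t < t1 then ul - s t else 0) * \<psi> (X t, t))"
      by (rule integrable_on_curve[where f = \<psi> and g = "\<lambda>t. if t < t1 then ul - s t else 0" and X = X and B = "ul - ur" and C = C])
        (use s_lt s_gt ur_less_ul in \<open>auto simp: C outside less_imp_le\<close>)
    have j3: "integrable lborel (\<lambda>t. (s t - ur) * \<psi> (X t, t))"
      by (rule integrable_on_curve[where f = \<psi> and g = "\<lambda>t. s t - ur" and X = X and B = "ul - ur" and C = C])
        (use s_lt s_gt ur_less_ul in \<open>auto simp: C outside less_imp_le\<close>)
    have "(LINT x|lborel. Reg x) = - (rl * ul ^ k) * (LINT x|lborel. P x) - rr * ur ^ k * (LINT x|lborel. Q x)"
      unfolding Reg_def using int by simp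
    then have "(LINT x|lborel. Reg x) + (LINT t|lborel. moment_rate k t * \<psi> (X t, t))
      = (LINT t|lborel. moment_rate k t * \<psi> (X t, t) - (rl * ul ^ k) * ((if t < t1 then ul - s t else 0) * \<psi> (X t, t))
         - rr * ur ^ k * ((s t - ur) * \<psi> (X t, t)))"
      using j1 j2 j3 by (simp add: P_int Q_int)
    also have "\<dots> = (LINT t|lborel. (moment_rate k t - (if t < t1 then rl * ul ^ k * (ul - s t) else 0) - rr * ur ^ k * (s t - ur))
       * (\<phi> (X t, t) / X t ^ (n - 1)))"
      by (intro Bochner_Integration.integral_cong) (auto simp: \<psi> algebra_simps diff_divide_distrib)
    finally show ?thesis .
  qed
  moreover have "\<forall>\<^sub>F e in at_right 0. integrable lborel (?W e)"
    using ev by eventually_elim (simp only: eq, intro Bochner_Integration.integrable_add i1 i2; simp)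
  ultimately show ?thesis
    unfolding weak_limit_def set_integrable_def set_lebesgue_integral_def by simp
qed

end

section \<open>Criteria for regularity, boundary and initial conditions\<close>

text \<open>The free exponent serves both fields: \<open>N = n - 1\<close> for densities,
  \<open>N = 0\<close> for velocities.\<close>

lemma Ck_on_1_inverse_power:
  assumes U: "open U" and f: "\<And>x. x \<in> U \<Longrightarrow> 0 < fst x \<and> f x = c / fst x ^ N"
  shows "Ck_on 1 (f :: real \<times> real \<Rightarrow> real) U"
proof -
  define D where "D x h = - (c * (real N * fst h * fst x ^ (N - 1))) / (fst x ^ N * fst x ^ N)" for x h :: "real \<times> real"
  have D: "(f has_derivative D x) (at x)" if "x \<in> U" for x
  proof -
    have p: "((\<lambda>x :: real \<times> real. fst x ^ N) has_derivative (\<lambda>h. real N * fst h * fst x ^ (N - 1))) (at x)"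
      by (intro has_derivative_power has_derivative_fst has_derivative_ident)
    have "((\<lambda>x. c / fst x ^ N) has_derivative (\<lambda>h. (0 * fst x ^ N - c * (real N * fst h * fst x ^ (N - 1))) / (fst x ^ N * fst x ^ N))) (at x)"
      by (rule has_derivative_divide'[OF has_derivative_const p]) (use f[OF that] in simp)
    then have "((\<lambda>x. c / fst x ^ N) has_derivative D x) (at x)"
      by (simp add: D_def[abs_def])
    then show ?thesis
      by (rule has_derivative_transform_within_open[OF _ U that]) (use f in simp)
  qed
  have "continuous_on U (\<lambda>x. frechet_derivative f (at x) v)" for v
  proof (rule continuous_on_eq)
    show "continuous_on U (\<lambda>x. D x v)"
      unfolding D_def by (intro continuous_intros) (use f in fastforce)
    show "D x v = frechet_derivative f (at x) v" if "x \<in> U" for x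
      by (simp add: frechet_derivative_eq[OF D[OF that]])
  qed
  moreover have "f differentiable_on U"
    unfolding differentiable_on_def
    using D by (metis differentiable_def has_derivative_at_withinI)
  ultimately show ?thesis unfolding Ck_on_1_iff by blast
qed

text \<open>All fields constructed here are locally of the form \<open>c / r ^ N\<close> on each
  side of a curve. Regularity is thereby reduced to naming, at every point, a neighbourhood and one
  or two constants.\<close>

lemma piecewise_C1_offI:
  fixes f :: "real \<times> real \<Rightarrow> real"
  assumes bd: "\<And>x. x \<in> quadrant \<Longrightarrow> \<bar>f x\<bar> \<le> C / fst x ^ N" and P: "finite P"
    and loc: "\<And>r t. 0 < r \<Longrightarrow> 0 < t \<Longrightarrow> (r, t) \<notin> P \<Longrightarrow>
      (\<exists>U c. open U \<and> (r, t) \<in> U \<and> (\<forall>x\<in>U \<inter> quadrant. f x = c / fst x ^ N)) \<or>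
      (\<exists>a b \<gamma> U c c'. (a, b, \<gamma>) \<in> J \<and> t \<in> arc_times a b \<and> r = \<gamma> t \<and> open U \<and> (r, t) \<in> U \<and>
         (\<forall>x\<in>U \<inter> quadrant. (fst x < \<gamma> (snd x) \<longrightarrow> f x = c / fst x ^ N) \<and>
                               (\<gamma> (snd x) < fst x \<longrightarrow> f x = c' / fst x ^ N)))"
  shows "piecewise_C1_off J f"
  unfolding piecewise_C1_off_def
proof (intro conjI allI impI exI[of _ P] ballI P)
  fix K assume K: "compact K \<and> K \<subseteq> quadrant"
  have "compact (fst ` K)" using K by (intro compact_continuous_image continuous_intros) auto
  moreover have "fst ` K \<subseteq> {0<..}" using K by (auto simp: quadrant_def)
  ultimately obtain d M where d: "0 < d" "fst ` K \<subseteq> {d..M}" using compact_pos_lower_bound by metis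
  show "bounded (f ` K)"
    unfolding bounded_iff
  proof (intro exI ballI)
    fix y assume "y \<in> f ` K"
    then obtain x where x: "x \<in> K" "y = f x" by blast
    then have xq: "x \<in> quadrant" using K by blast
    have dx: "d \<le> fst x" using x d by auto
    have 0: "0 \<le> C"
    proof -
      have "0 < fst x ^ N" using dx d(1) by simp
      then show ?thesis
        using order_trans[OF abs_ge_zero bd[OF xq]] by (auto simp: zero_le_divide_iff)
    qed
    have "\<bar>f x\<bar> \<le> C / fst x ^ N" by (rule bd[OF xq])
    also have "\<dots> \<le> C / d ^ N" using 0 dx d(1) by (intro divide_left_mono power_mono mult_pos_pos) auto
    finally show "norm y \<le> C / d ^ N" using x by simp
  qed
next
  fix x assume x: "x \<in> quadrant - P"
  obtain r t where rt: "x = (r, t)" by (cases x)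
  have H: "open quadrant" unfolding quadrant_def by (intro open_Times) auto
  have r: "0 < r" "0 < t" "(r, t) \<notin> P" using x rt by (auto simp: quadrant_def)
  from loc[OF r]
  show "(\<exists>U. open U \<and> x \<in> U \<and> Ck_on 1 f U) \<or>
        (\<exists>(a, b, \<gamma>)\<in>J. snd x \<in> arc_times a b \<and> fst x = \<gamma> (snd x) \<and>
           (\<exists>U g h. open U \<and> x \<in> U \<and> Ck_on 1 g U \<and> Ck_on 1 h U \<and>
              (\<forall>(r, t)\<in>U. (r < \<gamma> t \<longrightarrow> f (r, t) = g (r, t)) \<and>
                          (\<gamma> t < r \<longrightarrow> f (r, t) = h (r, t)))))"
  proof (elim disjE exE conjE)
    fix U c assume U: "open U" "(r, t) \<in> U" "\<forall>x\<in>U \<inter> quadrant. f x = c / fst x ^ N"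
    have "Ck_on 1 f (U \<inter> quadrant)"
      by (rule Ck_on_1_inverse_power[OF open_Int[OF U(1) H]]) (use U(3) in \<open>auto simp: quadrant_def\<close>)
    then show ?thesis using open_Int[OF U(1) H] U(2) x rt by (intro disjI1 exI[of _ "U \<inter> quadrant"]) simp
  next
    fix a b \<gamma> U c c'
    assume U: "(a, b, \<gamma>) \<in> J" "t \<in> arc_times a b" "r = \<gamma> t" "open U" "(r, t) \<in> U"
      "\<forall>x\<in>U \<inter> quadrant. (fst x < \<gamma> (snd x) \<longrightarrow> f x = c / fst x ^ N) \<and>
                               (\<gamma> (snd x) < fst x \<longrightarrow> f x = c' / fst x ^ N)"
    have Ck: "Ck_on 1 (\<lambda>x. c / fst x ^ N) (U \<inter> quadrant)" for c
      by (rule Ck_on_1_inverse_power[OF open_Int[OF U(4) H]]) (auto simp: quadrant_def)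
    show ?thesis
      by (intro disjI2 bexI[OF _ U(1)], simp only: prod.case)
        (intro conjI exI[of _ "U \<inter> quadrant"] exI[of _ "\<lambda>x. c / fst x ^ N"] exI[of _ "\<lambda>x. c' / fst x ^ N"] Ck open_Int U(4) H,
         use U x rt in auto)
  qed
qed

section \<open>Boundary conditions at the origin and attainment of the initial data\<close>

lemma sphere_area_nonneg: "1 \<le> n \<Longrightarrow> 0 \<le> sphere_area n"
  unfolding sphere_area_def by (intro divide_nonneg_nonneg) (auto intro: less_imp_le[OF Gamma_real_pos])

text \<open>A single mass law covers the three signs of \<open>v\<close>: its right-hand side is the
  inflow for \<open>v < 0\<close>, vanishes for \<open>v = 0\<close>, and vanishes for
  \<open>v > 0\<close> because then \<open>w = 0\<close>.\<close>

lemma origin_condition_at: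
  fixes v w :: real
  assumes vel: "\<forall>\<^sub>F r in at_right 0. vel S (r, t) = v"
    and dens: "\<forall>\<^sub>F r in at_right 0. dens S (r, t) = w / r ^ (n - 1)"
    and m: "(origin_mass S has_real_derivative - (sphere_area n * w * v)) (at t)"
    and v: "0 < v \<Longrightarrow> w = 0"
  shows "\<exists>v w. ((\<lambda>r. vel S (r, t)) \<longlongrightarrow> v) (at_right 0) \<and>
               ((\<lambda>r. dens S (r, t) * r ^ (n - 1)) \<longlongrightarrow> w) (at_right 0) \<and>
               (v > 0 \<longrightarrow> (origin_mass S has_real_derivative 0) (at t) \<and>
                          ((\<lambda>r. dens S (r, t)) \<longlongrightarrow> 0) (at_right 0)) \<and>
               (v < 0 \<longrightarrow> (\<exists>q. ((\<lambda>r. r ^ (n - 1) * sphere_area n * dens S (r, t) * vel S (r, t))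
                                   \<longlongrightarrow> q) (at_right 0) \<and>
                               (origin_mass S has_real_derivative - q) (at t))) \<and>
               (v = 0 \<longrightarrow> (origin_mass S has_real_derivative 0) (at t))"
proof (rule exI[of _ v], rule exI[of _ w], intro conjI impI)
  have ev: "\<forall>\<^sub>F r in at_right (0::real). 0 < r" by (simp add: eventually_at_right_less)
  show "((\<lambda>r. vel S (r, t)) \<longlongrightarrow> v) (at_right 0)" by (rule tendsto_eventually[OF vel])
  show "((\<lambda>r. dens S (r, t) * r ^ (n - 1)) \<longlongrightarrow> w) (at_right 0)"
    by (rule tendsto_eventually) (use ev dens in \<open>eventually_elim, simp\<close>)
  show "((\<lambda>r. dens S (r, t)) \<longlongrightarrow> 0) (at_right 0)" if "0 < v"
    by (rule tendsto_eventually) (use dens in \<open>eventually_elim, simp add: v[OF that]\<close>)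
  have "((\<lambda>r. r ^ (n - 1) * sphere_area n * dens S (r, t) * vel S (r, t)) \<longlongrightarrow> sphere_area n * w * v) (at_right 0)"
    by (rule tendsto_eventually) (use ev dens vel in \<open>eventually_elim, simp\<close>)
  then show "\<exists>q. ((\<lambda>r. r ^ (n - 1) * sphere_area n * dens S (r, t) * vel S (r, t)) \<longlongrightarrow> q) (at_right 0) \<and>
                               (origin_mass S has_real_derivative - q) (at t)"
    using m by blast
qed (use m v in auto)

lemma layer_average_tendsto:
  fixes \<psi> :: "real \<Rightarrow> real"
  assumes c: "continuous_on UNIV \<psi>" and C: "\<And>r. \<bar>\<psi> r\<bar> \<le> C"
  shows "((\<lambda>e. (LINT r|lborel. indicator {-(e/2)<..<e/2} (r - X) * \<psi> r) / e) \<longlongrightarrow> \<psi> X) (at_right 0)"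
proof -
  have [measurable]: "\<psi> \<in> borel_measurable borel" by (rule borel_measurable_continuous_onI[OF c])
  let ?J = "{-(1/2)<..<1/2::real}"
  have eq: "(LINT r|lborel. indicator {-(e/2)<..<e/2} (r - X) * \<psi> r) / e = (LINT q|lborel. indicator ?J q * \<psi> (X + e * q))"
    if "0 < e" for e
  proof -
    have "indicator {-(e/2)<..<e/2} (e * q) = (indicator ?J q :: real)" for q
      using mult_less_cancel_left_pos[OF that, of "-(1/2)" q] mult_less_cancel_left_pos[OF that, of q "1/2"]
      by (simp add: indicator_def)
    then show ?thesis
      using that by (subst lborel_integral_real_affine[of e _ X]) simp_all
  qed
  have "((\<lambda>e. LINT q|lborel. indicator ?J q * \<psi> (X + e * q)) \<longlongrightarrow> (LINT q|lborel. indicator ?J q * \<psi> X)) (at_right 0)"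
  proof (rule tendsto_integral_at_right[where b = 1 and w = "\<lambda>q. C * indicator ?J q"])
    show "AE q in lborel. ((\<lambda>e. indicator ?J q * \<psi> (X + e * q)) \<longlongrightarrow> indicator ?J q * \<psi> X) (at_right 0)"
    proof (intro AE_I2 tendsto_mult tendsto_const)
      fix q
      have "((\<lambda>e. X + e * q) \<longlongrightarrow> X + 0 * q) (at_right 0)" by (intro tendsto_intros)
      then show "((\<lambda>e. \<psi> (X + e * q)) \<longlongrightarrow> \<psi> X) (at_right 0)"
        using c by (intro isCont_tendsto_compose[of X \<psi>]) (auto simp: continuous_on_eq_continuous_at)
    qed
    show "integrable lborel (\<lambda>q. C * indicator ?J q)"
      by (intro integrable_mult_right integrable_real_indicator) auto
  qed (use C in \<open>auto simp: indicator_def\<close>)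
  then have "((\<lambda>e. LINT q|lborel. indicator ?J q * \<psi> (X + e * q)) \<longlongrightarrow> \<psi> X) (at_right 0)" by simp
  then show ?thesis
    by (rule Lim_transform_eventually)
      (use eventually_at_right_less[of 0] in \<open>eventually_elim, simp only: eq\<close>)
qed

text \<open>A layer of width \<open>e\<close> and height \<open>c e t\<close> tends to a point mass
  \<open>\<kappa> t\<close> at \<open>X t\<close>, which must disappear as \<open>t\<close> tends to
  0. For the density \<open>\<kappa>\<close> is the mass of the front; for the velocity the height
  is bounded, so \<open>\<kappa>\<close> is zero.\<close>

lemma initial_limitI:
  fixes X \<kappa> :: "real \<Rightarrow> real" and c :: "real \<Rightarrow> real \<Rightarrow> real" and g :: "real \<times> real \<Rightarrow> real"
  assumes g[measurable]: "g \<in> borel_measurable borel" and g0[measurable]: "g0 \<in> borel_measurable borel"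
    and bd: "\<And>r t. 0 < r \<Longrightarrow> \<bar>g (r, t)\<bar> \<le> C / r ^ N"
    and g_lim: "\<And>r. 0 < r \<Longrightarrow> r \<noteq> R \<Longrightarrow> ((\<lambda>t. g (r, t)) \<longlongrightarrow> g0 r) (at_right 0)"
    and f: "\<forall>\<^sub>F t in at_right 0. \<forall>\<^sub>F e in at_right 0. \<forall>r>0. f e (r, t) = (if \<bar>r - X t\<bar> < e / 2 then c e t else g (r, t))"
    and c: "\<And>t. ((\<lambda>e. e * c e t) \<longlongrightarrow> \<kappa> t) (at_right 0)" and \<kappa>: "(\<kappa> \<longlongrightarrow> 0) (at_right 0)"
  shows "initial_limit f g0"
  unfolding initial_limit_def
proof (intro allI impI)
  fix \<psi> :: "real \<Rightarrow> real" assume "test_function {0<..} \<psi>"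
  then obtain d M B where d: "0 < d" and \<psi>: "continuous_on UNIV \<psi>" and B: "\<And>r. \<bar>\<psi> r\<bar> \<le> B"
    and supp: "\<And>r. r \<notin> {d..M} \<Longrightarrow> \<psi> r = 0"
    using test_function_line by metis
  have [measurable]: "\<psi> \<in> borel_measurable borel" by (rule borel_measurable_continuous_onI[OF \<psi>])
  have meas_t[measurable]: "(\<lambda>r. g (r, t)) \<in> borel_measurable borel" for t
    by (rule measurable_compose[OF _ g]) measurable
  have C0: "0 \<le> C" using order_trans[OF abs_ge_zero bd[of 1 0]] by simp
  have B0: "0 \<le> B" using order_trans[OF abs_ge_zero B[of 0]] .
  have bd': "\<bar>g (r, t) * \<psi> r\<bar> \<le> C / d ^ N * B * indicator {d..M} r" for r t
  proof (cases "r \<in> {d..M}")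
    case True
    have "\<bar>g (r, t)\<bar> \<le> C / d ^ N"
      using True d C0 by (intro order_trans[OF bd] divide_left_mono power_mono mult_pos_pos) auto
    then have "\<bar>g (r, t)\<bar> * \<bar>\<psi> r\<bar> \<le> C / d ^ N * B"
      using B[of r] C0 d by (intro mult_mono) auto
    then show ?thesis using True by (simp add: abs_mult)
  qed (simp add: supp)
  have w: "integrable lborel (\<lambda>r. C / d ^ N * B * indicator {d..M} r)"
    by (intro integrable_mult_right integrable_real_indicator) (auto simp: emeasure_lborel_Icc_eq)
  have int: "integrable lborel (\<lambda>r. g (r, t) * \<psi> r)" for t
  proof (rule Bochner_Integration.integrable_bound[OF w])
    show "AE r in lborel. norm (g (r, t) * \<psi> r) \<le> norm (C / d ^ N * B * indicator {d..M} r)"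
      unfolding real_norm_def by (intro AE_I2 order_trans[OF bd' abs_ge_self])
  qed simp
  have set_eq: "(LINT r:{0<..}|lborel. h r * \<psi> r) = (LINT r|lborel. h r * \<psi> r)"
    "set_integrable lborel {0<..} (\<lambda>r. h r * \<psi> r) \<longleftrightarrow> integrable lborel (\<lambda>r. h r * \<psi> r)" for h
  proof -
    have "indicator {0<..} r *\<^sub>R (h r * \<psi> r) = h r * \<psi> r" for r
      using supp[of r] d by (auto simp: indicator_def)
    then show "(LINT r:{0<..}|lborel. h r * \<psi> r) = (LINT r|lborel. h r * \<psi> r)"
      "set_integrable lborel {0<..} (\<lambda>r. h r * \<psi> r) \<longleftrightarrow> integrable lborel (\<lambda>r. h r * \<psi> r)"
      unfolding set_lebesgue_integral_def set_integrable_def by (simp_all only:)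
  qed
  define L where "L t = (LINT r|lborel. g (r, t) * \<psi> r) + \<kappa> t * \<psi> (X t)" for t
  have "(L \<longlongrightarrow> (LINT r|lborel. g0 r * \<psi> r) + 0) (at_right 0)"
    unfolding L_def
  proof (rule tendsto_add)
    show "((\<lambda>t. LINT r|lborel. g (r, t) * \<psi> r) \<longlongrightarrow> (LINT r|lborel. g0 r * \<psi> r)) (at_right 0)"
    proof (rule tendsto_integral_at_right[where b = 1, OF _ _ w])
      show "AE r in lborel. ((\<lambda>t. g (r, t) * \<psi> r) \<longlongrightarrow> g0 r * \<psi> r) (at_right 0)"
        using AE_lborel_singleton[of R]
      proof eventually_elim
        case (elim r)
        show ?case
        proof (cases "0 < r")
          case True
          then show ?thesis using g_lim elim by (intro tendsto_intros) auto
        next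
          case False
          then show ?thesis using supp[of r] d by simp
        qed
      qed
    qed (use bd' in auto)
    show "((\<lambda>t. \<kappa> t * \<psi> (X t)) \<longlongrightarrow> 0) (at_right 0)"
      by (rule lim_null_mult_right_bounded[OF \<kappa>, of _ B]) (use B in simp)
  qed
  moreover have "\<forall>\<^sub>F t in at_right 0.
     (\<forall>\<^sub>F e in at_right 0. integrable lborel (\<lambda>r. f e (r, t) * \<psi> r)) \<and>
     ((\<lambda>e. LINT r|lborel. f e (r, t) * \<psi> r) \<longlongrightarrow> L t) (at_right 0)"
    using f
  proof eventually_elim
    case (elim t)
    define I where "I e r = (indicator {-(e/2)<..<e/2} (r - X t) :: real)" for e r
    have I_eq: "I e r = (if \<bar>r - X t\<bar> < e / 2 then 1 else 0)" for e r
    proof -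
      have "(- (e / 2) < y \<and> y < e / 2) \<longleftrightarrow> \<bar>y\<bar> < e / 2" for y by linarith
      then show ?thesis by (simp only: I_def indicator_def greaterThanLessThan_iff of_bool_def)
    qed
    have I_meas[measurable]: "I e \<in> borel_measurable borel" for e unfolding I_def by measurable
    have eq: "f e (r, t) * \<psi> r = (1 - I e r) * (g (r, t) * \<psi> r) + c e t * (I e r * \<psi> r)"
      if "\<forall>r>0. f e (r, t) = (if \<bar>r - X t\<bar> < e / 2 then c e t else g (r, t))" for e r
    proof (cases "0 < r")
      case True
      then show ?thesis using that by (simp add: I_eq)
    next
      case False
      then show ?thesis using supp[of r] d by simp
    qed
    have i1: "integrable lborel (\<lambda>r. (1 - I e r) * (g (r, t) * \<psi> r))" for e
      by (rule Bochner_Integration.integrable_bound[OF int[of t]]) (auto simp: I_eq)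
    have i2: "integrable lborel (\<lambda>r. I e r * \<psi> r)" for e
      by (rule integrable_bounded_support[of _ "{d..M}" B]) (use B B0 supp in \<open>auto simp: I_eq\<close>)
    have l1: "((\<lambda>e. LINT r|lborel. (1 - I e r) * (g (r, t) * \<psi> r)) \<longlongrightarrow> (LINT r|lborel. g (r, t) * \<psi> r)) (at_right 0)"
    proof (rule tendsto_integral_at_right[where b = 1, OF _ _ w])
      show "AE r in lborel. ((\<lambda>e. (1 - I e r) * (g (r, t) * \<psi> r)) \<longlongrightarrow> g (r, t) * \<psi> r) (at_right 0)"
        using AE_lborel_singleton[of "X t"]
      proof eventually_elim
        case (elim r)
        then have "0 < 2 * \<bar>r - X t\<bar>" by simp
        then have "\<forall>\<^sub>F e in at_right 0. e < 2 * \<bar>r - X t\<bar>" by (rule eventually_at_right_real[THEN eventually_mono]) auto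
        then have "\<forall>\<^sub>F e in at_right 0. g (r, t) * \<psi> r = (1 - I e r) * (g (r, t) * \<psi> r)"
          by eventually_elim (auto simp: I_eq)
        then show ?case by (rule Lim_transform_eventually[OF tendsto_const])
      qed
      show "\<bar>(1 - I e r) * (g (r, t) * \<psi> r)\<bar> \<le> C / d ^ N * B * indicator {d..M} r" for e r
        using bd'[of r t] by (auto simp: I_eq intro: order_trans[OF abs_ge_zero])
    qed auto
    \<comment> \<open>The factor \<open>e\<close> is split off so that the remaining integral is the
      average of \<open>\<psi>\<close> over the layer.\<close>
    have l2: "((\<lambda>e. e * c e t * ((LINT r|lborel. I e r * \<psi> r) / e)) \<longlongrightarrow> \<kappa> t * \<psi> (X t)) (at_right 0)"
      unfolding I_def by (intro tendsto_mult c layer_average_tendsto[OF \<psi> B])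
    have "((\<lambda>e. LINT r|lborel. f e (r, t) * \<psi> r) \<longlongrightarrow> L t) (at_right 0)"
      unfolding L_def
    proof (rule Lim_transform_eventually[OF tendsto_add[OF l1 l2]])
      show "\<forall>\<^sub>F e in at_right 0. (LINT r|lborel. (1 - I e r) * (g (r, t) * \<psi> r)) + e * c e t * ((LINT r|lborel. I e r * \<psi> r) / e)
         = (LINT r|lborel. f e (r, t) * \<psi> r)"
        using elim eventually_at_right_less[of 0]
        by eventually_elim (simp only: eq, simp add: i1 i2)
    qed
    moreover have "\<forall>\<^sub>F e in at_right 0. integrable lborel (\<lambda>r. f e (r, t) * \<psi> r)"
      using elim by eventually_elim (simp only: eq, intro Bochner_Integration.integrable_add integrable_mult_right i1 i2)
    ultimately show ?case by blast
  qed
  ultimately show "\<exists>L. (\<forall>\<^sub>F t in at_right 0.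
                (\<forall>\<^sub>F \<epsilon> in at_right 0. set_integrable lborel {0<..} (\<lambda>r. f \<epsilon> (r, t) * \<psi> r)) \<and>
                ((\<lambda>\<epsilon>. LINT r:{0<..}|lborel. f \<epsilon> (r, t) * \<psi> r) \<longlongrightarrow> L t) (at_right 0)) \<and>
             (L \<longlongrightarrow> (LINT r:{0<..}|lborel. g0 r * \<psi> r)) (at_right 0)"
    unfolding set_eq by (intro exI[of _ L]) simp
qed

section \<open>Admissibility of the solution with a front\<close>

context delta_front
begin

lemma sol_simps [simp]:
  "dens sol x = (rl * indicator {0<..} (fst x - ul * snd x) * indicator {..0} (fst x - X (snd x))
           + rr * indicator {0<..} (fst x - X (snd x))) / fst x ^ (n - 1)"
  "vel sol x = (if fst x \<le> X (snd x) then ul else ur)"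
  "front sol = Some front0" "origin_mass sol = core_mass"
  "jump_arcs sol = (if 0 < ul then {(0, ereal t1, \<lambda>t. ul * t)} else {})"
  by (simp_all add: sol_def)

lemma front0_simps [simp]:
  "shift front0 = (\<lambda>t. X t - R)" "lifetime front0 = life" "front_mass front0 = (\<lambda>t. m t / X t ^ (n - 1))"
  by (simp_all add: front0_def)

text \<open>For \<open>k = 0\<close> the defect vanishes because \<open>m'\<close> is the sum of the
  two inflows; for \<open>k = 1\<close> its vanishing is the assumption
  \<open>momentum\<close>.\<close>

lemma sol_weak: "weak_solution n R sol"
  unfolding weak_solution_def
proof (intro allI impI ballI)
  fix \<phi> and k :: nat assume \<phi>: "test_function quadrant \<phi>" and k: "k \<in> {0, 1}"
  have "moment_rate k t - (if t < t1 then rl * ul ^ k * (ul - s t) else 0) - rr * ur ^ k * (s t - ur) = 0" for t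
    using k momentum[of t] by (auto simp: moment_rate_def m'_def)
  then show "weak_limit n (\<lambda>e x. sw_dens R sol e x * sw_vel R sol e x ^ k)
                     (\<lambda>e x. sw_dens R sol e x * sw_vel R sol e x ^ (k + 1)) \<phi> 0"
    using weak_limit_moment[OF \<phi>, of k] by simp
qed

text \<open>Once \<open>m * s'\<close> is eliminated by the momentum balance, each side shows the
  loss of an inelastic collision: the flux \<open>rl * (ul - s t)\<close> loses
  \<open>(ul - s t) ^ 2\<close>, and similarly on the right. The factor one half of the kinetic
  energy is restored later by scaling.\<close>

lemma energy_rate:
  "moment_rate 2 t - (if t < t1 then rl * ul ^ 2 * (ul - s t) else 0) - rr * ur ^ 2 * (s t - ur)
    = - (if t < t1 then rl * (ul - s t) ^ 3 else 0) - rr * (s t - ur) ^ 3"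
proof -
  have ms: "m t * s' t = (if t < t1 then rl * ul * (ul - s t) else 0) + rr * ur * (s t - ur) - m' t * s t"
    using momentum[of t] by (simp add: m'_def)
  have mr: "moment_rate 2 t = m' t * s t ^ 2 + 2 * s t * (m t * s' t)"
    by (simp add: moment_rate_def)
  show ?thesis
    unfolding mr ms by (simp add: m'_def algebra_simps power2_eq_square power3_eq_cube)
qed

lemma sol_dissipative: "dissipative n R sol"
  unfolding dissipative_def
proof (intro allI impI)
  fix \<phi> :: "real \<times> real \<Rightarrow> real" assume \<phi>: "test_function quadrant \<phi> \<and> (\<forall>x. 0 \<le> \<phi> x)"
  obtain K where K: "K \<subseteq> quadrant" "\<And>x. x \<notin> K \<Longrightarrow> \<phi> x = 0"
    using \<phi> unfolding test_function_def by blast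
  define L where "L = (LINT t|lborel. (moment_rate 2 t - (if t < t1 then rl * ul ^ 2 * (ul - s t) else 0) - rr * ur ^ 2 * (s t - ur))
       * (\<phi> (X t, t) / X t ^ (n - 1)))"
  have "0 \<le> (LINT t|lborel. - ((moment_rate 2 t - (if t < t1 then rl * ul ^ 2 * (ul - s t) else 0) - rr * ur ^ 2 * (s t - ur))
       * (\<phi> (X t, t) / X t ^ (n - 1))))"
  proof (rule Bochner_Integration.integral_nonneg)
    fix t
    have "0 \<le> \<phi> (X t, t) / X t ^ (n - 1)"
    \<comment> \<open>For \<open>X t \<le> 0\<close> the denominator has no definite sign, but
      \<open>\<phi>\<close> vanishes off the quadrant.\<close>
    proof (cases "0 < X t")
      case False
      then have "\<phi> (X t, t) = 0" using K by (auto simp: quadrant_def)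
      then show ?thesis by simp
    qed (use \<phi> in simp)
    moreover have "0 \<le> (if t < t1 then rl * (ul - s t) ^ 3 else 0) + rr * (s t - ur) ^ 3"
      using rl rr s_lt[of t] s_gt[of t] by (auto intro!: add_nonneg_nonneg mult_nonneg_nonneg zero_le_power)
    ultimately have "0 \<le> ((if t < t1 then rl * (ul - s t) ^ 3 else 0) + rr * (s t - ur) ^ 3) * (\<phi> (X t, t) / X t ^ (n - 1))"
      by (rule mult_nonneg_nonneg[rotated])
    then show "0 \<le> - ((moment_rate 2 t - (if t < t1 then rl * ul ^ 2 * (ul - s t) else 0) - rr * ur ^ 2 * (s t - ur))
       * (\<phi> (X t, t) / X t ^ (n - 1)))"
      unfolding energy_rate by (simp only: mult_minus_left[symmetric] minus_diff_eq minus_minus diff_minus_eq_add) (simp add: add.commute)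
  qed
  then have "L \<le> 0" by (simp add: L_def)
  moreover have "weak_limit n (\<lambda>e x. 1 / 2 * (sw_dens R sol e x * sw_vel R sol e x ^ 2))
      (\<lambda>e x. 1 / 2 * (sw_dens R sol e x * sw_vel R sol e x ^ (2 + 1))) \<phi> (1 / 2 * L)"
    unfolding L_def using \<phi> by (intro weak_limit_scale weak_limit_moment) simp
  then have "weak_limit n (\<lambda>e x. 1 / 2 * sw_dens R sol e x * sw_vel R sol e x ^ 2)
      (\<lambda>e x. 1 / 2 * sw_dens R sol e x * sw_vel R sol e x ^ 3) \<phi> (1 / 2 * L)"
    by (simp add: mult.assoc)
  ultimately show "\<exists>L\<le>0. weak_limit n (\<lambda>e x. 1 / 2 * sw_dens R sol e x * sw_vel R sol e x ^ 2)
      (\<lambda>e x. 1 / 2 * sw_dens R sol e x * sw_vel R sol e x ^ 3) \<phi> L"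
    by (intro exI[of _ "1 / 2 * L"]) simp
qed

text \<open>\<open>X t - ul * t\<close> decreases strictly, so the left edge and the front meet only
  at \<open>t1\<close>. That meeting point is the one exceptional point of the density.\<close>

lemma strictly_after: "t1 < t \<Longrightarrow> X t < ul * t"
proof -
  assume t: "t1 < t"
  have "X t - ul * t < X t1 - ul * t1"
  proof (rule DERIV_neg_imp_decreasing[OF t])
    show "\<exists>y. ((\<lambda>t. X t - ul * t) has_real_derivative y) (at z) \<and> y < 0" for z
      using s_lt[of z] by (intro exI[of _ "s z - ul"]) (auto intro!: derivative_eq_intros X_deriv)
  qed
  then show ?thesis using after[of t1] by simp
qed

lemma open_sets: "open {x :: real \<times> real. fst x < X (snd x)}" "open {x :: real \<times> real. X (snd x) < fst x}"
  "open {x :: real \<times> real. fst x < ul * snd x}" "open {x :: real \<times> real. ul * snd x < fst x}"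
  by (intro open_Collect_less continuous_intros continuous_on_compose2[OF X_cont]; simp)+

lemma front_arc: "0 < t \<Longrightarrow> 0 < X t \<Longrightarrow> t \<in> arc_times 0 life"
  using less_life_iff[of t] by (auto simp: arc_times_def)

lemma sol_regular: "regular_part R sol"
proof -
  have eta: "(\<lambda>t. R + (X t - R)) = X" by simp
  let ?J = "jump_arcs sol \<union> {(0, life, X)}"
  have "piecewise_C1_off ?J (dens sol)"
  proof (rule piecewise_C1_offI[where C = "rl + rr" and N = "n - 1" and P = "{(X t1, t1)}"])
    fix x :: "real \<times> real" assume "x \<in> quadrant"
    then show "\<bar>dens sol x\<bar> \<le> (rl + rr) / fst x ^ (n - 1)"
      using rl rr by (auto simp: indicator_def quadrant_def divide_right_mono)
  next
    fix r t :: real assume rt: "0 < r" "0 < t" "(r, t) \<notin> {(X t1, t1)}"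
    let ?l = "\<lambda>x :: real \<times> real. fst x < X (snd x)" and ?g = "\<lambda>x :: real \<times> real. X (snd x) < fst x"
    let ?a = "\<lambda>x :: real \<times> real. fst x < ul * snd x" and ?b = "\<lambda>x :: real \<times> real. ul * snd x < fst x"
    consider "X t < r" | "r < X t" "ul * t < r" | "r < X t" "r < ul * t" | "r < X t" "r = ul * t"
      | "r = X t" "ul * t < r" | "r = X t" "r < ul * t" | "r = X t" "r = ul * t" by linarith
    then show "(\<exists>U c. open U \<and> (r, t) \<in> U \<and> (\<forall>x\<in>U \<inter> quadrant. dens sol x = c / fst x ^ (n - 1))) \<or>
      (\<exists>a b \<gamma> U c c'. (a, b, \<gamma>) \<in> ?J \<and> t \<in> arc_times a b \<and> r = \<gamma> t \<and> open U \<and> (r, t) \<in> U \<and>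
         (\<forall>x\<in>U \<inter> quadrant. (fst x < \<gamma> (snd x) \<longrightarrow> dens sol x = c / fst x ^ (n - 1)) \<and>
                               (\<gamma> (snd x) < fst x \<longrightarrow> dens sol x = c' / fst x ^ (n - 1))))"
    proof cases
      case 1
      then show ?thesis
        using open_sets(2) by (intro disjI1 exI[of _ "Collect ?g"] exI[of _ rr]) (auto simp: indicator_def)
    next
      case 2
      then show ?thesis
        using open_Int[OF open_sets(1,4)]
        by (intro disjI1 exI[of _ "Collect ?l \<inter> Collect ?b"] exI[of _ rl]) (auto simp: indicator_def)
    next
      case 3
      then show ?thesis
        using open_Int[OF open_sets(1,3)]
        by (intro disjI1 exI[of _ "Collect ?l \<inter> Collect ?a"] exI[of _ 0]) (auto simp: indicator_def)
    next
      case 4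
      \<comment> \<open>The left edge lies strictly behind the front only before \<open>t1\<close>,
        which is exactly the lifetime given to its arc.\<close>
      then have "t < t1" using after[of t] by (cases "t < t1") auto
      moreover have "0 < ul" using 4 rt by (auto simp: zero_less_mult_iff)
      ultimately show ?thesis
        using 4 rt open_sets(1)
        by (intro disjI2 exI[of _ 0] exI[of _ "ereal t1"] exI[of _ "\<lambda>t. ul * t"] exI[of _ "Collect ?l"] exI[of _ rl])
          (auto simp: indicator_def arc_times_def)
    next
      case 5
      then show ?thesis
        using rt open_sets(4) front_arc[of t]
        by (intro disjI2 exI[of _ 0] exI[of _ life] exI[of _ X] exI[of _ "Collect ?b"] exI[of _ rl] exI[of _ rr])
          (auto simp: indicator_def)
    next
      case 6
      then show ?thesis
        using rt open_sets(3) front_arc[of t]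
        by (intro disjI2 exI[of _ 0] exI[of _ life] exI[of _ X] exI[of _ "Collect ?a"] exI[of _ 0] exI[of _ rr])
          (auto simp: indicator_def)
    next
      case 7
      then have "t = t1" using before[of t] strictly_after[of t] by (cases t t1 rule: linorder_cases) auto
      then show ?thesis using 7 rt by simp
    qed
  qed simp
  moreover have "piecewise_C1_off ?J (vel sol)"
  \<comment> \<open>The velocity does not see the left edge, so there is no exceptional
    point.\<close>
  proof (rule piecewise_C1_offI[where C = "\<bar>ul\<bar> + \<bar>ur\<bar>" and N = 0 and P = "{}"])
    fix r t :: real assume rt: "0 < r" "0 < t"
    consider "X t < r" | "r < X t" | "r = X t" by linarith
    then show "(\<exists>U c. open U \<and> (r, t) \<in> U \<and> (\<forall>x\<in>U \<inter> quadrant. vel sol x = c / fst x ^ 0)) \<or>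
      (\<exists>a b \<gamma> U c c'. (a, b, \<gamma>) \<in> ?J \<and> t \<in> arc_times a b \<and> r = \<gamma> t \<and> open U \<and> (r, t) \<in> U \<and>
         (\<forall>x\<in>U \<inter> quadrant. (fst x < \<gamma> (snd x) \<longrightarrow> vel sol x = c / fst x ^ 0) \<and>
                               (\<gamma> (snd x) < fst x \<longrightarrow> vel sol x = c' / fst x ^ 0)))"
    proof cases
      case 1
      then show ?thesis
        using open_sets(2) by (intro disjI1 exI[of _ "{x. X (snd x) < fst x}"] exI[of _ ur]) auto
    next
      case 2
      then show ?thesis
        using open_sets(1) by (intro disjI1 exI[of _ "{x. fst x < X (snd x)}"] exI[of _ ul]) auto
    next
      case 3
      then show ?thesis
        using rt front_arc[of t]
        by (intro disjI2 exI[of _ 0] exI[of _ life] exI[of _ X] exI[of _ UNIV] exI[of _ ul] exI[of _ ur]) auto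
    qed
  qed auto
  moreover have "C1_arc A" if "A \<in> jump_arcs sol" for A
    using that t1 by (auto simp: C1_arc_def arc_times_def C1_differentiable_on_def split: if_splits
        intro!: exI[of _ "\<lambda>_. ul"] derivative_eq_intros simp flip: has_real_derivative_iff_has_vector_derivative)
  moreover have "{(0, lifetime F, \<lambda>t. R + shift F t) |F. front sol = Some F} = {(0, life, X)}"
    by (simp add: eta)
  ultimately show ?thesis
    unfolding regular_part_def by (simp add: eta)
qed

lemma X_pos_front: "t \<in> front_times front0 \<Longrightarrow> 0 < X t"
  by (simp add: front_times_iff)

lemma m'_cont: "continuous_on (- {t1}) m'"
proof -
  have "continuous_on {..<t1} m'"
    by (rule continuous_on_eq[where f = "\<lambda>t. rl * (ul - s t) + rr * (s t - ur)"])
      (auto simp: m'_def intro!: continuous_intros continuous_on_subset[OF s_cont])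
  moreover have "continuous_on {t1<..} m'"
    by (rule continuous_on_eq[where f = "\<lambda>t. rr * (s t - ur)"])
      (auto simp: m'_def intro!: continuous_intros continuous_on_subset[OF s_cont])
  ultimately have "continuous_on ({..<t1} \<union> {t1<..}) m'"
    by (intro continuous_on_open_Un) auto
  moreover have "{..<t1} \<union> {t1<..} = - {t1}" by auto
  ultimately show ?thesis by simp
qed

lemma front0_regular: "front_regular R front0"
  unfolding front_regular_def
proof (intro conjI ballI exI[of _ s])
  let ?T = "front_times front0"
  show "0 < lifetime front0" using less_life_iff[of 0] R X_0 by (simp add: zero_ereal_def)
  show "shift front0 0 = 0" by (simp add: X_0)
  show "0 < R + shift front0 t" if "t \<in> ?T" for t using X_pos_front[OF that] by simp
  show "(shift front0 has_real_derivative s t) (at t within ?T)" for t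
    by (rule has_field_derivative_at_within) (auto intro!: derivative_eq_intros X_deriv)
  show "s piecewise_C1_differentiable_on ?T"
    unfolding piecewise_C1_differentiable_on_def C1_differentiable_on_def
    by (intro conjI continuous_on_subset[OF s_cont] exI[of _ "{t1}"] exI[of _ s'] ballI continuous_on_subset[OF s'_cont])
      (auto simp: s_deriv simp flip: has_real_derivative_iff_has_vector_derivative)
  define D where "D t = (m' t * X t ^ (n - 1) - m t * (real (n - 1) * X t ^ (n - 1 - 1) * s t)) / (X t ^ (n - 1) * X t ^ (n - 1))" for t
  have "((\<lambda>t. m t / X t ^ (n - 1)) has_real_derivative D t) (at t)" if "t \<in> ?T - {t1}" for t
  proof -
    have "((\<lambda>t. X t ^ (n - 1)) has_real_derivative real (n - 1) * X t ^ (n - 1 - 1) * s t) (at t)"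
      by (auto intro!: derivative_eq_intros X_deriv simp: mult_ac)
    then show ?thesis
      unfolding D_def m'_def using that X_pos_front[of t] by (intro DERIV_divide m_deriv) auto
  qed
  moreover have "continuous_on (?T - {t1}) D"
    unfolding D_def
    by (intro continuous_intros continuous_on_subset[OF X_cont] continuous_on_subset[OF s_cont] continuous_on_subset[OF m_cont]
        continuous_on_subset[OF m'_cont]) (use X_pos_front in force)+
  moreover have "continuous_on ?T (\<lambda>t. m t / X t ^ (n - 1))"
    by (intro continuous_intros continuous_on_subset[OF X_cont] continuous_on_subset[OF m_cont]) (use X_pos_front in force)+
  ultimately show "front_mass front0 piecewise_C1_differentiable_on ?T"
    unfolding piecewise_C1_differentiable_on_def C1_differentiable_on_def
    by (auto intro!: exI[of _ "{t1}"] exI[of _ D] simp flip: has_real_derivative_iff_has_vector_derivative)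
qed

end

definition initial_dens :: "nat \<Rightarrow> real \<Rightarrow> real \<Rightarrow> real \<Rightarrow> real \<Rightarrow> real" where
  "initial_dens n R rl rr = (\<lambda>r. if r < R then rl * r powi (1 - int n) else rr * r powi (1 - int n))"

lemma powi_eq_inverse_power: "1 \<le> n \<Longrightarrow> r powi (1 - int n) = 1 / (r :: real) ^ (n - 1)"
proof -
  assume "1 \<le> n"
  then have "1 - int n = - int (n - 1)" by simp
  then show ?thesis by (simp only: power_int_minus power_int_of_nat inverse_eq_divide)
qed

lemma initial_dens_eq:
  "1 \<le> n \<Longrightarrow> initial_dens n R rl rr r = (if r < R then rl else rr) / r ^ (n - 1)"
  by (simp add: initial_dens_def powi_eq_inverse_power)

lemma initial_dens_measurable [measurable]: "1 \<le> n \<Longrightarrow> initial_dens n R rl rr \<in> borel_measurable borel"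
  by (subst measurable_cong[OF initial_dens_eq]) measurable

context delta_front
begin

section \<open>The solution with a front: origin, signs, waves and initial data\<close>

lemma life_pos: "0 < life"
  using less_life_iff[of 0] R X_0 by (simp add: zero_ereal_def)

lemma life_cases: obtains (never) "life = \<infinity>" | (hit) t0 where "life = ereal t0" "0 < t0" "X t0 = 0"
  using life_pos life_eq by (cases life) auto

lemma core_mass_deriv_before:
  assumes "ereal t < life"
  shows "(core_mass has_real_derivative sphere_area n * (rl * max 0 (- ul))) (at t)"
proof -
  obtain U where U: "open U" "t \<in> U" "\<And>u. u \<in> U \<Longrightarrow> ereal u < life"
  proof (cases rule: life_cases)
    case never then show ?thesis using that[of UNIV] by simp
  next
    case (hit t0) then show ?thesis using that[of "{..<t0}"] assms by auto
  qed
  have "((\<lambda>t. sphere_area n * (rl * max 0 (- ul) * t)) has_real_derivative sphere_area n * (rl * max 0 (- ul))) (at t)"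
    by (auto intro!: derivative_eq_intros)
  then show ?thesis
    by (rule has_field_derivative_transform_within_open[OF _ U(1,2)]) (use U(3) in \<open>simp add: core_mass_def\<close>)
qed

lemma core_mass_deriv_after:
  assumes "life = ereal t0" "t0 < t"
  shows "(core_mass has_real_derivative - (sphere_area n * rr * ur)) (at t)"
proof -
  have "((\<lambda>t. sphere_area n * (rl * max 0 (- ul) * t0 + m t0 - rr * ur * (t - t0))) has_real_derivative - (sphere_area n * rr * ur)) (at t)"
    by (auto intro!: derivative_eq_intros)
  then show ?thesis
    by (rule has_field_derivative_transform_within_open[OF _ open_greaterThan[of t0]]) (use assms in \<open>auto simp: core_mass_def\<close>)
qed

text \<open>The trace at the origin switches from the left velocity to the right one when the front
  arrives, so the arrival is the only time to be excluded.\<close>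

lemma sol_origin: "origin_conditions n sol"
  unfolding origin_conditions_def
proof (intro exI[of _ "{t. life = ereal t}"] conjI allI impI)
  show "finite ({t. life = ereal t} \<inter> {0..T})" for T
    by (rule finite_subset[of _ "{real_of_ereal life}"]) auto
next
  fix t :: real assume t: "0 < t" "t \<notin> {t. life = ereal t}"
  show "\<exists>v w. ((\<lambda>r. vel sol (r, t)) \<longlongrightarrow> v) (at_right 0) \<and>
               ((\<lambda>r. dens sol (r, t) * r ^ (n - 1)) \<longlongrightarrow> w) (at_right 0) \<and>
               (v > 0 \<longrightarrow> (origin_mass sol has_real_derivative 0) (at t) \<and>
                          ((\<lambda>r. dens sol (r, t)) \<longlongrightarrow> 0) (at_right 0)) \<and>
               (v < 0 \<longrightarrow> (\<exists>q. ((\<lambda>r. r ^ (n - 1) * sphere_area n * dens sol (r, t) * vel sol (r, t))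
                                   \<longlongrightarrow> q) (at_right 0) \<and>
                               (origin_mass sol has_real_derivative - q) (at t))) \<and>
               (v = 0 \<longrightarrow> (origin_mass sol has_real_derivative 0) (at t))"
  proof (cases "ereal t < life")
    case True
    then have X: "0 < X t" using less_life_iff[of t] t by simp
    \<comment> \<open>Below this radius only the vacuum (if \<open>0 < ul\<close>) or only the left
      state (otherwise) is present at time \<open>t\<close>.\<close>
    define e where "e = (if 0 < ul then min (X t) (ul * t) else X t)"
    have "0 < e" using X t by (auto simp: e_def)
    then have ev: "\<forall>\<^sub>F r in at_right 0. 0 < r \<and> r < e"
      using eventually_at_right_real by (auto elim!: eventually_mono)
    have lt: "r < X t" "0 < ul \<Longrightarrow> r < ul * t" if "r < e" for r using that by (auto simp: e_def split: if_splits)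
    have neg: "ul * t < r" if "\<not> 0 < ul" "0 < r" for r
      using that t mult_nonpos_nonneg[of ul t] by linarith
    show ?thesis
    proof (rule origin_condition_at[where v = ul and w = "if 0 < ul then 0 else rl"])
      show "\<forall>\<^sub>F r in at_right 0. vel sol (r, t) = ul"
        using ev by eventually_elim (use lt in force)
      show "\<forall>\<^sub>F r in at_right 0. dens sol (r, t) = (if 0 < ul then 0 else rl) / r ^ (n - 1)"
        using ev
      proof eventually_elim
        case (elim r)
        then show ?case using lt[of r] neg[of r] by (auto simp: indicator_def)
      qed
      show "(origin_mass sol has_real_derivative - (sphere_area n * (if 0 < ul then 0 else rl) * ul)) (at t)"
        using core_mass_deriv_before[OF True] by (auto simp: max_def mult.assoc)
    qed auto
  next
    case False
    then obtain t0 where t0: "life = ereal t0" "t0 < t" using t(2) life_pos by (cases life) auto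
    then have X: "X t0 = 0" "0 < t0" using life_eq by auto
    then have X: "X t \<le> 0" and ur: "ur < 0" using X_stays_nonpos[of t0 t] t0(2) s_gt[of t0] by auto
    show ?thesis
    proof (rule origin_condition_at[where v = ur and w = rr])
      show "\<forall>\<^sub>F r in at_right 0. vel sol (r, t) = ur"
        using eventually_at_right_less[of 0] by eventually_elim (use X in simp)
      show "\<forall>\<^sub>F r in at_right 0. dens sol (r, t) = rr / r ^ (n - 1)"
        using eventually_at_right_less[of 0] by eventually_elim (use X in \<open>simp add: indicator_def\<close>)
    qed (use core_mass_deriv_after[OF t0] ur in simp_all)
  qed
qed

text \<open>The front mass \<open>m t / X t ^ (n - 1)\<close> may blow up at the arrival, but its
  product with \<open>X t ^ (n - 1)\<close> is \<open>m t\<close>, which has a finite limit. This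
  limit is the jump built into \<open>core_mass\<close>.\<close>

lemma sol_absorption: "origin_absorption n R sol"
  unfolding origin_absorption_def
proof (intro conjI allI impI)
  fix t :: real assume t: "0 < t" and no: "\<nexists>F. front sol = Some F \<and> hits_origin R F t"
  have Xt: "(X \<longlongrightarrow> X t) (at_left t)" for t
    using X_cont by (auto simp: continuous_on_def intro: tendsto_within_subset)
  have "life \<noteq> ereal t"
  proof
    assume l: "life = ereal t"
    then have "hits_origin R front0 t" using Xt[of t] life_eq[OF l] by (simp add: hits_origin_def)
    then show False using no by simp
  qed
  then consider "ereal t < life" | t0 where "life = ereal t0" "t0 < t"
    using life_pos by (cases life) (auto simp: linorder_neq_iff)
  then show "isCont (origin_mass sol) t"
    using core_mass_deriv_before core_mass_deriv_after by cases (auto intro: DERIV_isCont)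
next
  fix F t0 assume "front sol = Some F \<and> hits_origin R F t0"
  then have F: "F = front0" and l: "life = ereal t0" by (auto simp: hits_origin_def)
  have t0: "0 < t0" "X t0 = 0" using life_eq[OF l] by auto
  let ?m = "sphere_area n * (rl * max 0 (- ul) * t0)"
  have m: "(core_mass \<longlongrightarrow> ?m) (at_left t0)"
  proof (rule Lim_transform_eventually)
    show "((\<lambda>t. sphere_area n * (rl * max 0 (- ul) * t)) \<longlongrightarrow> ?m) (at_left t0)" by (intro tendsto_intros)
    show "\<forall>\<^sub>F t in at_left t0. sphere_area n * (rl * max 0 (- ul) * t) = core_mass t"
      using eventually_at_left_real[OF t0(1)] by eventually_elim (simp add: core_mass_def l)
  qed
  have M: "((\<lambda>t. front_mass F t * (R + shift F t) ^ (n - 1) * sphere_area n) \<longlongrightarrow> m t0 * sphere_area n) (at_left t0)"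
  proof (rule Lim_transform_eventually)
    have "(m \<longlongrightarrow> m t0) (at_left t0)" using m_cont by (auto simp: continuous_on_def intro: tendsto_within_subset)
    then show "((\<lambda>t. m t * sphere_area n) \<longlongrightarrow> m t0 * sphere_area n) (at_left t0)" by (intro tendsto_intros)
    show "\<forall>\<^sub>F t in at_left t0. m t * sphere_area n = front_mass F t * (R + shift F t) ^ (n - 1) * sphere_area n"
      using eventually_at_left_real[OF t0(1)]
    proof eventually_elim
      case (elim t)
      then have "0 < X t" using less_life_iff[of t] l by simp
      then show ?case by (simp add: F)
    qed
  qed
  have "(core_mass \<longlongrightarrow> ?m + m t0 * sphere_area n) (at_right t0)"
  proof (rule Lim_transform_eventually)
    have "((\<lambda>t. sphere_area n * (rl * max 0 (- ul) * t0 + m t0 - rr * ur * (t - t0))) \<longlongrightarrow>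
       sphere_area n * (rl * max 0 (- ul) * t0 + m t0 - rr * ur * (t0 - t0))) (at_right t0)" by (intro tendsto_intros)
    then show "((\<lambda>t. sphere_area n * (rl * max 0 (- ul) * t0 + m t0 - rr * ur * (t - t0))) \<longlongrightarrow>
       ?m + m t0 * sphere_area n) (at_right t0)" by (simp add: algebra_simps)
    show "\<forall>\<^sub>F t in at_right t0. sphere_area n * (rl * max 0 (- ul) * t0 + m t0 - rr * ur * (t - t0)) = core_mass t"
      using eventually_at_right_less[of t0] by eventually_elim (simp add: core_mass_def l)
  qed
  then show "\<exists>m M. (origin_mass sol \<longlongrightarrow> m) (at_left t0) \<and>
               ((\<lambda>t. front_mass F t * (R + shift F t) ^ (n - 1) * sphere_area n) \<longlongrightarrow> M) (at_left t0) \<and>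
               (origin_mass sol \<longlongrightarrow> m + M) (at_right t0)"
    using m M by (intro exI[of _ ?m] exI[of _ "m t0 * sphere_area n"]) simp
qed

lemma core_mass_0: "(origin_mass sol \<longlongrightarrow> 0) (at_right 0)"
proof -
  have "isCont core_mass 0" by (rule DERIV_isCont[OF core_mass_deriv_before]) (use life_pos in \<open>simp add: zero_ereal_def\<close>)
  moreover have "core_mass 0 = 0" using life_pos by (simp add: core_mass_def flip: zero_ereal_def)
  ultimately show ?thesis by (auto simp: isCont_def intro: tendsto_within_subset)
qed

text \<open>After the arrival the term with \<open>ur\<close> is a gain: the front reached the
  origin with negative speed, and \<open>ur\<close> lies below that speed.\<close>

lemma sol_physical: "physical sol"
  unfolding physical_def
proof (intro conjI ballI allI impI)
  show "0 \<le> dens sol x" if "x \<in> quadrant" for x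
    using that rl rr by (auto simp: quadrant_def indicator_def)
  show "0 \<le> front_mass F t" if "front sol = Some F" "t \<in> front_times F" for F t
  proof -
    have F: "F = front0" using that by simp
    have "0 \<le> m t" using that m_pos[of t] m_0 F by (cases "t = 0") (auto simp: front_times_iff)
    then show ?thesis using that F X_pos_front[of t] by simp
  qed
  show "0 \<le> origin_mass sol t" if t: "0 < t" for t
  proof (cases "ereal t < life")
    case True
    then show ?thesis using sphere_area_nonneg[OF n] rl t by (simp add: core_mass_def)
  next
    case False
    then obtain t0 where l: "life = ereal t0" "t0 \<le> t" using life_pos by (cases life) auto
    then have t0: "0 < t0" "X t0 = 0" using life_eq by auto
    then have "ur < 0" using X_stays_nonpos(1)[of t0 t0] s_gt[of t0] by auto
    then have "0 \<le> - (rr * ur * (t - t0))"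
      using rr l(2) by (simp add: mult_nonneg_nonpos mult_nonpos_nonneg)
    moreover have "0 < m t0" using m_pos t0 by simp
    moreover have "0 \<le> rl * max 0 (- ul) * t0" using rl t0 by simp
    ultimately have "0 \<le> rl * max 0 (- ul) * t0 + m t0 - rr * ur * (t - t0)" by linarith
    then show ?thesis using sphere_area_nonneg[OF n] l by (simp add: core_mass_def)
  qed
qed

text \<open>The front carries positive mass at every positive time and so never counts as a massless
  curve. What remains is the left edge, present for \<open>ul > 0\<close> until \<open>t1\<close>,
  with vacuum on its inner side.\<close>

lemma sol_waves: "wave_structure R sol"
  unfolding wave_structure_def
proof (intro allI impI)
  fix t :: real assume t: "0 < t"
  have nofront: "front_mass front0 t \<noteq> 0" if "t \<in> front_times front0"
    using X_pos_front[OF that] m_pos[OF t] by simp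
  have eq: "massless_curves R sol t = (if 0 < ul \<and> t < t1 then {\<lambda>t. ul * t} else {})"
    using nofront t by (auto simp: massless_curves_def arc_times_def)
  have "vacuum_shock sol (\<lambda>t. ul * t) t" if "0 < ul" "t < t1"
  proof -
    have X: "ul * t < X t" using before that by simp
    have "\<forall>\<^sub>F r in at_left (ul * t). dens sol (r, t) = 0"
      using eventually_at_left_real[OF mult_pos_pos[OF that(1) t]] by eventually_elim (use X in \<open>auto simp: indicator_def\<close>)
    moreover have "\<forall>\<^sub>F r in at_right (ul * t). vel sol (r, t) = ul"
      using eventually_at_right_real[OF X] by eventually_elim auto
    then have "((\<lambda>r. vel sol (r, t)) \<longlongrightarrow> ul) (at_right (ul * t))" by (rule tendsto_eventually)
    moreover have "((\<lambda>t. ul * t) has_real_derivative ul) (at t)" by (auto intro!: derivative_eq_intros)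
    ultimately show ?thesis unfolding vacuum_shock_def by blast
  qed
  then show "\<exists>C V. massless_curves R sol t = C \<union> V \<and>
        finite C \<and> card C \<le> 1 \<and> (\<forall>\<gamma>\<in>C. contact_discontinuity sol \<gamma> t) \<and>
        finite V \<and> card V \<le> 3 \<and> (\<forall>\<gamma>\<in>V. vacuum_shock sol \<gamma> t)"
    by (intro exI[of _ "{}"] exI[of _ "massless_curves R sol t"]) (auto simp: eq)
qed

lemma sol_measurable [measurable]: "dens sol \<in> borel_measurable borel" "vel sol \<in> borel_measurable borel"
  unfolding sol_def by (simp_all, measurable)

text \<open>In the density the front is a point mass \<open>m t / X t ^ (n - 1)\<close>, which
  vanishes initially since \<open>m\<close> tends to 0 while \<open>X\<close> tends to
  \<open>R > 0\<close>. In the velocity the layer leaves no trace in the limit.\<close>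

lemma
  shows initial_dens_limit: "initial_limit (sw_dens R sol) (initial_dens n R rl rr)"
    and initial_vel_limit: "initial_limit (sw_vel R sol) (\<lambda>r. if r < R then ul else ur)"
proof -
  have Xlim: "(X \<longlongrightarrow> R) (at_right 0)" "((\<lambda>t. ul * t) \<longlongrightarrow> 0) (at_right 0)"
    using X_cont X_0 by (auto simp: continuous_on_def intro: tendsto_within_subset intro!: tendsto_eq_intros)
  have ev: "\<forall>\<^sub>F t in at_right 0. t \<in> front_times front0 \<and> 0 < t"
  proof -
    have "\<forall>\<^sub>F t in at_right 0. 0 < X t" using order_tendstoD(1)[OF Xlim(1)] R by blast
    then show ?thesis using eventually_at_right_less[of 0] by eventually_elim (simp add: front_times_iff)
  qed
  have side: "\<forall>\<^sub>F t in at_right 0. (r < X t \<longleftrightarrow> r < R) \<and> r \<noteq> X t \<and> ul * t < r" if "0 < r" "r \<noteq> R" for r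
  proof -
    have "\<forall>\<^sub>F t in at_right 0. ul * t < r" using order_tendstoD(2)[OF Xlim(2)] that by blast
    moreover have "\<forall>\<^sub>F t in at_right 0. (r < X t \<longleftrightarrow> r < R) \<and> r \<noteq> X t"
    proof (cases "r < R")
      case True
      show ?thesis using order_tendstoD(1)[OF Xlim(1) True] by eventually_elim (use True in auto)
    next
      case False
      then have "R < r" using that by simp
      from order_tendstoD(2)[OF Xlim(1) this] show ?thesis by eventually_elim (use False in auto)
    qed
    ultimately show ?thesis by eventually_elim auto
  qed
  show "initial_limit (sw_dens R sol) (initial_dens n R rl rr)"
  proof (rule initial_limitI[where g = "dens sol" and X = X and c = "\<lambda>e t. m t / X t ^ (n - 1) / e"
        and \<kappa> = "\<lambda>t. m t / X t ^ (n - 1)" and C = "rl + rr" and N = "n - 1" and R = R])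
    show "\<bar>dens sol (r, t)\<bar> \<le> (rl + rr) / r ^ (n - 1)" if "0 < r" for r t
      using that rl rr by (auto simp: indicator_def divide_right_mono)
    show "((\<lambda>t. dens sol (r, t)) \<longlongrightarrow> initial_dens n R rl rr r) (at_right 0)" if "0 < r" "r \<noteq> R" for r
      by (rule tendsto_eventually)
        (use side[OF that] in \<open>eventually_elim, auto simp: initial_dens_eq[OF n] indicator_def\<close>)
    show "\<forall>\<^sub>F t in at_right 0. \<forall>\<^sub>F e in at_right 0. \<forall>r>0. sw_dens R sol e (r, t) =
         (if \<bar>r - X t\<bar> < e / 2 then m t / X t ^ (n - 1) / e else dens sol (r, t))"
      using ev
    proof eventually_elim
      case (elim t)
      then show ?case by (simp add: sw_dens_def in_layer_def)
    qed
    show "((\<lambda>e. e * (m t / X t ^ (n - 1) / e)) \<longlongrightarrow> m t / X t ^ (n - 1)) (at_right 0)" for t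
      by (rule tendsto_eventually) (use eventually_at_right_less[of 0] in \<open>eventually_elim, simp\<close>)
    have "(m \<longlongrightarrow> m 0) (at_right 0)" using m_cont by (auto simp: continuous_on_def intro: tendsto_within_subset)
    then have "(m \<longlongrightarrow> 0) (at_right 0)" by (simp only: m_0)
    then have "((\<lambda>t. m t / X t ^ (n - 1)) \<longlongrightarrow> 0 / R ^ (n - 1)) (at_right 0)"
      using R Xlim by (intro tendsto_intros) auto
    then show "((\<lambda>t. m t / X t ^ (n - 1)) \<longlongrightarrow> 0) (at_right 0)" by simp
  qed (use n in measurable)
  show "initial_limit (sw_vel R sol) (\<lambda>r. if r < R then ul else ur)"
  proof (rule initial_limitI[where g = "vel sol" and X = X and c = "\<lambda>e t. s t"
        and \<kappa> = "\<lambda>t. 0" and C = "\<bar>ul\<bar> + \<bar>ur\<bar>" and N = 0 and R = R])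
    show "((\<lambda>t. vel sol (r, t)) \<longlongrightarrow> (if r < R then ul else ur)) (at_right 0)" if "0 < r" "r \<noteq> R" for r
      by (rule tendsto_eventually)
        (use side[OF that] in \<open>eventually_elim, auto\<close>)
    show "\<forall>\<^sub>F t in at_right 0. \<forall>\<^sub>F e in at_right 0. \<forall>r>0. sw_vel R sol e (r, t) =
         (if \<bar>r - X t\<bar> < e / 2 then s t else vel sol (r, t))"
      using ev
    proof eventually_elim
      case (elim t)
      have "deriv (\<lambda>t. X t - R) t = s t" using deriv_shift[of t] by simp
      with elim show ?case by (simp add: sw_vel_def in_layer_def)
    qed
    show "((\<lambda>e. e * s t) \<longlongrightarrow> 0) (at_right 0)" for t by (auto intro!: tendsto_eq_intros)
  qed (auto, measurable)
qed

lemma delta_front_solution: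
  "sdw_solution n R (initial_dens n R rl rr) (\<lambda>r. if r < R then ul else ur) sol \<and>
     physical sol \<and> dissipative n R sol \<and> wave_structure R sol"
  unfolding sdw_solution_def
  using sol_regular front0_regular sol_weak sol_origin sol_absorption initial_dens_limit initial_vel_limit core_mass_0 sol_physical sol_dissipative sol_waves
  by simp

end

section \<open>Solutions without a front\<close>

text \<open>
  The left state fills \<open>\<alpha> * t < r \<le> R + \<alpha> * t\<close> and the right one \<open>r > R + \<beta> * t\<close>. If \<open>ur < ul\<close>, one of the states
  is a vacuum, and it is given the speed of the other one so that the two regions do not overlap.
\<close>

locale free_flow =
  fixes n :: nat and R rl rr ul ur \<alpha> \<beta> :: real
  assumes n: "1 \<le> n" and R: "0 < R" and rl: "0 \<le> rl" and rr: "0 \<le> rr"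
    and speeds: "(\<alpha> = ul \<and> \<beta> = ur \<and> ul \<le> ur) \<or> (rr = 0 \<and> \<alpha> = ul \<and> \<beta> = ul) \<or> (rl = 0 \<and> \<alpha> = ur \<and> \<beta> = ur)"
begin

lemma speeds_le: "\<alpha> \<le> \<beta>" and left_speed: "rl = 0 \<or> \<alpha> = ul" and right_speed: "rr = 0 \<or> \<beta> = ur"
  using speeds by auto

lemma curves_le: "0 \<le> t \<Longrightarrow> R + \<alpha> * t \<le> R + \<beta> * t"
  using speeds_le by (simp add: mult_right_mono)

lemma curves_less: "0 < t \<Longrightarrow> \<alpha> \<noteq> \<beta> \<Longrightarrow> R + \<alpha> * t < R + \<beta> * t"
  using speeds_le by simp

definition line_life :: "real \<Rightarrow> ereal" where
  "line_life c = (if c < 0 then ereal (R / - c) else \<infinity>)"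

text \<open>The two terms measure the lengths of the left and the right state that have passed the
  origin: the left state has total length \<open>R\<close>, and the right one starts at distance
  \<open>R\<close>. The result is continuous in time, as required without a front.\<close>

definition core_mass :: "real \<Rightarrow> real" where
  "core_mass t = sphere_area n * (rl * max 0 (min (- \<alpha> * t) R) + rr * max 0 (- \<beta> * t - R))"

text \<open>The velocity changes at the right edge of the left region, so a vacuum gap carries
  \<open>ur\<close>. The edge from the origin is listed only if \<open>0 < rl\<close>: for
  \<open>rl = 0\<close> there is nothing to separate, and its speed \<open>\<alpha>\<close> need not
  agree with the velocity \<open>ul\<close> beside it. For \<open>\<alpha> = \<beta>\<close> the two
  other arcs coincide.\<close>

definition sol :: sdw where
  "sol = \<lparr>dens = (\<lambda>x. (rl * indicator {0<..} (fst x - \<alpha> * snd x) * indicator {..0} (fst x - (R + \<alpha> * snd x))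
           + rr * indicator {0<..} (fst x - (R + \<beta> * snd x))) / fst x ^ (n - 1)),
        vel = (\<lambda>x. if fst x \<le> R + \<alpha> * snd x then ul else ur),
        jump_arcs = (if 0 < \<alpha> \<and> 0 < rl then {(0, \<infinity>, \<lambda>t. \<alpha> * t)} else {}) \<union>
          {(0, line_life \<alpha>, \<lambda>t. R + \<alpha> * t), (0, line_life \<beta>, \<lambda>t. R + \<beta> * t)},
        front = None, origin_mass = core_mass\<rparr>"

lemma sol_simps [simp]:
  "dens sol x = (rl * indicator {0<..} (fst x - \<alpha> * snd x) * indicator {..0} (fst x - (R + \<alpha> * snd x))
           + rr * indicator {0<..} (fst x - (R + \<beta> * snd x))) / fst x ^ (n - 1)"
  "vel sol x = (if fst x \<le> R + \<alpha> * snd x then ul else ur)"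
  "front sol = None" "origin_mass sol = core_mass"
  "jump_arcs sol = (if 0 < \<alpha> \<and> 0 < rl then {(0, \<infinity>, \<lambda>t. \<alpha> * t)} else {}) \<union>
          {(0, line_life \<alpha>, \<lambda>t. R + \<alpha> * t), (0, line_life \<beta>, \<lambda>t. R + \<beta> * t)}"
  by (simp_all add: sol_def)

lemma sw_eq [simp]: "sw_dens R sol e = dens sol" "sw_vel R sol e = vel sol"
  by (simp_all add: sw_dens_def[abs_def] sw_vel_def[abs_def] fun_eq_iff)

lemma sol_measurable [measurable]: "dens sol \<in> borel_measurable borel" "vel sol \<in> borel_measurable borel"
  unfolding sol_def by (simp_all, measurable)

lemma line_time: "t \<in> arc_times 0 (line_life c) \<longleftrightarrow> 0 < t \<and> 0 < R + c * t"
proof -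
  have "t < R / - c \<longleftrightarrow> 0 < R + c * t" if "c < 0"
  proof -
    have "0 < - c" using that by simp
    then have "t < R / - c \<longleftrightarrow> t * - c < R" by (rule pos_less_divide_eq)
    then show ?thesis by (auto simp: mult.commute[of t])
  qed
  moreover have "0 < R + c * t" if "\<not> c < 0" "0 < t"
    using that R by (simp add: add_pos_nonneg)
  ultimately show ?thesis by (auto simp: arc_times_def line_life_def)
qed

lemma dens_mult_vel_power:
  assumes "x \<in> quadrant"
  shows "dens sol x * vel sol x ^ k = (rl * ul ^ k * indicator {0<..} (fst x - \<alpha> * snd x) * indicator {..0} (fst x - (R + \<alpha> * snd x))
        + rr * ur ^ k * indicator {0<..} (fst x - (R + \<beta> * snd x))) / fst x ^ (n - 1)"
proof -
  have "R + \<alpha> * snd x \<le> R + \<beta> * snd x" using assms by (intro curves_le) (auto simp: quadrant_def)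
  then show ?thesis by (auto simp: indicator_def)
qed

lemma weak_limit_moment:
  assumes \<phi>: "test_function quadrant \<phi>"
  shows "weak_limit n (\<lambda>e x. sw_dens R sol e x * sw_vel R sol e x ^ k) (\<lambda>e x. sw_dens R sol e x * sw_vel R sol e x ^ (k + 1)) \<phi> 0"
  unfolding sw_eq
proof (rule weak_limit_free_transport[OF \<phi> n R])
  fix x :: "real \<times> real" assume x: "x \<in> quadrant"
  show "dens sol x * vel sol x ^ k = (rl * ul ^ k * indicator {0<..} (fst x - \<alpha> * snd x) * indicator {..0} (fst x - (R + \<alpha> * snd x))
        + rr * ur ^ k * indicator {0<..} (fst x - (R + \<beta> * snd x))) / fst x ^ (n - 1)"
    by (rule dens_mult_vel_power[OF x])
  \<comment> \<open>A state whose velocity differs from the speed of its edges has density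
    zero.\<close>
  have *: "rl * ul ^ (k + 1) = rl * ul ^ k * \<alpha>" "rr * ur ^ (k + 1) = rr * ur ^ k * \<beta>"
    using left_speed right_speed by auto
  show "dens sol x * vel sol x ^ (k + 1) = (rl * ul ^ k * \<alpha> * indicator {0<..} (fst x - \<alpha> * snd x) * indicator {..0} (fst x - (R + \<alpha> * snd x))
        + rr * ur ^ k * \<beta> * indicator {0<..} (fst x - (R + \<beta> * snd x))) / fst x ^ (n - 1)"
    unfolding dens_mult_vel_power[OF x] * ..
qed

lemma sol_weak: "weak_solution n R sol"
  unfolding weak_solution_def using weak_limit_moment by blast

text \<open>Nothing collides, so the energy balance holds with equality.\<close>

lemma sol_dissipative: "dissipative n R sol"
  unfolding dissipative_def
proof (intro allI impI exI[of _ 0] conjI)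
  fix \<phi> :: "real \<times> real \<Rightarrow> real" assume "test_function quadrant \<phi> \<and> (\<forall>x. 0 \<le> \<phi> x)"
  then have "weak_limit n (\<lambda>e x. 1 / 2 * (sw_dens R sol e x * sw_vel R sol e x ^ 2))
      (\<lambda>e x. 1 / 2 * (sw_dens R sol e x * sw_vel R sol e x ^ (2 + 1))) \<phi> (1 / 2 * 0)"
    by (intro weak_limit_scale weak_limit_moment) simp
  then show "weak_limit n (\<lambda>e x. 1 / 2 * sw_dens R sol e x * sw_vel R sol e x ^ 2)
      (\<lambda>e x. 1 / 2 * sw_dens R sol e x * sw_vel R sol e x ^ 3) \<phi> 0"
    by (simp add: mult.assoc del: sol_simps sw_eq)
qed simp

lemma open_sets: "open {x :: real \<times> real. fst x < a + c * snd x}" "open {x :: real \<times> real. a + c * snd x < fst x}"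
  by (intro open_Collect_less continuous_intros)+

lemma sol_regular: "regular_part R sol"
proof -
  let ?J = "jump_arcs sol"
  let ?l = "\<lambda>a c. {x :: real \<times> real. fst x < a + c * snd x}" and ?g = "\<lambda>a c. {x :: real \<times> real. a + c * snd x < fst x}"
  have quad: "0 < snd x" "R + \<alpha> * snd x \<le> R + \<beta> * snd x" if "x \<in> quadrant" for x
    using that curves_le[of "snd x"] by (auto simp: quadrant_def)
  have "piecewise_C1_off ?J (dens sol)"
  proof (rule piecewise_C1_offI[where C = "rl + rr" and N = "n - 1" and P = "{}"])
    fix x :: "real \<times> real" assume x: "x \<in> quadrant"
    show "\<bar>dens sol x\<bar> \<le> (rl + rr) / fst x ^ (n - 1)"
      using rl rr quad[OF x] x by (auto simp: indicator_def quadrant_def divide_right_mono)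
  next
    fix r t :: real assume rt: "0 < r" "0 < t"
    have le: "\<alpha> * t < R + \<alpha> * t" "R + \<alpha> * t \<le> R + \<beta> * t" using R rt curves_le[of t] by auto
    consider "r < \<alpha> * t" | "r = \<alpha> * t" | "\<alpha> * t < r" "r < R + \<alpha> * t" | "r = R + \<alpha> * t"
      | "R + \<alpha> * t < r" "r < R + \<beta> * t" | "R + \<alpha> * t < r" "r = R + \<beta> * t" | "R + \<beta> * t < r" by linarith
    then show "(\<exists>U c. open U \<and> (r, t) \<in> U \<and> (\<forall>x\<in>U \<inter> quadrant. dens sol x = c / fst x ^ (n - 1))) \<or>
      (\<exists>a b \<gamma> U c c'. (a, b, \<gamma>) \<in> ?J \<and> t \<in> arc_times a b \<and> r = \<gamma> t \<and> open U \<and> (r, t) \<in> U \<and>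
         (\<forall>x\<in>U \<inter> quadrant. (fst x < \<gamma> (snd x) \<longrightarrow> dens sol x = c / fst x ^ (n - 1)) \<and>
                               (\<gamma> (snd x) < fst x \<longrightarrow> dens sol x = c' / fst x ^ (n - 1))))"
    proof cases
      case 1
      then show ?thesis
        using open_sets(1)[of 0 \<alpha>] R
        by (intro disjI1 exI[of _ "?l 0 \<alpha>"] exI[of _ 0]) (auto simp: indicator_def dest!: quad)
    next
      case 2
      then have \<alpha>: "0 < \<alpha>" using rt by (simp add: zero_less_mult_iff)
      show ?thesis
      \<comment> \<open>With an empty left region the ray from the origin is not an arc, but then
        the density vanishes on both sides of it.\<close>
      proof (cases "rl = 0")
        case True
        then have "rl * z = 0" for z by simp
        then show ?thesis
          using open_sets(1)[of R \<beta>] 2 le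
          by (intro disjI1 exI[of _ "?l R \<beta>"] exI[of _ 0]) (auto simp: indicator_def)
      next
        case False
        then have "0 < rl" using rl by simp
        then show ?thesis
          using open_sets(1)[of R \<alpha>] 2 \<alpha> rt R
          by (intro disjI2 exI[of _ 0] exI[of _ \<infinity>] exI[of _ "\<lambda>t. \<alpha> * t"] exI[of _ "?l R \<alpha>"] exI[of _ rl])
            (auto simp: indicator_def arc_times_def dest!: quad)
      qed
    next
      case 3
      then show ?thesis
        using open_Int[OF open_sets(2)[of 0 \<alpha>] open_sets(1)[of R \<alpha>]]
        by (intro disjI1 exI[of _ "?g 0 \<alpha> \<inter> ?l R \<alpha>"] exI[of _ rl]) (auto simp: indicator_def dest!: quad)
    next
      case 4
      then have tm: "t \<in> arc_times 0 (line_life \<alpha>)" using rt by (simp add: line_time)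
      show ?thesis
      \<comment> \<open>Either both states touch along the common curve, or a vacuum gap has opened
        on its right.\<close>
      proof (cases "\<alpha> = \<beta>")
        case True
        have dens: "dens sol x = (rl * indicator {0<..} (fst x - \<alpha> * snd x) * indicator {..0} (fst x - (R + \<alpha> * snd x))
           + rr * indicator {0<..} (fst x - (R + \<alpha> * snd x))) / fst x ^ (n - 1)" for x
          unfolding sol_simps(1) unfolding True ..
        show ?thesis
          using 4 tm R open_sets(2)[of 0 \<alpha>]
          by (intro disjI2 exI[of _ 0] exI[of _ "line_life \<alpha>"] exI[of _ "\<lambda>t. R + \<alpha> * t"] exI[of _ "?g 0 \<alpha>"] exI[of _ rl] exI[of _ rr])
            (auto simp: dens indicator_def simp del: sol_simps(1))
      next
        case False
        then show ?thesis
          using 4 tm R curves_less[OF rt(2) False] open_Int[OF open_sets(2)[of 0 \<alpha>] open_sets(1)[of R \<beta>]]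
          by (intro disjI2 exI[of _ 0] exI[of _ "line_life \<alpha>"] exI[of _ "\<lambda>t. R + \<alpha> * t"] exI[of _ "?g 0 \<alpha> \<inter> ?l R \<beta>"]
              exI[of _ rl] exI[of _ 0])
            (auto simp: indicator_def dest!: quad)
      qed
    next
      case 5
      then show ?thesis
        using open_Int[OF open_sets(2)[of R \<alpha>] open_sets(1)[of R \<beta>]]
        by (intro disjI1 exI[of _ "?g R \<alpha> \<inter> ?l R \<beta>"] exI[of _ 0]) (auto simp: indicator_def)
    next
      case 6
      then have tm: "t \<in> arc_times 0 (line_life \<beta>)" using rt by (simp add: line_time)
      then show ?thesis
        using 6 open_sets(2)[of R \<alpha>]
        by (intro disjI2 exI[of _ 0] exI[of _ "line_life \<beta>"] exI[of _ "\<lambda>t. R + \<beta> * t"] exI[of _ "?g R \<alpha>"] exI[of _ 0] exI[of _ rr])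
          (auto simp: indicator_def)
    next
      case 7
      then show ?thesis
        using open_sets(2)[of R \<beta>]
        by (intro disjI1 exI[of _ "?g R \<beta>"] exI[of _ rr]) (auto simp: indicator_def dest!: quad)
    qed
  qed simp
  moreover have "piecewise_C1_off ?J (vel sol)"
  proof (rule piecewise_C1_offI[where C = "\<bar>ul\<bar> + \<bar>ur\<bar>" and N = 0 and P = "{}"])
    fix r t :: real assume rt: "0 < r" "0 < t"
    consider "R + \<alpha> * t < r" | "r < R + \<alpha> * t" | "r = R + \<alpha> * t" by linarith
    then show "(\<exists>U c. open U \<and> (r, t) \<in> U \<and> (\<forall>x\<in>U \<inter> quadrant. vel sol x = c / fst x ^ 0)) \<or>
      (\<exists>a b \<gamma> U c c'. (a, b, \<gamma>) \<in> ?J \<and> t \<in> arc_times a b \<and> r = \<gamma> t \<and> open U \<and> (r, t) \<in> U \<and>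
         (\<forall>x\<in>U \<inter> quadrant. (fst x < \<gamma> (snd x) \<longrightarrow> vel sol x = c / fst x ^ 0) \<and>
                               (\<gamma> (snd x) < fst x \<longrightarrow> vel sol x = c' / fst x ^ 0)))"
    proof cases
      case 1
      then show ?thesis
        using open_sets(2)[of R \<alpha>] by (intro disjI1 exI[of _ "?g R \<alpha>"] exI[of _ ur]) auto
    next
      case 2
      then show ?thesis
        using open_sets(1)[of R \<alpha>] by (intro disjI1 exI[of _ "?l R \<alpha>"] exI[of _ ul]) auto
    next
      case 3
      then have "t \<in> arc_times 0 (line_life \<alpha>)" using rt by (simp add: line_time)
      then show ?thesis
        using 3 by (intro disjI2 exI[of _ 0] exI[of _ "line_life \<alpha>"] exI[of _ "\<lambda>t. R + \<alpha> * t"] exI[of _ UNIV] exI[of _ ul] exI[of _ ur]) auto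
    qed
  qed auto
  moreover have "C1_arc A" if A: "A \<in> ?J" for A
  proof -
    have lin: "(\<lambda>t. a + c * t) C1_differentiable_on T" for a c :: real and T
      unfolding C1_differentiable_on_def
    proof (intro exI[of _ "\<lambda>_. c"] conjI ballI continuous_on_const)
      show "((\<lambda>t. a + c * t) has_vector_derivative c) (at x)" for x
        unfolding has_real_derivative_iff_has_vector_derivative[symmetric] by (auto intro!: derivative_eq_intros)
    qed
    have "ereal 0 < line_life c" for c using R by (simp add: line_life_def divide_pos_neg)
    then have line: "C1_arc (0, line_life c, \<lambda>t. R + c * t)" for c
      using lin[of R c] by (simp add: C1_arc_def line_time)
    have "C1_arc (0, \<infinity>, \<lambda>t. \<alpha> * t)" if "0 < \<alpha>"
      using that lin[of 0 \<alpha>] by (simp add: C1_arc_def arc_times_def)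
    with line show ?thesis using A by (auto split: if_splits)
  qed
  ultimately show ?thesis unfolding regular_part_def by simp
qed

lemma sol_origin: "origin_conditions n sol"
  unfolding origin_conditions_def
\<comment> \<open>The times when the two curves reach the origin. If a speed is zero, the quotient
  is 0 by convention and excludes no positive time.\<close>
proof (intro exI[of _ "{- R / \<alpha>, - R / \<beta>}"] conjI allI impI)
  fix t :: real assume t: "0 < t" "t \<notin> {- R / \<alpha>, - R / \<beta>}"
  have ne: "R + \<alpha> * t \<noteq> 0" "R + \<beta> * t \<noteq> 0"
  proof -
    have "t = - R / c" if "R + c * t = 0" for c
    proof -
      have "c \<noteq> 0" using that R by auto
      then show ?thesis using that by (simp add: field_simps)
    qed
    then show "R + \<alpha> * t \<noteq> 0" "R + \<beta> * t \<noteq> 0" using t by auto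
  qed
  have le: "R + \<alpha> * t \<le> R + \<beta> * t" using curves_le t by simp
  have op: "open {u. 0 < R + c * u}" "open {u. R + c * u < 0}" for c :: real
    by (intro open_Collect_less continuous_intros)+
  show "\<exists>v w. ((\<lambda>r. vel sol (r, t)) \<longlongrightarrow> v) (at_right 0) \<and>
               ((\<lambda>r. dens sol (r, t) * r ^ (n - 1)) \<longlongrightarrow> w) (at_right 0) \<and>
               (v > 0 \<longrightarrow> (origin_mass sol has_real_derivative 0) (at t) \<and>
                          ((\<lambda>r. dens sol (r, t)) \<longlongrightarrow> 0) (at_right 0)) \<and>
               (v < 0 \<longrightarrow> (\<exists>q. ((\<lambda>r. r ^ (n - 1) * sphere_area n * dens sol (r, t) * vel sol (r, t))
                                   \<longlongrightarrow> q) (at_right 0) \<and>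
                               (origin_mass sol has_real_derivative - q) (at t))) \<and>
               (v = 0 \<longrightarrow> (origin_mass sol has_real_derivative 0) (at t))"
  proof -
    consider "0 < R + \<alpha> * t" | "R + \<alpha> * t < 0" "0 < R + \<beta> * t" | "R + \<beta> * t < 0"
      using ne by linarith
    then show ?thesis
    proof cases
      case 1
      define e where "e = (if 0 < \<alpha> then \<alpha> * t else R + \<alpha> * t)"
      have "0 < e" using 1 t by (auto simp: e_def)
      then have ev: "\<forall>\<^sub>F r in at_right 0. 0 < r \<and> r < e"
        using eventually_at_right_real by (auto elim!: eventually_mono)
      have lt: "r < R + \<alpha> * t" "0 < \<alpha> \<Longrightarrow> r < \<alpha> * t" if "r < e" for r
        using that R by (auto simp: e_def split: if_splits)
      have neg: "\<alpha> * t < r" if "\<not> 0 < \<alpha>" "0 < r" for r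
        using that t mult_nonpos_nonneg[of \<alpha> t] by linarith
      let ?w = "if 0 < \<alpha> then 0 else rl"
      have "((\<lambda>u. sphere_area n * (rl * max 0 (- \<alpha>) * u)) has_real_derivative sphere_area n * (rl * max 0 (- \<alpha>))) (at t)"
        by (auto intro!: derivative_eq_intros)
      then have "(core_mass has_real_derivative sphere_area n * (rl * max 0 (- \<alpha>))) (at t)"
      proof (rule has_field_derivative_transform_within_open)
        show "open ({u. 0 < R + \<alpha> * u} \<inter> {0<..})" by (intro open_Int op) auto
        show "sphere_area n * (rl * max 0 (- \<alpha>) * u) = core_mass u" if "u \<in> {u. 0 < R + \<alpha> * u} \<inter> {0<..}" for u
        proof -
          have u: "0 < u" "0 < R + \<alpha> * u" using that by auto
          then have "0 < R + \<beta> * u" using curves_le[of u] by (meson less_imp_le less_le_trans)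
          with u have "max 0 (- \<beta> * u - R) = 0" "max 0 (min (- \<alpha> * u) R) = max 0 (- \<alpha>) * u"
            using mult_nonneg_nonneg[of \<alpha> u] mult_nonpos_nonneg[of \<alpha> u] by (auto simp: max_def min_def not_le)
          then show ?thesis unfolding core_mass_def by (simp only: mult.assoc) simp
        qed
      qed (use 1 t in auto)
      \<comment> \<open>For \<open>0 < \<alpha>\<close> a vacuum has opened at the origin and both
        sides are zero; otherwise \<open>\<alpha>\<close> may be replaced by \<open>ul\<close>
        wherever \<open>rl\<close> is nonzero.\<close>
      moreover have "sphere_area n * (rl * max 0 (- \<alpha>)) = - (sphere_area n * ?w * ul)"
        using left_speed by (auto simp: max_def)
      ultimately have d: "(origin_mass sol has_real_derivative - (sphere_area n * ?w * ul)) (at t)" by simp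
      show ?thesis
      proof (rule origin_condition_at[where v = ul and w = ?w, OF _ _ d])
        show "\<forall>\<^sub>F r in at_right 0. vel sol (r, t) = ul"
          using ev by eventually_elim (use lt in force)
        show "\<forall>\<^sub>F r in at_right 0. dens sol (r, t) = ?w / r ^ (n - 1)"
          using ev
        proof eventually_elim
          case (elim r)
          then show ?case using lt[of r] neg[of r] le by (auto simp: indicator_def)
        qed
        show "?w = 0" if "0 < ul" using that left_speed by auto
      qed
    next
      \<comment> \<open>The gap is at the origin: the whole left state, of weighted mass
        \<open>rl * R\<close>, has been absorbed and the right state has not yet arrived.\<close>
      case 2
      have "((\<lambda>u. sphere_area n * (rl * R)) has_real_derivative 0) (at t)" by simp
      then have d: "(core_mass has_real_derivative 0) (at t)"
      proof (rule has_field_derivative_transform_within_open)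
        show "open ({u. R + \<alpha> * u < 0} \<inter> {u. 0 < R + \<beta> * u})" by (intro open_Int op)
        show "sphere_area n * (rl * R) = core_mass u" if "u \<in> {u. R + \<alpha> * u < 0} \<inter> {u. 0 < R + \<beta> * u}" for u
          using that R by (simp add: core_mass_def)
      qed (use 2 in auto)
      have ev: "\<forall>\<^sub>F r in at_right 0. 0 < r \<and> r < R + \<beta> * t"
        using eventually_at_right_real[OF 2(2)] by (auto elim!: eventually_mono)
      show ?thesis
      proof (rule origin_condition_at[where v = ur and w = 0])
        show "\<forall>\<^sub>F r in at_right 0. vel sol (r, t) = ur" using ev by eventually_elim (use 2 in auto)
        show "\<forall>\<^sub>F r in at_right 0. dens sol (r, t) = 0 / r ^ (n - 1)"
          using ev by eventually_elim (use 2 in \<open>auto simp: indicator_def\<close>)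
      qed (use d in simp_all)
    next
      case 3
      have "((\<lambda>u. sphere_area n * (rl * R + rr * (- \<beta> * u - R))) has_real_derivative - (sphere_area n * rr * \<beta>)) (at t)"
        by (auto intro!: derivative_eq_intros)
      then have "(core_mass has_real_derivative - (sphere_area n * rr * \<beta>)) (at t)"
      proof (rule has_field_derivative_transform_within_open)
        show "open ({u. R + \<beta> * u < 0} \<inter> {0<..})" by (intro open_Int op) auto
        show "sphere_area n * (rl * R + rr * (- \<beta> * u - R)) = core_mass u" if "u \<in> {u. R + \<beta> * u < 0} \<inter> {0<..}" for u
        proof -
          have u: "0 \<le> u" "R + \<beta> * u < 0" using that by auto
          with curves_le[OF u(1)] have "R + \<alpha> * u < 0" by linarith
          with u R show ?thesis by (simp add: core_mass_def)
        qed
      qed (use 3 t in auto)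
      moreover have "sphere_area n * rr * \<beta> = sphere_area n * rr * ur" using right_speed by auto
      ultimately have d: "(origin_mass sol has_real_derivative - (sphere_area n * rr * ur)) (at t)" by simp
      show ?thesis
      proof (rule origin_condition_at[where v = ur and w = rr, OF _ _ d])
        show "\<forall>\<^sub>F r in at_right 0. vel sol (r, t) = ur"
          using eventually_at_right_less[of 0] by eventually_elim (use 3 le in auto)
        show "\<forall>\<^sub>F r in at_right 0. dens sol (r, t) = rr / r ^ (n - 1)"
          using eventually_at_right_less[of 0] by eventually_elim (use 3 le in \<open>auto simp: indicator_def\<close>)
        \<comment> \<open>A curve that started at \<open>R\<close> has passed the origin, so its
          speed is negative.\<close>
        have "\<beta> < 0"
        proof (rule ccontr)
          assume "\<not> \<beta> < 0"
          then have "0 \<le> \<beta> * t" using t by simp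
          then show False using 3 R by linarith
        qed
        then show "rr = 0" if "0 < ur" using that right_speed by auto
      qed
    qed
  qed
qed auto

lemma core_mass_cont: "isCont core_mass t"
proof -
  have "continuous_on UNIV core_mass" unfolding core_mass_def[abs_def] by (intro continuous_intros)
  then show ?thesis by (simp add: continuous_on_eq_continuous_at)
qed

lemma sol_absorption: "origin_absorption n R sol"
  unfolding origin_absorption_def using core_mass_cont by simp

lemma core_mass_0: "(origin_mass sol \<longlongrightarrow> 0) (at_right 0)"
proof -
  have "core_mass 0 = 0" using R by (simp add: core_mass_def)
  then show ?thesis using core_mass_cont[of 0] by (auto simp: isCont_def intro: tendsto_within_subset)
qed

lemma sol_physical: "physical sol"
  unfolding physical_def
  using rl rr sphere_area_nonneg[OF n] by (auto simp: quadrant_def indicator_def core_mass_def)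

lemma
  shows initial_dens_limit: "initial_limit (sw_dens R sol) (initial_dens n R rl rr)"
    and initial_vel_limit: "initial_limit (sw_vel R sol) (\<lambda>r. if r < R then ul else ur)"
proof -
  have lim: "((\<lambda>t. a + c * t) \<longlongrightarrow> a) (at_right 0)" for a c :: real by (auto intro!: tendsto_eq_intros)
  have side: "\<forall>\<^sub>F t in at_right 0. (r < a + c * t \<longleftrightarrow> r < a) \<and> r \<noteq> a + c * t" if "r \<noteq> a" for a c r :: real
  proof (cases "r < a")
    case True
    show ?thesis using order_tendstoD(1)[OF lim True, of c] by eventually_elim (use True in auto)
  next
    case False
    then have "a < r" using that by simp
    from order_tendstoD(2)[OF lim this, of c] show ?thesis by eventually_elim (use False in auto)
  qed
  \<comment> \<open>without a front, the layer is placed around \<open>-1\<close>, outside the half-line\<close>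
  have nolayer: "\<forall>\<^sub>F t in at_right (0::real). \<forall>\<^sub>F e in at_right 0. \<forall>r>0. f (r, t) = (if \<bar>r - (-1)\<bar> < e / 2 then 0 else f (r, t))"
    for f :: "real \<times> real \<Rightarrow> real"
  proof (rule always_eventually, rule allI)
    fix t :: real
    have "\<forall>\<^sub>F e in at_right (0::real). e < 1" by (rule order_tendstoD(2)[OF tendsto_ident_at]) simp
    then show "\<forall>\<^sub>F e in at_right 0. \<forall>r>0. f (r, t) = (if \<bar>r - (-1)\<bar> < e / 2 then 0 else f (r, t))"
      by eventually_elim auto
  qed
  show "initial_limit (sw_dens R sol) (initial_dens n R rl rr)"
  proof (rule initial_limitI[where g = "dens sol" and X = "\<lambda>_. -1" and c = "\<lambda>_ _. 0"
        and \<kappa> = "\<lambda>_. 0" and C = "rl + rr" and N = "n - 1" and R = R])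
    show "\<bar>dens sol (r, t)\<bar> \<le> (rl + rr) / r ^ (n - 1)" if "0 < r" for r t
      using that rl rr by (auto simp: indicator_def divide_right_mono)
    show "((\<lambda>t. dens sol (r, t)) \<longlongrightarrow> initial_dens n R rl rr r) (at_right 0)" if "0 < r" "r \<noteq> R" for r
    proof (rule tendsto_eventually)
      have "r \<noteq> 0" using that by simp
      from side[OF this, of \<alpha>] side[OF that(2), of \<alpha>] side[OF that(2), of \<beta>]
      show "\<forall>\<^sub>F t in at_right 0. dens sol (r, t) = initial_dens n R rl rr r"
        by eventually_elim (use that in \<open>auto simp: initial_dens_eq[OF n] indicator_def\<close>)
    qed
  qed (use n nolayer in \<open>auto simp del: sol_simps\<close>)
  show "initial_limit (sw_vel R sol) (\<lambda>r. if r < R then ul else ur)"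
  proof (rule initial_limitI[where g = "vel sol" and X = "\<lambda>_. -1" and c = "\<lambda>_ _. 0"
        and \<kappa> = "\<lambda>t. 0" and C = "\<bar>ul\<bar> + \<bar>ur\<bar>" and N = 0 and R = R])
    show "((\<lambda>t. vel sol (r, t)) \<longlongrightarrow> (if r < R then ul else ur)) (at_right 0)" if "0 < r" "r \<noteq> R" for r
      by (rule tendsto_eventually) (use side[OF that(2), of \<alpha>] in \<open>eventually_elim, auto\<close>)
    show "\<bar>vel sol (r, t)\<bar> \<le> (\<bar>ul\<bar> + \<bar>ur\<bar>) / r ^ 0" for r t by simp
  qed (use nolayer in \<open>auto simp del: sol_simps\<close>)
qed

text \<open>The three possible curves are the inner edge of the left state and the two edges facing
  each other. All bound a vacuum, except when the states move together; then the facing edges merge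
  into one contact discontinuity.\<close>

lemma sol_waves: "wave_structure R sol"
  unfolding wave_structure_def
proof (intro allI impI)
  fix t :: real assume t: "0 < t"
  let ?g0 = "\<lambda>t. \<alpha> * t" and ?g1 = "\<lambda>t. R + \<alpha> * t" and ?g2 = "\<lambda>t. R + \<beta> * t"
  have le: "?g0 t < ?g1 t" "?g1 t \<le> ?g2 t" using R t curves_le[of t] by auto
  have D: "((\<lambda>t. c * t) has_real_derivative c) (at t)" "((\<lambda>t. a + c * t) has_real_derivative c) (at t)" for a c
    by (auto intro!: derivative_eq_intros)
  have below: "\<forall>\<^sub>F r in at_left a. b < r \<and> r < a" if "b < a" for a b :: real
    using eventually_at_left_real[OF that] by (auto elim!: eventually_mono)
  have above: "\<forall>\<^sub>F r in at_right a. a < r \<and> r < b" if "a < b" for a b :: real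
    using eventually_at_right_real[OF that] by (auto elim!: eventually_mono)
  have lem: "a - 1 < a" for a :: real by simp
  define C where "C = (if ul = ur \<and> \<alpha> = \<beta> then {?g1} \<inter> massless_curves R sol t else {})"
  define V where "V = massless_curves R sol t - C"
  have sub: "massless_curves R sol t \<subseteq> {?g0, ?g1, ?g2}"
    by (auto simp: massless_curves_def split: if_splits)
  have v0: "vacuum_shock sol ?g0 t" if "0 < \<alpha>" "0 < rl"
  proof -
    have "\<forall>\<^sub>F r in at_left (?g0 t). dens sol (r, t) = 0"
      using below[OF lem] by eventually_elim (use le in \<open>auto simp: indicator_def\<close>)
    moreover have "((\<lambda>r. vel sol (r, t)) \<longlongrightarrow> ul) (at_right (?g0 t))"
      by (rule tendsto_eventually) (use above[OF le(1)] in \<open>eventually_elim, auto\<close>)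
    then have "((\<lambda>r. vel sol (r, t)) \<longlongrightarrow> \<alpha>) (at_right (?g0 t))"
      using left_speed that by (simp del: sol_simps)
    ultimately show ?thesis unfolding vacuum_shock_def using D by blast
  qed
  have right1: "vacuum_shock sol ?g1 t" if "\<alpha> = ul" "rr = 0 \<or> ?g1 t < ?g2 t"
  proof -
    have "\<forall>\<^sub>F r in at_right (?g1 t). dens sol (r, t) = 0"
    proof (cases "rr = 0")
      case True
      then have z: "rr * z = 0" for z by simp
      show ?thesis using above[OF less_add_one] by eventually_elim (use z in \<open>auto simp: indicator_def\<close>)
    next
      case False
      then have "?g1 t < ?g2 t" using that by simp
      from above[OF this] show ?thesis by eventually_elim (auto simp: indicator_def)
    qed
    moreover have "((\<lambda>r. vel sol (r, t)) \<longlongrightarrow> ul) (at_left (?g1 t))"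
      by (rule tendsto_eventually) (use below[OF le(1)] in \<open>eventually_elim, auto\<close>)
    then have "((\<lambda>r. vel sol (r, t)) \<longlongrightarrow> \<alpha>) (at_left (?g1 t))" using that(1) by (simp del: sol_simps)
    ultimately show ?thesis unfolding vacuum_shock_def using D by blast
  qed
  have left2: "vacuum_shock sol ?g2 t" if "\<beta> = ur" "rl = 0 \<or> ?g1 t < ?g2 t"
  proof -
    have "\<forall>\<^sub>F r in at_left (?g2 t). dens sol (r, t) = 0"
    proof (cases "rl = 0")
      case True
      then have z: "rl * z = 0" for z by simp
      show ?thesis using below[OF lem] by eventually_elim (use z in \<open>auto simp: indicator_def\<close>)
    next
      case False
      then have "?g1 t < ?g2 t" using that by simp
      from below[OF this] show ?thesis by eventually_elim (auto simp: indicator_def)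
    qed
    moreover have "((\<lambda>r. vel sol (r, t)) \<longlongrightarrow> ur) (at_right (?g2 t))"
      by (rule tendsto_eventually) (use above[OF less_add_one] in \<open>eventually_elim, use le in auto\<close>)
    then have "((\<lambda>r. vel sol (r, t)) \<longlongrightarrow> \<beta>) (at_right (?g2 t))" using that(1) by (simp del: sol_simps)
    ultimately show ?thesis unfolding vacuum_shock_def using D by blast
  qed
  have "contact_discontinuity sol ?g1 t" if "ul = ur" "\<alpha> = \<beta>"
  proof -
    have \<alpha>: "\<alpha> = ul" using that speeds by auto
    have vel: "vel sol x = ul" for x by (subst sol_simps(2)) (use that(1) in auto)
    show ?thesis
      unfolding contact_discontinuity_def vel using D(2)[where c = \<alpha>] unfolding \<alpha>
      by (intro exI[of _ ul] conjI tendsto_const)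
  qed
  then have C: "\<forall>\<gamma>\<in>C. contact_discontinuity sol \<gamma> t" by (auto simp: C_def)
  have V: "vacuum_shock sol \<gamma> t" if "\<gamma> \<in> V" for \<gamma>
  proof -
    have \<gamma>: "\<gamma> \<in> massless_curves R sol t" "\<gamma> \<notin> C" using that by (auto simp: V_def)
    then consider "\<gamma> = ?g0" "0 < \<alpha>" "0 < rl" | "\<gamma> = ?g1 \<or> \<gamma> = ?g2"
      by (auto simp: massless_curves_def split: if_splits)
    then show ?thesis
    proof cases
      case 1 then show ?thesis using v0 by simp
    next
      case 2
      \<comment> \<open>The possible configurations: a gap between the states, equal velocities, an
        empty right state, or an empty left state. In the second one the curve belongs to
        \<open>C\<close>; in the last two the vacuum side is where the density coefficient is
        zero.\<close>
      from speeds consider "\<alpha> = ul" "\<beta> = ur" "\<alpha> < \<beta>" | "\<alpha> = ul" "ul = ur" "\<alpha> = \<beta>"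
        | "rr = 0" "\<alpha> = ul" "\<alpha> = \<beta>" | "rl = 0" "\<beta> = ur" "\<alpha> = \<beta>" by fastforce
      then show ?thesis
      proof cases
        case 1
        then show ?thesis using 2 right1 left2 curves_less[OF t] by auto
      next
        case two: 2
        then have "\<gamma> \<in> C" using 2 \<gamma>(1) by (auto simp: C_def)
        then show ?thesis using \<gamma>(2) by simp
      next
        case 3
        then show ?thesis using 2 right1 by auto
      next
        case 4
        then show ?thesis using 2 left2 by auto
      qed
    qed
  qed
  have "card V \<le> card {?g0, ?g1, ?g2}" using sub by (intro card_mono) (auto simp: V_def)
  also have "\<dots> \<le> 3" by (auto simp: card_insert_if)
  finally have "card V \<le> 3" .
  moreover have "finite V" by (rule finite_subset[of _ "{?g0, ?g1, ?g2}"]) (use sub in \<open>auto simp: V_def\<close>)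
  moreover have "finite C" "card C \<le> 1"
    unfolding C_def using card_mono[of "{?g1}" "{?g1} \<inter> massless_curves R sol t"] by auto
  moreover have "massless_curves R sol t = C \<union> V" by (auto simp: C_def V_def)
  ultimately show "\<exists>C V. massless_curves R sol t = C \<union> V \<and>
        finite C \<and> card C \<le> 1 \<and> (\<forall>\<gamma>\<in>C. contact_discontinuity sol \<gamma> t) \<and>
        finite V \<and> card V \<le> 3 \<and> (\<forall>\<gamma>\<in>V. vacuum_shock sol \<gamma> t)"
    using C V by blast
qed

lemma free_flow_solution:
  "sdw_solution n R (initial_dens n R rl rr) (\<lambda>r. if r < R then ul else ur) sol \<and>
     physical sol \<and> dissipative n R sol \<and> wave_structure R sol"
  unfolding sdw_solution_def
  using sol_regular sol_weak sol_origin sol_absorption initial_dens_limit initial_vel_limit core_mass_0 sol_physical sol_dissipative sol_waves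
  by (simp del: sol_simps(1,2,4,5) sw_eq)

end

section \<open>Construction of the front\<close>

text \<open>The two one-sided difference quotients have the same limit. It is needed because the
  front must be differentiable also at \<open>t1\<close>, where its formula changes.\<close>

lemma has_real_derivative_join:
  assumes f: "(f has_real_derivative D) (at c)" and g: "(g has_real_derivative D) (at c)" and eq: "f c = g c"
  shows "((\<lambda>t. if t \<le> c then f t else g t) has_real_derivative D) (at (c :: real))"
  unfolding has_field_derivative_iff
proof (rule filterlim_split_at)
  have "((\<lambda>y. (f y - f c) / (y - c)) \<longlongrightarrow> D) (at_left c)"
    using f unfolding has_field_derivative_iff by (rule tendsto_within_subset) simp
  then show "((\<lambda>y. ((if y \<le> c then f y else g y) - (if c \<le> c then f c else g c)) / (y - c)) \<longlongrightarrow> D) (at_left c)"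
    by (rule Lim_transform_eventually) (auto simp: eventually_at_filter intro!: always_eventually)
  have "((\<lambda>y. (g y - g c) / (y - c)) \<longlongrightarrow> D) (at_right c)"
    using g unfolding has_field_derivative_iff by (rule tendsto_within_subset) simp
  then show "((\<lambda>y. ((if y \<le> c then f y else g y) - (if c \<le> c then f c else g c)) / (y - c)) \<longlongrightarrow> D) (at_right c)"
    by (rule Lim_transform_eventually) (auto simp: eq eventually_at_filter intro!: always_eventually)
qed

text \<open>The explicit profiles are glued at \<open>t1\<close>: \<open>hit\<close> matches the
  positions, the choice of \<open>K\<close> the speeds, and \<open>Q t1 = m1\<close> the masses.
  Only the rates of change of speed and mass jump there.\<close>

lemma delta_front_exists:
  fixes n :: nat and R rl rr ul ur :: real
  assumes n: "1 \<le> n" and R: "0 < R" and rl: "0 < rl" and rr: "0 < rr" and u: "ur < ul"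
  obtains t1 B X s s' m where "delta_front n R rl rr ul ur t1 B X s s' m"
proof -
  define a b where "a = sqrt rl" and "b = sqrt rr"
  have ab: "0 < a" "0 < b" "a * a = rl" "b * b = rr" using rl rr by (simp_all add: a_def b_def)
  define w where "w = (a * ul + b * ur) / (a + b)"
  define \<delta> where "\<delta> = ul - ur"
  have \<delta>: "0 < \<delta>" using u by (simp add: \<delta>_def)
  have w1: "ul - w = b * \<delta> / (a + b)" and w2: "w - ur = a * \<delta> / (a + b)"
    using ab by (simp_all add: w_def \<delta>_def field_simps)
  have "0 < ul - w" "0 < w - ur" unfolding w1 w2 using ab \<delta> by simp_all
  then have w_less: "w < ul" "ur < w" by simp_all
  \<comment> \<open>The front gains on the left edge from behind: their initial distance
    \<open>R\<close> shrinks at the rate \<open>ul - w\<close>.\<close>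
  define t1 where "t1 = R / (ul - w)"
  have t1: "0 < t1" using R w_less by (simp add: t1_def)
  have hit: "R + w * t1 = ul * t1" using w_less by (simp add: t1_def field_simps)
  \<comment> \<open>The mass gathered up to \<open>t1\<close>; the constant rate
    \<open>a * b * \<delta>\<close> is confirmed in \<open>rate\<close>.\<close>
  define m1 where "m1 = a * b * \<delta> * t1"
  \<comment> \<open>momentum relative to \<open>ur\<close>, conserved after \<open>t1\<close> because then only the right state flows in\<close>
  define K where "K = m1 * (w - ur)"
  have m1: "0 < m1" using ab \<delta> t1 by (simp add: m1_def)
  have K: "0 < K" using m1 w_less by (simp add: K_def)
  \<comment> \<open>The square of the mass after \<open>t1\<close>, from
    \<open>(m^2)' = 2 * m * m' = 2 * rr * K\<close>.\<close>
  define q where "q t = m1 ^ 2 + 2 * rr * K * (t - t1)" for t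
  define Q where "Q t = sqrt (q t)" for t
  have q_pos: "m1 ^ 2 \<le> q t" if "t1 \<le> t" for t using that rr K by (simp add: q_def)
  have Q_ge: "m1 \<le> Q t" if "t1 \<le> t" for t
    unfolding Q_def using q_pos[OF that] by (rule real_le_rsqrt)
  have Q_pos: "0 < Q t" if "t1 \<le> t" for t using Q_ge[OF that] m1 by linarith
  \<comment> \<open>The real square root is extended to negative arguments as an odd increasing
    function, so this holds also at times where \<open>q\<close> is negative.\<close>
  have Q_mono: "Q t \<le> Q t'" if "t \<le> t'" for t t'
    using that rr K by (simp add: Q_def q_def)
  have Q_t1: "Q t1 = m1" using m1 by (simp add: Q_def q_def)
  have Q_deriv: "(Q has_real_derivative rr * K / Q t) (at t)" if "t1 \<le> t" for t
  proof -
    have "0 < m1 ^ 2" using m1 by simp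
    then have 1: "0 < q t" using q_pos[OF that] by linarith
    have 2: "(q has_real_derivative 2 * rr * K) (at t)"
      unfolding q_def[abs_def] by (auto intro!: derivative_eq_intros)
    have "((\<lambda>t. sqrt (q t)) has_real_derivative (inverse (sqrt (q t)) / 2) * (2 * rr * K)) (at t)"
      by (rule DERIV_chain2[OF DERIV_real_sqrt[OF 1] 2])
    moreover have "(inverse (sqrt (q t)) / 2) * (2 * rr * K) = rr * K / sqrt (q t)"
      using 1 by (simp add: field_simps)
    ultimately show ?thesis unfolding Q_def[abs_def] by (simp only:)
  qed
  define m where "m t = (if t \<le> t1 then a * b * \<delta> * t else Q t)" for t
  define s where "s t = (if t \<le> t1 then w else ur + K / Q t)" for t
  \<comment> \<open>The strict inequality gives the right-hand value at \<open>t1\<close>, in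
    agreement with the left inflow, which is switched off at \<open>t1\<close>; so the momentum
    balance holds there too.\<close>
  define s' where "s' t = (if t < t1 then 0 else - (K * (rr * K / Q t)) / (Q t * Q t))" for t
  \<comment> \<open>After \<open>t1\<close> the speed is \<open>ur + K / Q t\<close>, and
    \<open>K / Q t\<close> is the derivative of \<open>Q t / rr\<close>.\<close>
  define X where "X t = (if t \<le> t1 then R + w * t else ul * t1 + ur * (t - t1) + (Q t - m1) / rr)" for t
  have s_t1: "ur + K / Q t1 = w" using m1 by (simp add: Q_t1 K_def)
  have s_after: "s t = ur + K / Q t" if "t1 \<le> t" for t
    using that s_t1 by (cases "t = t1") (auto simp: s_def)
  have m_after: "m t = Q t" if "t1 \<le> t" for t
    using that Q_t1 by (cases "t = t1") (auto simp: m_def m1_def)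
  have s_le: "s t \<le> w" for t
  proof (cases "t \<le> t1")
    case False
    then have "K / Q t \<le> K / m1" using K m1 Q_ge[of t] by (intro divide_left_mono) auto
    then show ?thesis using False s_t1 by (simp add: s_def Q_t1)
  qed (simp add: s_def)
  have s_gt: "ur < s t" for t using w_less K Q_pos[of t] by (simp add: s_def)
  have Qinv_deriv: "((\<lambda>t. ur + K / Q t) has_real_derivative s' t) (at t)" if "t1 \<le> t" for t
    using DERIV_add[OF DERIV_const DERIV_divide[OF DERIV_const Q_deriv[OF that]]] Q_pos[OF that] that
    by (simp add: s'_def)
  have X_deriv: "(X has_real_derivative s t) (at t)" for t
  proof -
    have left: "((\<lambda>t. R + w * t) has_real_derivative w) (at t)" for t by (auto intro!: derivative_eq_intros)
    have right: "((\<lambda>t. ul * t1 + ur * (t - t1) + (Q t - m1) / rr) has_real_derivative ur + K / Q t) (at t)" if "t1 \<le> t" for t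
      using rr by (auto intro!: derivative_eq_intros Q_deriv[OF that])
    consider "t < t1" | "t = t1" | "t1 < t" by linarith
    then show ?thesis
    proof cases
      case 1
      show ?thesis
        using has_field_derivative_transform_within_open[OF left open_lessThan[of t1], of t X] 1 by (simp add: s_def X_def)
    next
      case 2
      have "((\<lambda>t. if t \<le> t1 then R + w * t else ul * t1 + ur * (t - t1) + (Q t - m1) / rr) has_real_derivative w) (at t1)"
        by (rule has_real_derivative_join[OF left]) (use right[of t1, unfolded s_t1] hit in \<open>simp_all add: Q_t1\<close>)
      then show ?thesis using 2 by (simp add: X_def[abs_def] s_def)
    next
      case 3
      then show ?thesis
        using has_field_derivative_transform_within_open[OF right open_greaterThan[of t1], of t X] by (simp add: s_def X_def)
    qed
  qed
  have Q_cont: "continuous_on UNIV Q" unfolding Q_def[abs_def] q_def by (intro continuous_intros)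
  have split: "continuous_on UNIV (\<lambda>t. if t \<le> t1 then f t else g t)"
    if "continuous_on {..t1} f" "continuous_on {t1..} g" "f t1 = g t1" for f g :: "real \<Rightarrow> real"
  proof -
    have "continuous_on ({..t1} \<union> {t1..}) (\<lambda>t. if t \<le> t1 then f t else g t)"
      by (rule continuous_on_If) (use that in auto)
    moreover have "{..t1} \<union> {t1..} = UNIV" by auto
    ultimately show ?thesis by simp
  qed
  \<comment> \<open>The bound on the acceleration comes from
    \<open>\<bar>s' t\<bar> = rr * K^2 / Q t ^ 3\<close> and \<open>Q t \<ge> m1\<close> after
    \<open>t1\<close>.\<close>
  have "delta_front n R rl rr ul ur t1 (K * rr * K / (m1 * m1 * m1)) X s s' m"
  proof
    show "X 0 = R" using t1 by (simp add: X_def)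
    show "(X has_real_derivative s t) (at t)" for t by (rule X_deriv)
    show "continuous_on UNIV s"
      unfolding s_def[abs_def] by (rule split)
        (use Q_pos s_t1 in \<open>force intro!: continuous_intros continuous_on_subset[OF Q_cont]\<close>)+
    show "ur < s t" for t by (rule s_gt)
    show "s t < ul" for t using s_le[of t] w_less by linarith
    show "s t' \<le> s t" if "t \<le> t'" for t t'
    proof (cases "t \<le> t1")
      case True
      then show ?thesis using s_le[of t'] by (simp add: s_def)
    next
      case False
      then have "K / Q t' \<le> K / Q t" using K Q_pos[of t] Q_pos[of t'] Q_mono[OF that] that by (intro divide_left_mono) auto
      then show ?thesis using False that by (simp add: s_def)
    qed
    have X_t1: "X t1 = ul * t1" using hit by (simp add: X_def)
    have decr: "((\<lambda>t. X t - ul * t) has_real_derivative s t - ul) (at t)" and neg: "s t - ul < 0" for t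
      using s_le[of t] w_less by (auto intro!: derivative_eq_intros X_deriv)
    show "ul * t < X t" if "t < t1" for t
      using DERIV_neg_imp_decreasing[OF that, of "\<lambda>t. X t - ul * t"] decr neg X_t1 by force
    show "X t \<le> ul * t" if "t1 \<le> t" for t
      using DERIV_nonpos_imp_nonincreasing[OF that, of "\<lambda>t. X t - ul * t"] decr neg X_t1 by (force intro: less_imp_le)
    show "continuous_on UNIV m"
      unfolding m_def[abs_def]
      by (rule split) (auto intro!: continuous_intros continuous_on_subset[OF Q_cont] simp: Q_t1 m1_def)
    show "m 0 = 0" using t1 by (simp add: m_def)
    show "0 < m t" if "0 < t" for t using that ab \<delta> Q_pos[of t] by (simp add: m_def)
    have rate: "rl * (ul - w) + rr * (w - ur) = a * b * \<delta>" "rl * ul * (ul - w) + rr * ur * (w - ur) = a * b * \<delta> * w"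
    proof -
      \<comment> \<open>The fractions of the incoming mass that stem from the left and from the
        right; \<open>w\<close> is the mean velocity with these weights, so the incoming mass brings
        exactly the momentum needed to keep the speed.\<close>
      define p q where "p = a / (a + b)" and "q = b / (a + b)"
      have e: "rl * (ul - w) = a * b * \<delta> * p" "rr * (w - ur) = a * b * \<delta> * q"
        unfolding w1 w2 ab(3,4)[symmetric] p_def q_def by simp_all
      have pq: "p + q = 1" using ab by (simp add: p_def q_def add_divide_distrib[symmetric])
      have pq': "ul * p + ur * q = w" by (simp add: p_def q_def w_def add_divide_distrib mult.commute)
      have "a * b * \<delta> * p + a * b * \<delta> * q = a * b * \<delta> * (p + q)" by (simp only: distrib_left)
      then show "rl * (ul - w) + rr * (w - ur) = a * b * \<delta>" unfolding e pq by simp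
      have "rl * ul * (ul - w) + rr * ur * (w - ur) = ul * (rl * (ul - w)) + ur * (rr * (w - ur))"
        by (simp only: mult_ac)
      also have "\<dots> = a * b * \<delta> * (ul * p + ur * q)" unfolding e by (simp only: distrib_left mult_ac)
      finally show "rl * ul * (ul - w) + rr * ur * (w - ur) = a * b * \<delta> * w" unfolding pq' .
    qed
    show "(m has_real_derivative (if t < t1 then rl * (ul - s t) else 0) + rr * (s t - ur)) (at t)" if "t \<noteq> t1" for t
    proof (cases "t < t1")
      case True
      have "((\<lambda>t. a * b * \<delta> * t) has_real_derivative a * b * \<delta>) (at t)" by (auto intro!: derivative_eq_intros)
      from has_field_derivative_transform_within_open[OF this open_lessThan[of t1], of m]
      show ?thesis using True rate(1) by (simp add: m_def s_def)
    next
      case False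
      then have "t1 < t" using that by simp
      with has_field_derivative_transform_within_open[OF Q_deriv open_greaterThan[of t1], of t m]
      show ?thesis by (simp add: m_def s_def)
    qed
    show "(s has_real_derivative s' t) (at t)" if "t \<noteq> t1" for t
    proof (cases "t < t1")
      case True
      from has_field_derivative_transform_within_open[OF DERIV_const open_lessThan[of t1], of t w s]
      show ?thesis using True by (simp add: s_def s'_def)
    next
      case False
      then have "t1 < t" using that by simp
      with has_field_derivative_transform_within_open[OF Qinv_deriv open_greaterThan[of t1], of t s]
      show ?thesis by (simp add: s_def)
    qed
    show "((if t < t1 then rl * (ul - s t) else 0) + rr * (s t - ur)) * s t + m t * s' t
          = (if t < t1 then rl * ul * (ul - s t) else 0) + rr * ur * (s t - ur)" for t
    proof (cases "t < t1")
      case True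
      then show ?thesis using rate by (simp add: s_def s'_def)
    next
      case False
      then have t: "t1 \<le> t" by simp
      show ?thesis
        using False Q_pos[OF t] by (simp add: s_after[OF t] m_after[OF t] s'_def field_simps)
    qed
    show "continuous_on (- {t1}) s'"
    proof -
      have "continuous_on {..<t1} s'"
        by (rule continuous_on_eq[where f = "\<lambda>_. 0"]) (auto simp: s'_def)
      moreover have nz: "Q t \<noteq> 0" if "t1 < t" for t using Q_pos[of t] that by simp
      have "continuous_on {t1<..} s'"
        by (rule continuous_on_eq[where f = "\<lambda>t. - (K * (rr * K / Q t)) / (Q t * Q t)"])
          (use nz in \<open>auto simp: s'_def intro!: continuous_intros continuous_on_subset[OF Q_cont]\<close>)
      ultimately have "continuous_on ({..<t1} \<union> {t1<..}) s'" by (intro continuous_on_open_Un) auto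
      moreover have "{..<t1} \<union> {t1<..} = - {t1}" by auto
      ultimately show ?thesis by simp
    qed
    show "\<bar>s' t\<bar> \<le> K * rr * K / (m1 * m1 * m1)" for t
    proof (cases "t < t1")
      case True
      then show ?thesis using K rr m1 by (simp add: s'_def)
    next
      case False
      then have t: "t1 \<le> t" by simp
      have "\<bar>s' t\<bar> = K * rr * K / (Q t * Q t * Q t)"
        using False K rr Q_pos[OF t] by (simp add: s'_def abs_mult)
      also have "\<dots> \<le> K * rr * K / (m1 * m1 * m1)"
      proof (rule divide_left_mono)
        have "m1 * m1 \<le> Q t * Q t" using m1 Q_ge[OF t] by (intro mult_mono) auto
        then show "m1 * m1 * m1 \<le> Q t * Q t * Q t" using m1 Q_ge[OF t] by (intro mult_mono) auto
      qed (use K rr m1 Q_pos[OF t] in simp_all)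
      finally show ?thesis .
    qed
  qed (use n R rl rr t1 in auto)
  then show thesis by (rule that)
qed

theorem proposition6p3:
  fixes n :: nat and R \<rho>\<^sub>l \<rho>\<^sub>r u\<^sub>l u\<^sub>r :: real
  assumes "1 \<le> n" and "0 < R" and "0 \<le> \<rho>\<^sub>l" and "0 \<le> \<rho>\<^sub>r"
  shows "\<exists>S. sdw_solution n R
               (\<lambda>r. if r < R then \<rho>\<^sub>l * r powi (1 - int n) else \<rho>\<^sub>r * r powi (1 - int n))
               (\<lambda>r. if r < R then u\<^sub>l else u\<^sub>r) S \<and>
             physical S \<and> dissipative n R S \<and> wave_structure R S"
proof (cases "u\<^sub>r < u\<^sub>l \<and> 0 < \<rho>\<^sub>l \<and> 0 < \<rho>\<^sub>r")
  case True
  then obtain t1 B X s s' m where "delta_front n R \<rho>\<^sub>l \<rho>\<^sub>r u\<^sub>l u\<^sub>r t1 B X s s' m"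
    using delta_front_exists[OF assms(1,2)] by blast
  from delta_front.delta_front_solution[OF this] show ?thesis
    unfolding initial_dens_def by blast
next
  case False
  \<comment> \<open>If \<open>u\<^sub>r < u\<^sub>l\<close> here, one density vanishes: both edges
    take the left velocity if the right state is empty, and the right velocity otherwise.\<close>
  define \<alpha> where "\<alpha> = (if u\<^sub>l \<le> u\<^sub>r \<or> \<rho>\<^sub>r = 0 then u\<^sub>l else u\<^sub>r)"
  define \<beta> where "\<beta> = (if u\<^sub>l \<le> u\<^sub>r \<or> \<rho>\<^sub>r \<noteq> 0 then u\<^sub>r else u\<^sub>l)"
  have "free_flow n R \<rho>\<^sub>l \<rho>\<^sub>r u\<^sub>l u\<^sub>r \<alpha> \<beta>"
    by unfold_locales (use assms False in \<open>auto simp: \<alpha>_def \<beta>_def\<close>)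
  from free_flow.free_flow_solution[OF this] show ?thesis
    unfolding initial_dens_def by blast
qed

end
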